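(* Let $\theta\in H^\infty$ be inner, let $\phi,\psi\in L^\infty$ be unimodular with $\overline\psi\phi=A_-\overline\theta+A_+\theta$ for some $A_+\in H^\infty$, $A_-\in\overline{H^\infty}$, such that neither $\phi\overline\psi$ nor $\overline\phi\psi$ is a constant multiple of $\theta$, and let $M=\phi K_\theta\oplus\psi K_\theta$. Then the essential spectrum $\sigma_e(T^M_z)$ of the dual-band shift is contained in $\mathbb T$ and depends only on $\theta$, not on $A_+$ or $A_-$; precisely, $$\sigma_e(T^M_z)=\sigma_e(A^\theta_z)=\Bigl\{\lambda\in\mathbb T:\ \liminf_{z\to\lambda,\,z\in\mathbb D}|\theta(z)|=0\Bigr\}.$$
   Context: All function spaces are on the unit circle $\mathbb T$; $H^2,H^\infty$ are the Hardy spaces of the unit disc $\mathbb D$; $\overline{H^\infty}$ is the set of complex conjugates of functions in $H^\infty$. For $\theta$ inner, $K_\theta=H^2\ominus\theta H^2$, $P_\theta$ is the orthogonal projection from $L^2=L^2(\mathbb T)$ onto $K_\theta$, and $A^\theta_zf=P_\theta(zf)$ for $f\in K_\theta$. The condition $\overline\psi\phi=A_-\overline\theta+A_+\theta$ implies $\phi K_\theta\perp\psi K_\theta$, and $M=\phi K_\theta\oplus\psi K_\theta$ is a closed subspace of $L^2$ with orthogonal projection $P_M$. The dual-band shift is $T^M_zf=P_M(zf)$ for $f\in M$. $\sigma_e(T)$ is the set of $\lambda\in\mathbb C$ such that $T-\lambda I$ is not Fredholm. *)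

theory Defs
  imports "HOL-Probability.Probability"
begin

section \<open>The space \<open>L\<^sup>2\<close> of the unit circle\<close>

text \<open>Normalised arc length, as a Borel probability measure on the plane concentrated on the
  unit circle.\<close>

definition circle_measure :: "complex measure" where
  "circle_measure = distr (uniform_measure lborel {0..2 * pi}) borel cis"

lemma cis_borel_measurable: "cis \<in> borel_measurable borel"
  by (intro borel_measurable_continuous_onI continuous_intros)

lemma cnj_borel_measurable [measurable]: "cnj \<in> borel_measurable borel"
  by (intro borel_measurable_continuous_onI continuous_intros)

lemma sets_circle_measure [measurable_cong, simp]: "sets circle_measure = sets borel"
  by (simp add: circle_measure_def)

lemma space_circle_measure [simp]: "space circle_measure = UNIV"
  by (simp add: circle_measure_def)

lemma prob_space_circle_measure: "prob_space circle_measure"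
  unfolding circle_measure_def
  by (intro prob_space.prob_space_distr prob_space_uniform_measure)
     (simp_all add: cis_borel_measurable measurable_cong_sets[OF sets_uniform_measure refl])

lemma AE_circle_norm: "AE z in circle_measure. norm z = 1"
  unfolding circle_measure_def
  by (subst AE_distr_iff) (simp_all add: cis_borel_measurable measurable_cong_sets[OF sets_uniform_measure refl])

definition square_integrable :: "(complex \<Rightarrow> complex) \<Rightarrow> bool" where
  "square_integrable f \<longleftrightarrow>
     f \<in> borel_measurable circle_measure \<and> integrable circle_measure (\<lambda>z. (norm (f z))\<^sup>2)"

definition Linf :: "(complex \<Rightarrow> complex) set" where
  "Linf = {f \<in> borel_measurable circle_measure. \<exists>B. AE z in circle_measure. norm (f z) \<le> B}"

lemma square_integrable_0: "square_integrable (\<lambda>_. 0)"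
  by (simp add: square_integrable_def)

lemma square_integrable_add:
  assumes "square_integrable f" "square_integrable g"
  shows "square_integrable (\<lambda>z. f z + g z)"
proof -
  have [measurable]: "f \<in> borel_measurable circle_measure" "g \<in> borel_measurable circle_measure"
    using assms by (auto simp: square_integrable_def)
  have "integrable circle_measure (\<lambda>z. 2 * (norm (f z))\<^sup>2 + 2 * (norm (g z))\<^sup>2)"
    using assms by (auto simp: square_integrable_def)
  then have "integrable circle_measure (\<lambda>z. (norm (f z + g z))\<^sup>2)"
  proof (rule Bochner_Integration.integrable_bound)
    have "(norm (f z + g z))\<^sup>2 \<le> 2 * (norm (f z))\<^sup>2 + 2 * (norm (g z))\<^sup>2" for z
    proof -
      have "(norm (f z + g z))\<^sup>2 \<le> (norm (f z) + norm (g z))\<^sup>2"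
        by (intro power_mono norm_triangle_ineq) auto
      also have "\<dots> \<le> 2 * (norm (f z))\<^sup>2 + 2 * (norm (g z))\<^sup>2"
        using sum_squares_bound[of "norm (f z)" "norm (g z)"] by (simp add: power2_sum)
      finally show ?thesis .
    qed
    then show "AE z in circle_measure. norm ((norm (f z + g z))\<^sup>2)
        \<le> norm (2 * (norm (f z))\<^sup>2 + 2 * (norm (g z))\<^sup>2)"
      by simp
  qed measurable
  then show ?thesis
    by (simp add: square_integrable_def)
qed

lemma square_integrable_mult_Linf:
  assumes "\<phi> \<in> Linf" "square_integrable f"
  shows "square_integrable (\<lambda>z. \<phi> z * f z)"
proof -
  have [measurable]: "\<phi> \<in> borel_measurable circle_measure" "f \<in> borel_measurable circle_measure"
    using assms by (auto simp: square_integrable_def Linf_def)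
  obtain B where B: "AE z in circle_measure. norm (\<phi> z) \<le> B"
    using assms by (auto simp: Linf_def)
  have "integrable circle_measure (\<lambda>z. B\<^sup>2 * (norm (f z))\<^sup>2)"
    using assms by (auto simp: square_integrable_def)
  then have "integrable circle_measure (\<lambda>z. (norm (\<phi> z * f z))\<^sup>2)"
  proof (rule Bochner_Integration.integrable_bound)
    show "AE z in circle_measure. norm ((norm (\<phi> z * f z))\<^sup>2) \<le> norm (B\<^sup>2 * (norm (f z))\<^sup>2)"
      using B by eventually_elim (simp add: norm_mult power_mult_distrib power_mono mult_right_mono)
  qed measurable
  then show ?thesis
    by (simp add: square_integrable_def)
qed

lemma Linf_const: "(\<lambda>_. c) \<in> Linf"
  by (auto simp: Linf_def)

lemma Linf_id: "(\<lambda>z. z) \<in> Linf"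
  using AE_circle_norm by (auto simp: Linf_def intro!: exI[of _ 1] elim: eventually_mono)

lemma square_integrable_scale: "square_integrable f \<Longrightarrow> square_integrable (\<lambda>z. c * f z)"
  by (rule square_integrable_mult_Linf[OF Linf_const])

lemma square_integrable_uminus: "square_integrable f \<Longrightarrow> square_integrable (\<lambda>z. - f z)"
  using square_integrable_scale[of f "-1"] by simp

lemma integrable_mult_cnj:
  assumes "square_integrable f" "square_integrable g"
  shows "integrable circle_measure (\<lambda>z. f z * cnj (g z))"
proof -
  have [measurable]: "f \<in> borel_measurable circle_measure" "g \<in> borel_measurable circle_measure"
    using assms by (auto simp: square_integrable_def)
  have "integrable circle_measure (\<lambda>z. (norm (f z))\<^sup>2 + (norm (g z))\<^sup>2)"
    using assms by (auto simp: square_integrable_def)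
  then show ?thesis
  proof (rule Bochner_Integration.integrable_bound)
    have "norm (f z) * norm (g z) \<le> (norm (f z))\<^sup>2 + (norm (g z))\<^sup>2" for z
      using sum_squares_bound[of "norm (f z)" "norm (g z)"]
        mult_nonneg_nonneg[OF norm_ge_zero[of "f z"] norm_ge_zero[of "g z"]] by linarith
    then show "AE z in circle_measure. norm (f z * cnj (g z))
        \<le> norm ((norm (f z))\<^sup>2 + (norm (g z))\<^sup>2)"
      by (simp add: norm_mult)
  qed measurable
qed

definition L2_rel :: "(complex \<Rightarrow> complex) \<Rightarrow> (complex \<Rightarrow> complex) \<Rightarrow> bool" where
  "L2_rel f g \<longleftrightarrow>
     square_integrable f \<and> square_integrable g \<and> (AE z in circle_measure. f z = g z)"

lemma part_equivp_L2_rel: "part_equivp L2_rel"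
proof (rule part_equivpI)
  show "\<exists>f. L2_rel f f"
    by (auto simp: L2_rel_def intro!: exI[of _ "\<lambda>_. 0"] square_integrable_0)
  show "symp L2_rel"
    by (auto simp: symp_def L2_rel_def elim: eventually_mono)
  show "transp L2_rel"
    by (auto simp: transp_def L2_rel_def elim: eventually_elim2)
qed

quotient_type L2 = "complex \<Rightarrow> complex" / partial: L2_rel
  by (rule part_equivp_L2_rel)

lift_definition scaleC :: "complex \<Rightarrow> L2 \<Rightarrow> L2" (infixr \<open>*\<^sub>C\<close> 75) is "\<lambda>c f z. c * f z"
  by (auto simp: L2_rel_def intro: square_integrable_scale elim: eventually_mono)

text \<open>The complex inner product, linear in the first argument.\<close>

lift_definition cinner :: "L2 \<Rightarrow> L2 \<Rightarrow> complex" is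
  "\<lambda>f g. \<integral>z. f z * cnj (g z) \<partial>circle_measure"
proof -
  fix f1 f2 g1 g2 assume *: "L2_rel f1 f2" "L2_rel g1 g2"
  have "AE z in circle_measure. f1 z = f2 z" "AE z in circle_measure. g1 z = g2 z"
    using * by (auto simp: L2_rel_def)
  then have "AE z in circle_measure. f1 z * cnj (g1 z) = f2 z * cnj (g2 z)"
    by eventually_elim simp
  moreover have "integrable circle_measure (\<lambda>z. f1 z * cnj (g1 z))"
      "integrable circle_measure (\<lambda>z. f2 z * cnj (g2 z))"
    using * by (auto simp: L2_rel_def intro: integrable_mult_cnj)
  ultimately show "(\<integral>z. f1 z * cnj (g1 z) \<partial>circle_measure) = (\<integral>z. f2 z * cnj (g2 z) \<partial>circle_measure)"
    by (intro integral_cong_AE borel_measurable_integrable)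
qed

text \<open>The real Hilbert space structure has inner product \<open>Re (cinner f g)\<close>; it induces the norm
  and the topology of \<open>L\<^sup>2\<close>.\<close>

instantiation L2 :: real_inner
begin

lift_definition zero_L2 :: L2 is "\<lambda>_. 0"
  by (simp add: L2_rel_def square_integrable_0)

lift_definition plus_L2 :: "L2 \<Rightarrow> L2 \<Rightarrow> L2" is "\<lambda>f g z. f z + g z"
  by (auto simp: L2_rel_def intro: square_integrable_add elim: eventually_elim2)

lift_definition uminus_L2 :: "L2 \<Rightarrow> L2" is "\<lambda>f z. - f z"
  by (auto simp: L2_rel_def intro: square_integrable_uminus elim: eventually_mono)

definition minus_L2 :: "L2 \<Rightarrow> L2 \<Rightarrow> L2" where "minus_L2 f g = f + - g"

definition scaleR_L2 :: "real \<Rightarrow> L2 \<Rightarrow> L2" where "scaleR_L2 r f = complex_of_real r *\<^sub>C f"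

definition inner_L2 :: "L2 \<Rightarrow> L2 \<Rightarrow> real" where "inner_L2 f g = Re (cinner f g)"

definition norm_L2 :: "L2 \<Rightarrow> real" where "norm_L2 f = sqrt (inner f f)"

definition dist_L2 :: "L2 \<Rightarrow> L2 \<Rightarrow> real" where "dist_L2 f g = norm (f - g)"

definition sgn_L2 :: "L2 \<Rightarrow> L2" where "sgn_L2 f = scaleR (inverse (norm f)) f"

definition uniformity_L2 :: "(L2 \<times> L2) filter" where
  "uniformity_L2 = (INF e\<in>{0 <..}. principal {(x, y). dist x y < e})"

definition open_L2 :: "L2 set \<Rightarrow> bool" where
  "open_L2 U \<longleftrightarrow> (\<forall>x\<in>U. eventually (\<lambda>(x', y). x' = x \<longrightarrow> y \<in> U) uniformity)"

instance
proof
  fix f g h :: L2 and a b r :: real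
  show "f + g + h = f + (g + h)"
    by transfer (auto simp: L2_rel_def algebra_simps intro!: square_integrable_add)
  show "f + g = g + f"
    by transfer (auto simp: L2_rel_def algebra_simps intro!: square_integrable_add)
  show "0 + f = f"
    by transfer (auto simp: L2_rel_def)
  show "- f + f = 0"
    by transfer (auto simp: L2_rel_def square_integrable_0)
  show "f - g = f + - g"
    by (simp add: minus_L2_def)
  show "a *\<^sub>R (f + g) = a *\<^sub>R f + a *\<^sub>R g"
    unfolding scaleR_L2_def
    by transfer (auto simp: L2_rel_def distrib_left distrib_right mult.assoc
        intro!: square_integrable_add square_integrable_scale)
  show "(a + b) *\<^sub>R f = a *\<^sub>R f + b *\<^sub>R f"
    unfolding scaleR_L2_def
    by transfer (auto simp: L2_rel_def distrib_left distrib_right mult.assoc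
        intro!: square_integrable_add square_integrable_scale)
  show "a *\<^sub>R b *\<^sub>R f = (a * b) *\<^sub>R f"
    unfolding scaleR_L2_def
    by transfer (auto simp: L2_rel_def mult.assoc intro!: square_integrable_scale)
  show "1 *\<^sub>R f = f"
    unfolding scaleR_L2_def by transfer (auto simp: L2_rel_def)
  show "inner f g = inner g f"
  proof -
    have "cinner f g = cnj (cinner g f)"
      by transfer (subst Bochner_Integration.integral_cnj[symmetric],
          simp add: mult.commute del: Bochner_Integration.integral_cnj)
    then show ?thesis
      by (simp add: inner_L2_def)
  qed
  show "inner (f + g) h = inner f h + inner g h"
  proof -
    have "cinner (f + g) h = cinner f h + cinner g h"
      by transfer (auto simp: L2_rel_def distrib_right intro!: Bochner_Integration.integral_add
          integrable_mult_cnj)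
    then show ?thesis
      by (simp add: inner_L2_def)
  qed
  show "inner (r *\<^sub>R f) g = r * inner f g"
  proof -
    have "cinner (r *\<^sub>R f) g = complex_of_real r * cinner f g"
      unfolding scaleR_L2_def by transfer (simp add: mult.assoc)
    then show ?thesis
      by (simp add: inner_L2_def)
  qed
  have self: "Re (\<integral>z. k z * cnj (k z) \<partial>circle_measure) = (\<integral>z. (norm (k z))\<^sup>2 \<partial>circle_measure)"
    for k :: "complex \<Rightarrow> complex"
    by (simp only: complex_norm_square[symmetric] integral_complex_of_real Re_complex_of_real)
  show "0 \<le> inner f f"
    unfolding inner_L2_def by transfer (simp add: self)
  show "(inner f f = 0) = (f = 0)"
    unfolding inner_L2_def
  proof transfer
    fix k :: "complex \<Rightarrow> complex" assume "L2_rel k k"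
    then have "square_integrable k"
      by (simp add: L2_rel_def)
    then show "(Re (\<integral>z. k z * cnj (k z) \<partial>circle_measure) = 0) = L2_rel k (\<lambda>_. 0)"
      unfolding self
      by (subst integral_nonneg_eq_0_iff_AE)
        (auto simp: L2_rel_def square_integrable_def square_integrable_0)
  qed
  show "dist f g = norm (f - g)"
    by (simp add: dist_L2_def)
  show "sgn f = scaleR (inverse (norm f)) f"
    by (simp add: sgn_L2_def)
  show "norm f = sqrt (inner f f)"
    by (simp add: norm_L2_def)
  show "(uniformity :: (L2 \<times> L2) filter) = (INF e\<in>{0 <..}. principal {(x, y). dist x y < e})"
    by (simp add: uniformity_L2_def)
  fix U :: "L2 set"
  show "open U \<longleftrightarrow> (\<forall>x\<in>U. eventually (\<lambda>(x', y). x' = x \<longrightarrow> y \<in> U) uniformity)"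
    by (simp add: open_L2_def)
qed

end

text \<open>The complex vector space structure; \<open>L2.span\<close> is the complex linear span.\<close>

interpretation L2: vector_space scaleC
proof
  fix a b :: complex and f g :: L2
  show "a *\<^sub>C (f + g) = a *\<^sub>C f + a *\<^sub>C g"
    by transfer (auto simp: L2_rel_def distrib_left distrib_right mult.assoc
        intro!: square_integrable_add square_integrable_scale)
  show "(a + b) *\<^sub>C f = a *\<^sub>C f + b *\<^sub>C f"
    by transfer (auto simp: L2_rel_def distrib_left distrib_right mult.assoc
        intro!: square_integrable_add square_integrable_scale)
  show "a *\<^sub>C b *\<^sub>C f = (a * b) *\<^sub>C f"
    by transfer (auto simp: L2_rel_def mult.assoc intro!: square_integrable_scale)
  show "1 *\<^sub>C f = f"
    by transfer (auto simp: L2_rel_def)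
qed

text \<open>Multiplication by an \<open>L\<^sup>\<infinity>\<close> function. Symbols are represented by functions rather than by
  classes; a symbol outside \<open>L\<^sup>\<infinity>\<close> gives the junk value 0.\<close>

lift_definition mult_L2 :: "(complex \<Rightarrow> complex) \<Rightarrow> L2 \<Rightarrow> L2" is
  "\<lambda>\<phi> f. if \<phi> \<in> Linf then (\<lambda>z. \<phi> z * f z) else (\<lambda>_. 0)"
  by (auto simp: L2_rel_def square_integrable_0 intro: square_integrable_mult_Linf
      elim: eventually_mono)

section \<open>Hardy spaces and model spaces\<close>

definition fourier :: "(complex \<Rightarrow> complex) \<Rightarrow> int \<Rightarrow> complex" where
  "fourier f n = (\<integral>z. f z * cnj (z powi n) \<partial>circle_measure)"

lift_definition fourier_L2 :: "L2 \<Rightarrow> int \<Rightarrow> complex" is fourier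
  unfolding fourier_def L2_rel_def square_integrable_def
proof (intro ext, elim conjE)
  fix f g :: "complex \<Rightarrow> complex" and n :: int
  assume [measurable]: "f \<in> borel_measurable circle_measure" "g \<in> borel_measurable circle_measure"
    and fg: "AE z in circle_measure. f z = g z"
  have [measurable]: "(\<lambda>z. z powi n) \<in> borel_measurable (borel :: complex measure)"
    unfolding power_int_def by measurable
  have "(\<lambda>z. cnj (z powi n)) \<in> borel_measurable circle_measure"
    by measurable
  then show "(\<integral>z. f z * cnj (z powi n) \<partial>circle_measure)
      = (\<integral>z. g z * cnj (z powi n) \<partial>circle_measure)"
    using fg by (intro integral_cong_AE) (auto elim: eventually_mono)
qed

text \<open>The Hardy spaces, as spaces of boundary functions on the circle: those whose Fourier
  coefficients of negative index vanish.\<close>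

definition H2 :: "L2 set" where
  "H2 = {f. \<forall>n<0. fourier_L2 f n = 0}"

definition Hinf :: "(complex \<Rightarrow> complex) set" where
  "Hinf = {f \<in> Linf. \<forall>n<0. fourier f n = 0}"

definition unimodular :: "(complex \<Rightarrow> complex) \<Rightarrow> bool" where
  "unimodular f \<longleftrightarrow> f \<in> Linf \<and> (AE z in circle_measure. norm (f z) = 1)"

definition inner_fun :: "(complex \<Rightarrow> complex) \<Rightarrow> bool" where
  "inner_fun \<theta> \<longleftrightarrow> \<theta> \<in> Hinf \<and> unimodular \<theta>"

text \<open>The holomorphic function in the unit disc with boundary function \<open>f \<in> H\<^sup>\<infinity>\<close>; meaningful for
  \<open>norm z < 1\<close>.\<close>

definition disc_ext :: "(complex \<Rightarrow> complex) \<Rightarrow> complex \<Rightarrow> complex" where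
  "disc_ext f z = (\<Sum>n. fourier f (int n) * z ^ n)"

definition model_space :: "(complex \<Rightarrow> complex) \<Rightarrow> L2 set" where
  "model_space \<theta> = {f \<in> H2. \<forall>g\<in>H2. cinner f (mult_L2 \<theta> g) = 0}"

text \<open>The orthogonal projection onto a closed subspace \<open>M\<close>.\<close>

definition orth_proj :: "L2 set \<Rightarrow> L2 \<Rightarrow> L2" where
  "orth_proj M f = (THE g. g \<in> M \<and> (\<forall>h\<in>M. cinner (f - g) h = 0))"

text \<open>The compression of multiplication by \<open>z\<close> to a closed subspace \<open>M\<close>: it is the truncated shift
  for \<open>M = model_space \<theta>\<close> and the dual-band shift for \<open>M = dual_band_space \<phi> \<psi> \<theta>\<close>.\<close>

definition compressed_shift :: "L2 set \<Rightarrow> L2 \<Rightarrow> L2" where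
  "compressed_shift M f = orth_proj M (mult_L2 (\<lambda>z. z) f)"

definition dual_band_space ::
  "(complex \<Rightarrow> complex) \<Rightarrow> (complex \<Rightarrow> complex) \<Rightarrow> (complex \<Rightarrow> complex) \<Rightarrow> L2 set" where
  "dual_band_space \<phi> \<psi> \<theta> =
     {mult_L2 \<phi> f + mult_L2 \<psi> g | f g. f \<in> model_space \<theta> \<and> g \<in> model_space \<theta>}"

section \<open>Essential spectrum\<close>

text \<open>For a bounded operator \<open>T\<close> on a closed subspace \<open>M\<close>, of which only the values on \<open>M\<close> matter:
  finite-dimensional kernel, closed range, and range of finite codimension in \<open>M\<close>.\<close>

definition fredholm_on :: "L2 set \<Rightarrow> (L2 \<Rightarrow> L2) \<Rightarrow> bool" where
  "fredholm_on M T \<longleftrightarrow>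
     (\<exists>B. finite B \<and> {f \<in> M. T f = 0} \<subseteq> L2.span B) \<and>
     closedin (top_of_set M) (T ` M) \<and>
     (\<exists>B\<subseteq>M. finite B \<and> M \<subseteq> L2.span (T ` M \<union> B))"

definition essential_spectrum :: "L2 set \<Rightarrow> (L2 \<Rightarrow> L2) \<Rightarrow> complex set" where
  "essential_spectrum M T = {\<mu>. \<not> fredholm_on M (\<lambda>f. T f - \<mu> *\<^sub>C f)}"

end

theory Submission
  imports Defs "HOL-Complex_Analysis.Complex_Analysis"
begin

text \<open>For \<open>x \<in> K\<^sub>\<theta>\<close> the function \<open>z x\<close> leaves \<open>K\<^sub>\<theta>\<close> only in the direction \<open>\<theta>\<close>. Since
  \<open>\<phi> K\<^sub>\<theta>\<close> and \<open>\<psi> K\<^sub>\<theta>\<close> are orthogonal, \<open>T\<^sub>z\<^sup>M\<close> is therefore a finite-rank perturbation of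
  the direct sum of two copies of the truncated shift \<open>A\<close>. Off the circle, compressions of
  multiplication by \<open>1 / (z - \<mu>)\<close> invert \<open>A - \<mu>\<close> up to finite rank. If \<open>\<bar>\<mu>\<bar> = 1\<close> and \<open>\<theta>(w\<^sub>n)\<close> tends to \<open>0\<close>
  for some \<open>w\<^sub>n\<close> tending to \<open>\<mu>\<close>, the normalised reproducing kernels at \<open>w\<^sub>n\<close> are a weakly null
  sequence on which the adjoint of \<open>A - \<mu>\<close> tends to \<open>0\<close>. If \<open>\<bar>\<theta>\<bar>\<close> is bounded below near \<open>\<mu>\<close>, then
  \<open>1 - \<bar>\<theta>(w)\<bar>\<^sup>2 \<le> C (1 - \<bar>w\<bar>\<^sup>2)\<close> there; the Cauchy--Schwarz inequality for reproducing kernels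
  makes \<open>g = (\<theta> - c) / (z - \<mu>)\<close> bounded for a suitable \<open>c\<close>, and compressing multiplication by
  \<open>g\<close> inverts \<open>A - \<mu>\<close> up to the factor \<open>- c\<close>.\<close>

section \<open>Hilbert space geometry of \<open>L\<^sup>2\<close>\<close>

text \<open>The two directions use different halves of Fredholmness. To prove it, a finite set
  spanning the kernel and a finite set whose annihilator lies in the range suffice; the range is
  then closed automatically. To refute it, only finite codimension of the range is contradicted.
  Finite-rank perturbations are therefore carried along as explicit vectors.

  The obstacle is the estimate for \<open>1 - \<bar>\<theta>(w)\<bar>\<^sup>2\<close> near \<mu>. On
  the circle the modulus of \<theta> is 1 only almost everywhere, so the maximum principle cannot
  simply be applied to \<open>1 / \<theta>\<close> up to the boundary. Cauchy's formula on
  rectangles in logarithmic coordinates, pulled slightly into the disc, replaces it: the error on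
  the side near the circle is an arc mean of \<open>1 - \<bar>\<theta>\<bar>\<^sup>2\<close>, which
  vanishes as the rectangle moves out. This gives a bound for all powers of a quotient that does not
  depend on the exponent, hence the bound 1 for the quotient.

  No radial limit of \<theta> at \<mu> is presupposed: \<open>c\<close> comes from a cluster value
  of \<theta> along the radius to \<mu>, obtained by compactness and nonzero by the
  estimate.\<close>

lemma cinner_add_left: "cinner (f + g) h = cinner f h + cinner g h"
  by transfer (auto simp: L2_rel_def distrib_right intro!: Bochner_Integration.integral_add
      integrable_mult_cnj)

lemma cinner_commute: "cinner f g = cnj (cinner g f)"
  by transfer (subst Bochner_Integration.integral_cnj[symmetric],
      simp add: mult.commute del: Bochner_Integration.integral_cnj)

lemma cinner_scaleC_left [simp]: "cinner (c *\<^sub>C f) g = c * cinner f g"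
  by transfer (simp add: mult.assoc)

lemma cinner_scaleC_right [simp]: "cinner f (c *\<^sub>C g) = cnj c * cinner f g"
  by (metis cinner_commute cinner_scaleC_left complex_cnj_mult)

lemma cinner_add_right: "cinner f (g + h) = cinner f g + cinner f h"
  by (metis cinner_commute cinner_add_left complex_cnj_add)

lemma scaleR_eq_scaleC: "r *\<^sub>R f = complex_of_real r *\<^sub>C f"
  by (simp add: scaleR_L2_def)

lemma cinner_self: "cinner f f = complex_of_real ((norm f)\<^sup>2)"
proof (rule complex_eqI)
  show "Re (cinner f f) = Re (complex_of_real ((norm f)\<^sup>2))"
    by (simp add: power2_norm_eq_inner inner_L2_def)
  have "Im (cinner f f) = - Im (cinner f f)"
    by (subst cinner_commute) simp
  then show "Im (cinner f f) = Im (complex_of_real ((norm f)\<^sup>2))"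
    by simp
qed

lemma norm_scaleC [simp]: "norm (c *\<^sub>C f) = cmod c * norm f"
proof -
  have "complex_of_real ((norm (c *\<^sub>C f))\<^sup>2) = (c * cnj c) * cinner f f"
    by (simp only: cinner_self[symmetric] cinner_scaleC_left cinner_scaleC_right mult.assoc
        mult.left_commute[of "cnj c"])
  also have "\<dots> = complex_of_real ((cmod c * norm f)\<^sup>2)"
    by (simp only: cinner_self complex_norm_square[symmetric] power_mult_distrib of_real_mult)
  finally have "complex_of_real ((norm (c *\<^sub>C f))\<^sup>2) = complex_of_real ((cmod c * norm f)\<^sup>2)" .
  then have "(norm (c *\<^sub>C f))\<^sup>2 = (cmod c * norm f)\<^sup>2"
    using of_real_eq_iff by blast
  then show ?thesis
    by (simp add: power2_eq_iff_nonneg)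
qed

text \<open>The Cauchy--Schwarz inequality of \<open>real_inner\<close> controls only the real part.
  Multiplying \<open>f\<close> by a unimodular scalar makes the complex product real and nonnegative
  without changing norms.\<close>

lemma cinner_bound: "cmod (cinner f g) \<le> norm f * norm g"
proof (cases "cinner f g = 0")
  case False
  define c where "c = cnj (sgn (cinner f g))"
  have c: "cmod c = 1" using False by (simp add: c_def norm_sgn)
  have "cinner (c *\<^sub>C f) g = of_real (cmod (cinner f g))"
    using False complex_norm_square[of "cinner f g"]
    by (simp add: c_def sgn_div_norm scaleR_conv_of_real field_simps power2_eq_square)
  then have "cmod (cinner f g) = inner (c *\<^sub>C f) g"
    by (simp add: inner_L2_def)
  also have "\<dots> \<le> norm (c *\<^sub>C f) * norm g"
    by (rule norm_cauchy_schwarz)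
  finally show ?thesis by (simp add: c)
qed simp

lemma bounded_bilinear_cinner: "bounded_bilinear cinner"
  by (rule bounded_bilinear.intro)
     (auto simp: cinner_add_left cinner_add_right scaleR_eq_scaleC scaleR_conv_of_real
       intro!: exI[of _ 1] cinner_bound)

interpretation cinner: bounded_bilinear cinner
  by (rule bounded_bilinear_cinner)

lemmas cinner_simps [simp] = cinner.zero_left cinner.zero_right cinner.add_left cinner.add_right
  cinner.diff_left cinner.diff_right cinner.minus_left cinner.minus_right

lemma norm_add_orthogonal:
  assumes "cinner f g = 0"
  shows "(norm (f + g))\<^sup>2 = (norm f)\<^sup>2 + (norm g)\<^sup>2"
proof -
  have "cinner g f = 0"
    using assms by (subst cinner_commute) simp
  then have "complex_of_real ((norm (f + g))\<^sup>2) = complex_of_real ((norm f)\<^sup>2 + (norm g)\<^sup>2)"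
    using assms by (simp add: cinner_self[symmetric] del: of_real_power) 
  then show ?thesis
    using of_real_eq_iff by blast
qed

lemma cinner_self_eq_0 [simp]: "cinner f f = 0 \<longleftrightarrow> f = 0"
  by (simp add: cinner_self)

section \<open>Representatives of classes and completeness of \<open>L2\<close>\<close>

lemma square_integrable_measurable: "square_integrable f \<Longrightarrow> f \<in> borel_measurable borel"
  unfolding square_integrable_def using measurable_cong_sets[OF sets_circle_measure refl] by auto

lemma L2_cases:
  obtains f where "square_integrable f" "X = abs_L2 f"
proof (induction X rule: L2.abs_induct)
  case (1 y)
  then show ?case by (auto simp: L2_rel_def)
qed

lemma L2_rel_refl: "L2_rel f f \<longleftrightarrow> square_integrable f"
  by (auto simp: L2_rel_def)

lemma abs_L2_diff:
  assumes "square_integrable f" "square_integrable g"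
  shows "abs_L2 f - abs_L2 g = abs_L2 (\<lambda>z. f z - g z)"
  using assms by (simp add: minus_L2_def uminus_L2.abs_eq plus_L2.abs_eq L2_rel_refl
      square_integrable_uminus)

lemma norm_abs_L2:
  assumes "square_integrable f"
  shows "(norm (abs_L2 f))\<^sup>2 = (\<integral>z. (cmod (f z))\<^sup>2 \<partial>circle_measure)"
proof -
  have "complex_of_real ((norm (abs_L2 f))\<^sup>2) = (\<integral>z. f z * cnj (f z) \<partial>circle_measure)"
    using assms by (simp only: cinner_self[symmetric] cinner.abs_eq L2_rel_refl)
  also have "\<dots> = complex_of_real (\<integral>z. (cmod (f z))\<^sup>2 \<partial>circle_measure)"
    by (simp only: complex_norm_square[symmetric] integral_complex_of_real)
  finally show ?thesis
    using of_real_eq_iff by blast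
qed

lemma square_integrable_diff:
  "square_integrable f \<Longrightarrow> square_integrable g \<Longrightarrow> square_integrable (\<lambda>z. f z - g z)"
  using square_integrable_add[of f "\<lambda>z. - g z"] square_integrable_uminus[of g] by simp

interpretation circle: prob_space circle_measure
  by (rule prob_space_circle_measure)

lemma square_integrable_imp_integrable:
  assumes "square_integrable f"
  shows "integrable circle_measure f"
proof -
  have "square_integrable (\<lambda>_. 1)" by (simp add: square_integrable_def)
  from integrable_mult_cnj[OF assms this] show ?thesis by simp
qed

text \<open>Cauchy--Schwarz against the constant function 1, which has norm 1 because the measure is
  a probability measure.\<close>

lemma integral_norm_le_norm_L2:
  assumes "square_integrable f"
  shows "(\<integral>z. cmod (f z) \<partial>circle_measure) \<le> norm (abs_L2 f)"
proof -
  have [measurable]: "f \<in> borel_measurable borel"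
    using assms by (auto simp: square_integrable_def)
  have 1: "square_integrable (\<lambda>z. of_real (cmod (f z)))"
    using assms by (auto simp: square_integrable_def)
  have 2: "square_integrable (\<lambda>_. 1)" by (simp add: square_integrable_def)
  have n1: "(norm (abs_L2 (\<lambda>_. 1)))\<^sup>2 = 1"
    using norm_abs_L2[OF 2] by (simp add: circle.prob_space[simplified])
  then have n1: "norm (abs_L2 (\<lambda>_. 1)) = 1"
    using norm_ge_zero by (simp add: power2_eq_1_iff)
       (metis norm_ge_zero le_minus_one_simps(3))
  have "cinner (abs_L2 (\<lambda>z. of_real (cmod (f z)))) (abs_L2 (\<lambda>_. 1))
      = complex_of_real (\<integral>z. cmod (f z) \<partial>circle_measure)"
    using 1 2 by (simp add: cinner.abs_eq L2_rel_refl)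
  then have "(\<integral>z. cmod (f z) \<partial>circle_measure) \<le> norm (abs_L2 (\<lambda>z. of_real (cmod (f z)))) * 1"
    using cinner_bound[of "abs_L2 (\<lambda>z. of_real (cmod (f z)))" "abs_L2 (\<lambda>_. 1)"]
    unfolding n1 by (metis abs_ge_self norm_of_real order_trans)
  also have "norm (abs_L2 (\<lambda>z. of_real (cmod (f z)))) = norm (abs_L2 f)"
    by (rule power2_eq_imp_eq) (simp_all add: norm_abs_L2[OF 1] norm_abs_L2[OF assms])
  finally show ?thesis by simp
qed

text \<open>The Riesz--Fischer argument: the increments have summable mean modulus, so
  representatives converge almost everywhere, and Fatou's lemma turns the pointwise limit into a
  limit in norm.\<close>

lemma L2_fast_Cauchy_convergent:
  fixes X :: "nat \<Rightarrow> L2"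
  assumes fast: "\<And>n m. n \<le> m \<Longrightarrow> norm (X m - X n) \<le> (1/2) ^ n"
  shows "\<exists>Y. X \<longlonglongrightarrow> Y"
proof -
  have "\<exists>f. square_integrable f \<and> X n = abs_L2 f" for n
    by (metis L2_cases)
  then obtain f where f: "\<And>n. square_integrable (f n)" "\<And>n. X n = abs_L2 (f n)"
    by metis
  have [measurable]: "f n \<in> borel_measurable borel" for n
    using f(1)[of n] by (auto simp: square_integrable_def)
  define d where "d n z = cmod (f (Suc n) z - f n z)" for n z
  have [measurable]: "d n \<in> borel_measurable borel" for n
    unfolding d_def by measurable
  have d_int: "(\<integral>\<^sup>+z. ennreal (d n z) \<partial>circle_measure) \<le> ennreal ((1/2)^n)" for n
  proof -
    have sq: "square_integrable (\<lambda>z. f (Suc n) z - f n z)"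
      by (intro square_integrable_diff f)
    have "(\<integral>\<^sup>+z. ennreal (d n z) \<partial>circle_measure) = ennreal (\<integral>z. d n z \<partial>circle_measure)"
      unfolding d_def by (intro nn_integral_eq_integral integrable_norm
          square_integrable_imp_integrable sq) auto
    also have "(\<integral>z. d n z \<partial>circle_measure) \<le> norm (X (Suc n) - X n)"
      unfolding d_def f(2) by (subst abs_L2_diff) (auto intro!: integral_norm_le_norm_L2 sq f)
    also have "\<dots> \<le> (1/2)^n"
      by (rule fast) simp
    finally show ?thesis by (simp add: ennreal_leI)
  qed
  have "(\<integral>\<^sup>+z. (\<Sum>n. ennreal (d n z)) \<partial>circle_measure) = (\<Sum>n. \<integral>\<^sup>+z. ennreal (d n z) \<partial>circle_measure)"
    by (rule nn_integral_suminf) simp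
  also have "\<dots> \<le> (\<Sum>n. ennreal ((1/2)^n))"
    by (intro suminf_le d_int) auto
  also have "\<dots> = ennreal (\<Sum>n. (1/2)^n)"
    by (rule suminf_ennreal2) (auto intro!: summable_geometric)
  finally have "(\<integral>\<^sup>+z. (\<Sum>n. ennreal (d n z)) \<partial>circle_measure) \<noteq> \<infinity>"
    by (auto simp: top_unique)
  then have "AE z in circle_measure. (\<Sum>n. ennreal (d n z)) \<noteq> \<infinity>"
    by (intro nn_integral_PInf_AE) auto
  then have conv: "AE z in circle_measure. convergent (\<lambda>n. f n z)"
  proof eventually_elim
    case (elim z)
    then have "summable (\<lambda>n. d n z)"
      by (intro summable_suminf_not_top) (auto simp: d_def)
    then have "summable (\<lambda>n. f (Suc n) z - f n z)"
      unfolding d_def by (rule summable_norm_cancel)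
    then have "convergent (\<lambda>n. \<Sum>i<n. f (Suc i) z - f i z)"
      by (simp add: summable_iff_convergent)
    then have "convergent (\<lambda>n. f n z - f 0 z + f 0 z)"
      by (intro convergent_add convergent_const) (simp only: sum_lessThan_telescope[of "\<lambda>n. f n z"])
    then show ?case by simp
  qed
  define g where "g z = lim (\<lambda>n. f n z)" for z
  have [measurable]: "g \<in> borel_measurable borel"
    unfolding g_def by (rule borel_measurable_lim_metric) simp
  have bound: "(\<integral>\<^sup>+z. ennreal ((cmod (g z - f n z))\<^sup>2) \<partial>circle_measure) \<le> ennreal (((1/2)^n)\<^sup>2)" for n
  proof -
    have "(\<integral>\<^sup>+z. ennreal ((cmod (g z - f n z))\<^sup>2) \<partial>circle_measure)
        = (\<integral>\<^sup>+z. liminf (\<lambda>m. ennreal ((cmod (f m z - f n z))\<^sup>2)) \<partial>circle_measure)"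
    proof (rule nn_integral_cong_AE)
      show "AE z in circle_measure. ennreal ((cmod (g z - f n z))\<^sup>2) = liminf (\<lambda>m. ennreal ((cmod (f m z - f n z))\<^sup>2))"
        using conv
      proof eventually_elim
        case (elim z)
        then have "(\<lambda>m. f m z) \<longlonglongrightarrow> g z"
          by (simp add: g_def convergent_LIMSEQ_iff)
        then have "(\<lambda>m. ennreal ((cmod (f m z - f n z))\<^sup>2)) \<longlonglongrightarrow> ennreal ((cmod (g z - f n z))\<^sup>2)"
          by (intro tendsto_ennrealI tendsto_intros)
        then show ?case
          by (intro lim_imp_Liminf[symmetric]) auto
      qed
    qed
    also have "\<dots> \<le> liminf (\<lambda>m. \<integral>\<^sup>+z. ennreal ((cmod (f m z - f n z))\<^sup>2) \<partial>circle_measure)"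
      by (rule nn_integral_liminf) measurable
    also have "\<dots> \<le> ennreal (((1/2)^n)\<^sup>2)"
    proof (rule order_trans[OF Liminf_mono])
      show "\<forall>\<^sub>F m in sequentially. (\<integral>\<^sup>+z. ennreal ((cmod (f m z - f n z))\<^sup>2) \<partial>circle_measure) \<le> ennreal (((1/2)^n)\<^sup>2)"
        using eventually_ge_at_top[of n]
      proof eventually_elim
        case (elim m)
        have sq: "square_integrable (\<lambda>z. f m z - f n z)"
          by (intro square_integrable_diff f)
        have "(\<integral>\<^sup>+z. ennreal ((cmod (f m z - f n z))\<^sup>2) \<partial>circle_measure)
            = ennreal (\<integral>z. (cmod (f m z - f n z))\<^sup>2 \<partial>circle_measure)"
          using sq by (intro nn_integral_eq_integral) (auto simp: square_integrable_def)
        also have "\<dots> = ennreal ((norm (X m - X n))\<^sup>2)"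
          using norm_abs_L2[OF sq] by (simp add: f abs_L2_diff)
        also have "\<dots> \<le> ennreal (((1/2)^n)\<^sup>2)"
          by (intro ennreal_leI power_mono fast elim) auto
        finally show ?case .
      qed
    qed (simp add: Liminf_const)
    finally show ?thesis .
  qed
  have sqd: "square_integrable (\<lambda>z. g z - f n z)" for n
    unfolding square_integrable_def
  proof
    show "integrable circle_measure (\<lambda>z. (cmod (g z - f n z))\<^sup>2)"
      by (rule integrableI_bounded) (use bound[of n] in \<open>auto simp: less_top[symmetric] top_unique\<close>)
  qed measurable
  have sqg: "square_integrable g"
    using square_integrable_add[OF sqd[of 0] f(1)[of 0]] by simp
  have "norm (X n - abs_L2 g) \<le> (1/2)^n" for n
  proof -
    have "ennreal ((norm (abs_L2 g - X n))\<^sup>2) = (\<integral>\<^sup>+z. ennreal ((cmod (g z - f n z))\<^sup>2) \<partial>circle_measure)"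
      unfolding f(2) abs_L2_diff[OF sqg f(1)] norm_abs_L2[OF sqd]
      using sqd[of n] by (intro nn_integral_eq_integral[symmetric]) (auto simp: square_integrable_def)
    then have "ennreal ((norm (abs_L2 g - X n))\<^sup>2) \<le> ennreal (((1/2)^n)\<^sup>2)"
      using bound[of n] by simp
    then have "(norm (abs_L2 g - X n))\<^sup>2 \<le> ((1/2)^n)\<^sup>2"
      by (subst (asm) ennreal_le_iff) auto
    then show ?thesis
      by (subst norm_minus_commute) (rule power2_le_imp_le, auto)
  qed
  moreover have "(\<lambda>n. (1/2::real)^n) \<longlonglongrightarrow> 0"
    by (rule LIMSEQ_power_zero) simp
  ultimately have "(\<lambda>n. X n - abs_L2 g) \<longlonglongrightarrow> 0"
    by (intro Lim_null_comparison[where f="\<lambda>n. X n - abs_L2 g"]) auto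
  then show ?thesis
    using LIM_zero_iff by blast
qed

instance L2 :: complete_space
proof
  fix X :: "nat \<Rightarrow> L2" assume X: "Cauchy X"
  have "\<exists>N. \<forall>m\<ge>N. \<forall>n\<ge>N. norm (X m - X n) < (1/2)^k" for k
    using X by (auto simp: Cauchy_iff)
  then obtain N where N: "\<And>k m n. m \<ge> N k \<Longrightarrow> n \<ge> N k \<Longrightarrow> norm (X m - X n) < (1/2)^k"
    by metis
  \<comment> \<open>The sum makes \<open>r\<close> monotone and at least \<open>N k\<close>; the
    summand \<open>k\<close> makes it strictly increasing, so that it selects a subsequence.\<close>
  define r where "r k = (\<Sum>j\<le>k. N j) + k" for k
  have rN: "r k \<ge> N k" for k
    unfolding r_def by (simp add: sum.atMost_Suc member_le_sum trans_le_add1)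
  have rm: "r n \<le> r m" if "n \<le> m" for n m
    unfolding r_def using that by (intro add_mono sum_mono2) auto
  have "\<exists>Y. (\<lambda>k. X (r k)) \<longlonglongrightarrow> Y"
    by (rule L2_fast_Cauchy_convergent) (meson N less_imp_le order_trans rN rm)
  then obtain Y where Y: "(X \<circ> r) \<longlonglongrightarrow> Y"
    by (auto simp: o_def)
  have "strict_mono r"
    unfolding strict_mono_Suc_iff r_def by simp
  then have "X \<longlonglongrightarrow> Y"
    using Y X Cauchy_converges_subseq by blast
  then show "convergent X" by (auto simp: convergent_def)
qed

instance L2 :: banach ..

section \<open>Closed complex subspaces, orthogonal projections and uniform boundedness\<close>

lemma subspace_scaleR: "L2.subspace M \<Longrightarrow> x \<in> M \<Longrightarrow> r *\<^sub>R x \<in> M"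
  by (simp add: scaleR_eq_scaleC L2.subspace_scale)

lemma norm_diff_projection_square:
  assumes "h \<noteq> 0"
  shows "(norm (f - (cinner f h / of_real ((norm h)\<^sup>2)) *\<^sub>C h))\<^sup>2
    = (norm f)\<^sup>2 - (cmod (cinner f h) / norm h)\<^sup>2"
proof -
  define c where "c = cinner f h / of_real ((norm h)\<^sup>2)"
  have "cinner (f - c *\<^sub>C h) (c *\<^sub>C h) = 0"
    using assms by (simp add: c_def cinner_self)
  from norm_add_orthogonal[OF this]
  have "(norm f)\<^sup>2 = (norm (f - c *\<^sub>C h))\<^sup>2 + (cmod c * norm h)\<^sup>2"
    by simp
  moreover have "cmod c * norm h = cmod (cinner f h) / norm h"
    using assms by (simp add: c_def norm_divide norm_mult power2_eq_square)
  ultimately show ?thesis by (simp add: c_def)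
qed

locale closed_csubspace =
  fixes M :: "L2 set"
  assumes subspace: "L2.subspace M" and closed: "closed M"
begin

lemma projection_exists: "\<exists>g\<in>M. \<forall>h\<in>M. cinner (f - g) h = 0"
proof -
  define D where "D = (INF x\<in>M. (norm (f - x))\<^sup>2)"
  have bdd: "bdd_below ((\<lambda>x. (norm (f - x))\<^sup>2) ` M)"
    by (rule bdd_belowI2[of _ 0]) simp
  have ne: "M \<noteq> {}" using subspace L2.subspace_0 by blast
  have Dle: "D \<le> (norm (f - x))\<^sup>2" if "x \<in> M" for x
    unfolding D_def using bdd that by (rule cINF_lower)
  have "\<exists>x\<in>M. (norm (f - x))\<^sup>2 < D + inverse (Suc n)" for n
    using cINF_less_iff[OF ne bdd, of "D + inverse (Suc n)"] by (simp add: D_def)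
  then obtain x where x: "\<And>n. x n \<in> M" "\<And>n. (norm (f - x n))\<^sup>2 < D + inverse (Suc n)"
    by metis
  \<comment> \<open>Parallelogram law: the midpoint of \<open>x m\<close> and \<open>x n\<close>
    lies in \<open>M\<close>, so its squared distance to \<open>f\<close> is at least
    \<open>D\<close>. Hence two near-minimisers are close to each other.\<close>
  have par: "(norm (x m - x n))\<^sup>2 \<le> 2 * inverse (Suc m) + 2 * inverse (Suc n)" for m n
  proof -
    have "(1/2::real) *\<^sub>R (x m + x n) \<in> M"
      by (intro subspace_scaleR subspace L2.subspace_add x)
    from Dle[OF this] have "4 * D \<le> 4 * (norm (f - (1/2::real) *\<^sub>R (x m + x n)))\<^sup>2" by simp
    also have "\<dots> = (norm ((f - x m) + (f - x n)))\<^sup>2"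
    proof -
      have "(f - x m) + (f - x n) = 2 *\<^sub>R (f - (1/2::real) *\<^sub>R (x m + x n))"
        by (simp add: scaleR_diff_right scaleR_2 algebra_simps)
      then show ?thesis by (simp only: norm_scaleR power_mult_distrib) simp
    qed
    also have "\<dots> = 2 * (norm (f - x m))\<^sup>2 + 2 * (norm (f - x n))\<^sup>2 - (norm ((f - x m) - (f - x n)))\<^sup>2"
      by (simp only: power2_norm_eq_inner inner_add_left inner_add_right inner_diff_left
          inner_diff_right inner_commute[of "f - x n" "f - x m"]) simp
    also have "(f - x m) - (f - x n) = x n - x m" by simp
    finally show ?thesis using x(2)[of m] x(2)[of n] by (simp add: norm_minus_commute)
  qed
  have "Cauchy x"
  proof (rule CauchyI)
    fix e :: real assume "e > 0"
    then obtain N where N: "inverse (Suc N) < e\<^sup>2 / 4"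
      using reals_Archimedean[of "e\<^sup>2 / 4"] by auto
    show "\<exists>N. \<forall>m\<ge>N. \<forall>n\<ge>N. norm (x m - x n) < e"
    proof (intro exI allI impI)
      fix m n assume "m \<ge> N" "n \<ge> N"
      then have "inverse (real (Suc m)) \<le> inverse (Suc N)" "inverse (real (Suc n)) \<le> inverse (Suc N)"
        by (auto intro!: le_imp_inverse_le)
      with par[of m n] N have "(norm (x m - x n))\<^sup>2 < e\<^sup>2" by linarith
      then show "norm (x m - x n) < e"
        using \<open>e > 0\<close> by (auto intro: power2_less_imp_less[of _ e])
    qed
  qed
  then obtain g where g: "x \<longlonglongrightarrow> g"
    using Cauchy_convergent convergent_def by blast
  then have gM: "g \<in> M"
    using closed x(1) closed_sequentially by blast
  have "(\<lambda>n. (norm (f - x n))\<^sup>2) \<longlonglongrightarrow> (norm (f - g))\<^sup>2"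
    by (intro tendsto_intros g)
  moreover have "(\<lambda>n. D + inverse (real (Suc n))) \<longlonglongrightarrow> D + 0"
    by (intro tendsto_intros LIMSEQ_inverse_real_of_nat)
  ultimately have gD: "(norm (f - g))\<^sup>2 \<le> D"
    using x(2) by (intro LIMSEQ_le[of "\<lambda>n. (norm (f - x n))\<^sup>2" _ "\<lambda>n. D + inverse (real (Suc n))"])
      (auto intro!: exI[of _ 0] less_imp_le)
  \<comment> \<open>If \<open>f - g\<close> had a component along \<open>h\<close>, moving
    \<open>g\<close> by that component would stay in \<open>M\<close> and lower the squared distance
    below its infimum \<open>D\<close>.\<close>
  have "cinner (f - g) h = 0" if "h \<in> M" for h
  proof (cases "h = 0")
    case False
    let ?c = "cinner (f - g) h / of_real ((norm h)\<^sup>2)"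
    have "g + ?c *\<^sub>C h \<in> M"
      by (intro L2.subspace_add L2.subspace_scale subspace gM that)
    from Dle[OF this] gD have "(norm (f - g))\<^sup>2 \<le> (norm ((f - g) - ?c *\<^sub>C h))\<^sup>2"
      by (simp only: diff_diff_eq)
    then have "(cmod (cinner (f - g) h) / norm h)\<^sup>2 \<le> 0"
      unfolding norm_diff_projection_square[OF False] by simp
    then show ?thesis using False by simp
  qed simp
  then show ?thesis using gM by blast
qed

lemma projection_unique:
  assumes "g \<in> M" "\<And>h. h \<in> M \<Longrightarrow> cinner (f - g) h = 0"
    and "g' \<in> M" "\<And>h. h \<in> M \<Longrightarrow> cinner (f - g') h = 0"
  shows "g = g'"
proof -
  have "g - g' \<in> M" by (intro L2.subspace_diff subspace assms)
  then have "cinner (f - g') (g - g') = 0" "cinner (f - g) (g - g') = 0"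
    using assms by blast+
  then have "cinner ((f - g') - (f - g)) (g - g') = 0"
    by (simp only: cinner.diff_left[of "f - g'"] diff_self)
  moreover have "(f - g') - (f - g) = g - g'" by simp
  ultimately show ?thesis
    by (simp only: cinner_self_eq_0) simp
qed

lemma orth_proj_eqI:
  assumes "g \<in> M" "\<And>h. h \<in> M \<Longrightarrow> cinner (f - g) h = 0"
  shows "orth_proj M f = g"
  unfolding orth_proj_def using assms by (intro the_equality projection_unique[of _ f g]) blast+

lemma orth_proj_in [simp]: "orth_proj M f \<in> M"
  and cinner_orth_proj: "h \<in> M \<Longrightarrow> cinner (f - orth_proj M f) h = 0"
proof -
  obtain g where "g \<in> M" "\<And>h. h \<in> M \<Longrightarrow> cinner (f - g) h = 0"
    using projection_exists[of f] by blast
  moreover from this have "orth_proj M f = g" by (rule orth_proj_eqI)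
  ultimately show "orth_proj M f \<in> M" "h \<in> M \<Longrightarrow> cinner (f - orth_proj M f) h = 0"
    by auto
qed

lemma cinner_orth_proj_left: "h \<in> M \<Longrightarrow> cinner (orth_proj M f) h = cinner f h"
  using cinner_orth_proj[of h f] by simp

lemma cinner_orth_proj_right: "h \<in> M \<Longrightarrow> cinner h (orth_proj M f) = cinner h f"
  by (subst (1 2) cinner_commute) (simp add: cinner_orth_proj_left)

lemma cinner_orth_proj_swap: "cinner (orth_proj M f) g = cinner f (orth_proj M g)"
  using cinner_orth_proj_left[of "orth_proj M g" f] cinner_orth_proj_right[of "orth_proj M f" g]
  by simp

lemma orth_proj_ident [simp]: "f \<in> M \<Longrightarrow> orth_proj M f = f"
  by (rule orth_proj_eqI) auto

lemma orth_proj_add: "orth_proj M (f + g) = orth_proj M f + orth_proj M g"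
  by (rule orth_proj_eqI)
     (auto intro: L2.subspace_add subspace simp: cinner_orth_proj_left)

lemma orth_proj_scaleC: "orth_proj M (c *\<^sub>C f) = c *\<^sub>C orth_proj M f"
  by (rule orth_proj_eqI)
     (auto intro: L2.subspace_scale subspace simp: cinner_orth_proj_left)

lemma orth_proj_diff: "orth_proj M (f - g) = orth_proj M f - orth_proj M g"
  by (rule orth_proj_eqI)
     (auto intro: L2.subspace_diff subspace simp: cinner_orth_proj_left)

lemma orth_proj_eq_0: "(\<And>h. h \<in> M \<Longrightarrow> cinner f h = 0) \<Longrightarrow> orth_proj M f = 0"
  by (rule orth_proj_eqI) (auto intro: L2.subspace_0 subspace)

lemma norm_orth_proj_square: "(norm f)\<^sup>2 = (norm (orth_proj M f))\<^sup>2 + (norm (f - orth_proj M f))\<^sup>2"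
proof -
  have "cinner (f - orth_proj M f) (orth_proj M f) = 0"
    by (rule cinner_orth_proj) simp
  from norm_add_orthogonal[OF this] show ?thesis
    unfolding diff_add_cancel by simp
qed

lemma norm_orth_proj_le: "norm (orth_proj M f) \<le> norm f"
proof (rule power2_le_imp_le)
  show "(norm (orth_proj M f))\<^sup>2 \<le> (norm f)\<^sup>2"
    by (subst norm_orth_proj_square[of f]) (rule le_add_same_cancel1[THEN iffD2], simp)
qed simp

text \<open>Gliding hump: the signs in \<open>y\<close> are chosen so that no cancellation occurs against
  earlier terms, and the tail of the geometric series costs at most half of the \<open>k\<close>-th term.\<close>

lemma uniform_boundedness:
  assumes u: "\<And>n::nat. u n \<in> M"
    and pt: "\<And>y. y \<in> M \<Longrightarrow> \<exists>B. \<forall>n. cmod (cinner y (u n)) \<le> B"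
  shows "\<exists>B. \<forall>n. norm (u n) \<le> B"
proof (rule ccontr)
  assume "\<not> ?thesis"
  then have "\<not> (\<forall>n. norm (u n) \<le> 4 ^ k)" for k :: nat
    by blast
  then have "\<exists>n. norm (u n) > 4 ^ k" for k :: nat
    by (simp add: not_le)
  then obtain i where i: "\<And>k::nat. norm (u (i k)) > 4 ^ k"
    by metis
  define v where "v k = u (i k)" for k
  have v: "norm (v k) > 4 ^ k" "v k \<in> range u" for k
    using i[of k] by (auto simp: v_def)
  have v0: "norm (v k) > 0" for k
    using v(1)[of k] by (metis order_less_trans zero_less_numeral zero_less_power)
  have vM: "v k \<in> M" for k using v(2)[of k] u by auto
  \<comment> \<open>The hump sizes shrink like \<open>(1/3) ^ k\<close> so that the series
    converges, while \<open>norm (v k)\<close> exceeds \<open>4 ^ k\<close>. The products then grow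
    like \<open>(4/3) ^ k\<close>, which contradicts pointwise boundedness.\<close>
  define w where "w k = ((1/3) ^ k / norm (v k)) *\<^sub>R v k" for k
  have nw: "norm (w k) = (1/3) ^ k" for k using v0[of k] by (simp add: w_def)
  have wM: "w k \<in> M" for k unfolding w_def by (intro subspace_scaleR subspace vM)
  have wv: "cmod (cinner (w k) (v k)) = (1/3) ^ k * norm (v k)" for k
    using v0[of k] by (simp add: w_def scaleR_eq_scaleC cinner_self norm_mult norm_power norm_divide
        power2_eq_square)
  define y where "y = rec_nat 0 (\<lambda>k a. if cmod (cinner (a + w k) (v k)) \<ge> (1/3) ^ k * norm (v k)
     then a + w k else a - w k)"
  have y0: "y 0 = 0" by (simp add: y_def)
  have yS: "y (Suc k) = (if cmod (cinner (y k + w k) (v k)) \<ge> (1/3) ^ k * norm (v k)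
     then y k + w k else y k - w k)" for k by (simp add: y_def)
  have yM: "y k \<in> M" for k
    by (induction k) (auto simp: y0 yS intro: L2.subspace_0 L2.subspace_add L2.subspace_diff subspace wM)
  have dy: "norm (y (Suc k) - y k) = (1/3) ^ k" for k
    by (simp add: yS nw)
  have big: "cmod (cinner (y (Suc k)) (v k)) \<ge> (1/3) ^ k * norm (v k)" for k
  proof -
    have "2 * cmod (cinner (w k) (v k))
        = cmod (cinner (y k + w k) (v k) - cinner (y k - w k) (v k))"
      by (simp add: norm_mult flip: mult_2)
    also have "\<dots> \<le> cmod (cinner (y k + w k) (v k)) + cmod (cinner (y k - w k) (v k))"
      by (rule norm_triangle_ineq4)
    finally show ?thesis unfolding yS wv by auto
  qed
  have tail: "norm (y (Suc k + m) - y (Suc k)) \<le> (1/3) ^ k * (1 - (1/3) ^ m) / 2" for k m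
  proof (induction m)
    case (Suc m)
    have "norm (y (Suc k + Suc m) - y (Suc k))
        \<le> norm (y (Suc (Suc k + m)) - y (Suc k + m)) + norm (y (Suc k + m) - y (Suc k))"
      using norm_triangle_ineq[of "y (Suc (Suc k + m)) - y (Suc k + m)" "y (Suc k + m) - y (Suc k)"] by simp
    also have "\<dots> \<le> (1/3) ^ (Suc k + m) + (1/3) ^ k * (1 - (1/3) ^ m) / 2"
      unfolding dy using Suc by simp
    also have "\<dots> = (1/3) ^ k * (1 - (1/3) ^ Suc m) / 2"
      by (simp add: power_add field_simps)
    finally show ?case .
  qed simp
  have "summable (\<lambda>k. norm (y (Suc k) - y k))"
    unfolding dy by (rule summable_geometric) simp
  then have "summable (\<lambda>k. y (Suc k) - y k)"
    by (rule summable_norm_cancel)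
  then have "convergent (\<lambda>n. \<Sum>k<n. y (Suc k) - y k)"
    by (simp add: summable_iff_convergent)
  then obtain Y where Y: "y \<longlonglongrightarrow> Y"
    by (auto simp: sum_lessThan_telescope y0 convergent_def)
  then have YM: "Y \<in> M" using closed yM closed_sequentially by blast
  have near: "norm (Y - y (Suc k)) \<le> (1/3) ^ k / 2" for k
  proof (rule LIMSEQ_le_const2)
    show "(\<lambda>m. norm (y (m + Suc k) - y (Suc k))) \<longlonglongrightarrow> norm (Y - y (Suc k))"
      by (intro tendsto_intros LIMSEQ_ignore_initial_segment Y)
    have "norm (y (m + Suc k) - y (Suc k)) \<le> (1/3) ^ k / 2" for m
    proof -
      have "(1/3) ^ k * (1 - (1/3) ^ m) / 2 \<le> ((1/3) ^ k / 2 :: real)"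
        by (simp add: field_simps)
      from order_trans[OF tail this] show ?thesis by (simp only: add.commute)
    qed
    then show "\<exists>N. \<forall>m\<ge>N. norm (y (m + Suc k) - y (Suc k)) \<le> (1/3) ^ k / 2" by blast
  qed
  have low: "cmod (cinner Y (v k)) \<ge> (4/3) ^ k / 2" for k
  proof -
    have "cmod (cinner (y (Suc k)) (v k)) \<le> cmod (cinner Y (v k)) + cmod (cinner (Y - y (Suc k)) (v k))"
      using norm_triangle_ineq4[of "cinner Y (v k)" "cinner (Y - y (Suc k)) (v k)"] by simp
    also have "cmod (cinner (Y - y (Suc k)) (v k)) \<le> (1/3) ^ k / 2 * norm (v k)"
      using near[of k] by (intro order_trans[OF cinner_bound] mult_right_mono) auto
    finally have "(1/3) ^ k * norm (v k) / 2 \<le> cmod (cinner Y (v k))"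
      using big[of k] by simp
    moreover have "(1/3) ^ k * 4 ^ k \<le> (1/3) ^ k * norm (v k)"
      using v(1)[of k] by (intro mult_left_mono) auto
    moreover have "(1/3) ^ k * 4 ^ k = ((4/3) ^ k :: real)"
      by (simp flip: power_mult_distrib)
    ultimately show ?thesis by simp
  qed
  obtain B where B: "\<And>n. cmod (cinner Y (u n)) \<le> B"
    using pt[OF YM] by blast
  obtain k where "(4/3) ^ k > 2 * B"
    using real_arch_pow[of "4/3" "2 * B"] by auto
  with low[of k] have "cmod (cinner Y (v k)) > B" by linarith
  moreover obtain n where "v k = u n" using v(2)[of k] by auto
  ultimately show False using B[of n] by simp
qed

end

section \<open>Fredholm criteria\<close>

text \<open>The map \<open>F\<close> removes the component along \<open>b'\<close>, the part of
  \<open>b\<close> orthogonal to \<open>M\<close>. The span is the preimage of the closed set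
  \<open>M\<close> under this continuous map.\<close>

lemma (in closed_csubspace) closed_span_insert: "closed (L2.span (insert b M))"
proof (cases "b \<in> M")
  case True
  then have "L2.span (insert b M) = M"
    using subspace by (simp add: insert_absorb L2.span_eq_iff)
  then show ?thesis by (simp add: closed)
next
  case False
  define b' where "b' = b - orth_proj M b"
  have b'0: "b' \<noteq> 0"
    using False orth_proj_in[of b] unfolding b'_def right_minus_eq by metis
  have orth: "cinner n b' = 0" if "n \<in> M" for n
    using cinner_orth_proj[OF that, of b] cinner_commute[of n b'] by (simp only: b'_def) simp
  define F where "F x = x - (cinner x b' / of_real ((norm b')\<^sup>2)) *\<^sub>C b'" for x
  have Fn: "F (n + c *\<^sub>C b') = n" if "n \<in> M" for n c
    using b'0 orth[OF that] by (simp add: F_def cinner_self)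
  have "L2.span (insert b M) = {x. F x \<in> M}"
  proof (rule Set.equalityI)
    show "L2.span (insert b M) \<subseteq> {x. F x \<in> M}"
    proof
      fix x assume "x \<in> L2.span (insert b M)"
      then obtain k where k: "x - k *\<^sub>C b \<in> L2.span M"
        using L2.span_breakdown_eq by blast
      then have kM: "x - k *\<^sub>C b \<in> M"
        using L2.span_eq_iff[THEN iffD2, OF subspace] by simp
      have "(x - k *\<^sub>C b) + k *\<^sub>C orth_proj M b \<in> M"
        by (intro L2.subspace_add L2.subspace_scale subspace kM) simp
      moreover have "x = ((x - k *\<^sub>C b) + k *\<^sub>C orth_proj M b) + k *\<^sub>C b'"
        by (simp add: b'_def L2.scale_right_diff_distrib)
      ultimately show "x \<in> {x. F x \<in> M}"
        using Fn by (metis mem_Collect_eq)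
    qed
    show "{x. F x \<in> M} \<subseteq> L2.span (insert b M)"
    proof
      fix x assume "x \<in> {x. F x \<in> M}"
      then have "F x \<in> L2.span (insert b M)"
        by (auto intro: L2.span_base)
      moreover have "b' \<in> L2.span (insert b M)"
        unfolding b'_def by (intro L2.span_diff L2.span_base) auto
      ultimately have "F x + (cinner x b' / of_real ((norm b')\<^sup>2)) *\<^sub>C b' \<in> L2.span (insert b M)"
        by (intro L2.span_add L2.span_scale)
      then show "x \<in> L2.span (insert b M)" by (simp add: F_def)
    qed
  qed
  moreover have "closed {x. F x \<in> M}"
  proof -
    have sc: "(\<lambda>x. c x *\<^sub>C v) \<midarrow>a\<rightarrow> c a *\<^sub>C v" if "c \<midarrow>a\<rightarrow> c a" for c :: "L2 \<Rightarrow> complex" and v a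
    proof -
      have "((\<lambda>x. norm (c x - c a) * norm v) \<longlongrightarrow> norm (c a - c a) * norm v) (at a)"
        by (intro tendsto_intros that)
      then have "((\<lambda>x. norm (c x *\<^sub>C v - c a *\<^sub>C v)) \<longlongrightarrow> 0) (at a)"
        by (simp flip: L2.scale_left_diff_distrib)
      then show ?thesis
        by (simp add: tendsto_norm_zero_iff LIM_zero_iff)
    qed
    have "isCont F x" for x
      unfolding F_def continuous_at
      by (intro tendsto_diff tendsto_ident_at sc tendsto_divide cinner.tendsto tendsto_const)
         (use b'0 in simp_all)
    then show ?thesis
      using continuous_closed_vimage[OF closed, of F] by (simp add: vimage_def)
  qed
  ultimately show ?thesis by simp
qed

text \<open>Each vector of \<open>B\<close> adds at most one dimension: if \<open>R\<close> is
  larger than its closed part \<open>R1\<close> inside the span of the previous vectors, a single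
  \<open>r\<close> outside that span already generates \<open>R\<close> over \<open>R1\<close>. This
  makes ranges closed that are only known to contain a closed subspace of finite
  codimension.\<close>

lemma closed_csubspace_between:
  assumes "finite B" "closed_csubspace N" "L2.subspace R" "N \<subseteq> R" "R \<subseteq> L2.span (N \<union> B)"
  shows "closed R"
  using assms
proof (induction B arbitrary: R rule: finite_induct)
  case empty
  then have "R = N"
    using L2.span_eq_iff[THEN iffD2, of N] by (auto simp: closed_csubspace_def)
  then show ?case using empty by (simp add: closed_csubspace_def)
next
  case (insert b B)
  define R1 where "R1 = R \<inter> L2.span (N \<union> B)"
  have sub1: "L2.subspace R1"
    unfolding R1_def by (intro L2.subspace_inter insert.prems L2.subspace_span)
  have "closed R1"
    by (rule insert.IH) (use insert.prems sub1 in \<open>auto simp: R1_def intro: L2.span_base\<close>)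
  then have cc: "closed_csubspace R1"
    using sub1 by (simp add: closed_csubspace_def)
  show ?case
  proof (cases "R = R1")
    case False
    then obtain r where r: "r \<in> R" "r \<notin> L2.span (N \<union> B)" by (auto simp: R1_def)
    have dec: "\<exists>k. x - k *\<^sub>C b \<in> L2.span (N \<union> B)" if "x \<in> R" for x
    proof -
      have "x \<in> L2.span (insert b (N \<union> B))" using that insert.prems(4) by auto
      then show ?thesis by (simp add: L2.span_breakdown_eq)
    qed
    obtain k where k: "r - k *\<^sub>C b \<in> L2.span (N \<union> B)" using dec[OF r(1)] by blast
    have k0: "k \<noteq> 0" using k r(2) by auto
    have "R = L2.span (insert r R1)"
    proof (rule Set.equalityI)
      show "L2.span (insert r R1) \<subseteq> R"
        using r(1) insert.prems(2) by (intro L2.span_minimal) (auto simp: R1_def)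
      show "R \<subseteq> L2.span (insert r R1)"
      proof
        fix x assume x: "x \<in> R"
        obtain j where j: "x - j *\<^sub>C b \<in> L2.span (N \<union> B)" using dec[OF x] by blast
        have "(x - j *\<^sub>C b) - (j / k) *\<^sub>C (r - k *\<^sub>C b) \<in> L2.span (N \<union> B)"
          by (intro L2.span_diff L2.span_scale j k)
        also have "(x - j *\<^sub>C b) - (j / k) *\<^sub>C (r - k *\<^sub>C b) = x - (j / k) *\<^sub>C r"
          using k0 by (simp add: L2.scale_right_diff_distrib)
        finally have "x - (j / k) *\<^sub>C r \<in> R1"
          unfolding R1_def using x r(1) insert.prems(2)
          by (auto intro: L2.subspace_diff L2.subspace_scale)
        then show "x \<in> L2.span (insert r R1)"
          by (auto simp: L2.span_breakdown_eq intro: L2.span_base)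
      qed
    qed
    then show ?thesis
      using closed_csubspace.closed_span_insert[OF cc] by simp
  qed (use \<open>closed R1\<close> in simp)
qed

lemma subspace_cinner_annihilator:
  "L2.subspace M \<Longrightarrow> L2.subspace {y \<in> M. \<forall>u\<in>U. cinner y u = 0}"
  unfolding L2.subspace_def by auto

text \<open>Adding \<open>u\<close> imposes one more linear condition. Either it already holds on
  the current annihilator, or any \<open>p\<close> violating it spans a complement of the new
  annihilator.\<close>

lemma finite_codim_annihilator:
  assumes "finite U" "L2.subspace M"
  shows "\<exists>B\<subseteq>M. finite B \<and> M \<subseteq> L2.span ({y \<in> M. \<forall>u\<in>U. cinner y u = 0} \<union> B)"
  using assms
proof (induction U rule: finite_induct)
  case empty
  then show ?case by (auto intro: L2.span_base)
next
  case (insert u U)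
  let ?N = "{y \<in> M. \<forall>u\<in>U. cinner y u = 0}"
  let ?N' = "{y \<in> M. \<forall>u\<in>insert u U. cinner y u = 0}"
  obtain B where B: "B \<subseteq> M" "finite B" "M \<subseteq> L2.span (?N \<union> B)"
    using insert by blast
  have "\<exists>p\<in>M. ?N \<subseteq> L2.span (?N' \<union> {p})"
  proof (cases "\<forall>y\<in>?N. cinner y u = 0")
    case True
    then have "?N \<subseteq> ?N'" by auto
    then show ?thesis using insert.prems L2.subspace_0
      by (intro bexI[of _ 0]) (auto intro: L2.span_base)
  next
    case False
    then obtain p where p: "p \<in> ?N" "cinner p u \<noteq> 0" by blast
    have "?N \<subseteq> L2.span (?N' \<union> {p})"
    proof
      fix y assume y: "y \<in> ?N"
      define c where "c = cinner y u / cinner p u"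
      have "y - c *\<^sub>C p \<in> ?N'"
        using y p insert.prems by (auto simp: c_def intro: L2.subspace_diff L2.subspace_scale)
      then have "(y - c *\<^sub>C p) + c *\<^sub>C p \<in> L2.span (?N' \<union> {p})"
        by (intro L2.span_add L2.span_scale L2.span_base) auto
      then show "y \<in> L2.span (?N' \<union> {p})" by simp
    qed
    then show ?thesis using p by blast
  qed
  then obtain p where p: "p \<in> M" "?N \<subseteq> L2.span (?N' \<union> {p})" by blast
  have "?N \<union> B \<subseteq> L2.span (?N' \<union> insert p B)"
  proof -
    have "L2.span (?N' \<union> {p}) \<subseteq> L2.span (?N' \<union> insert p B)"
      by (rule L2.span_mono) auto
    moreover have "B \<subseteq> L2.span (?N' \<union> insert p B)"
      by (auto intro: L2.span_base)
    ultimately show ?thesis using p(2) by blast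
  qed
  then have "L2.span (?N \<union> B) \<subseteq> L2.span (?N' \<union> insert p B)"
    by (rule L2.span_minimal) (rule L2.subspace_span)
  then show ?case
    using B p by (intro exI[of _ "insert p B"]) auto
qed

lemma (in closed_csubspace) closed_csubspace_annihilator:
  "closed_csubspace {y \<in> M. \<forall>u\<in>U. cinner y u = 0}"
proof
  show "L2.subspace {y \<in> M. \<forall>u\<in>U. cinner y u = 0}"
    by (rule subspace_cinner_annihilator[OF subspace])
  have "closed {y. cinner y u = 0}" for u
    by (intro closed_Collect_eq continuous_on_const)
       (auto intro!: cinner.continuous_on continuous_intros)
  then have "closed (M \<inter> (\<Inter>u\<in>U. {y. cinner y u = 0}))"
    by (intro closed_Int closed closed_INT) auto
  also have "M \<inter> (\<Inter>u\<in>U. {y. cinner y u = 0}) = {y \<in> M. \<forall>u\<in>U. cinner y u = 0}"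
    by auto
  finally show "closed {y \<in> M. \<forall>u\<in>U. cinner y u = 0}" .
qed

text \<open>Closedness of the range comes for free: it lies between the annihilator of
  \<open>U\<close>, which is closed and of finite codimension, and \<open>M\<close>. In applications
  only kernel vectors and preimages have to be produced.\<close>

lemma (in closed_csubspace) fredholm_onI:
  assumes T: "\<And>x. x \<in> M \<Longrightarrow> T x \<in> M"
    and add: "\<And>x y. x \<in> M \<Longrightarrow> y \<in> M \<Longrightarrow> T (x + y) = T x + T y"
    and scale: "\<And>c x. x \<in> M \<Longrightarrow> T (c *\<^sub>C x) = c *\<^sub>C T x"
    and V: "finite V" "\<And>x. x \<in> M \<Longrightarrow> T x = 0 \<Longrightarrow> x \<in> L2.span V"
    and U: "finite U" "\<And>y. y \<in> M \<Longrightarrow> (\<And>u. u \<in> U \<Longrightarrow> cinner y u = 0) \<Longrightarrow> y \<in> T ` M"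
  shows "fredholm_on M T"
proof -
  let ?N = "{y \<in> M. \<forall>u\<in>U. cinner y u = 0}"
  obtain B where B: "B \<subseteq> M" "finite B" "M \<subseteq> L2.span (?N \<union> B)"
    using finite_codim_annihilator[OF U(1) subspace] by blast
  have NR: "?N \<subseteq> T ` M" using U(2) by blast
  have subR: "L2.subspace (T ` M)"
  proof (rule L2.subspaceI)
    have "T (0 *\<^sub>C 0) = 0 *\<^sub>C T 0"
      by (rule scale) (rule L2.subspace_0[OF subspace])
    then have "T 0 = 0" by simp
    then show "0 \<in> T ` M" using L2.subspace_0[OF subspace] by (metis imageI)
    show "x + y \<in> T ` M" if "x \<in> T ` M" "y \<in> T ` M" for x y
      using that by (auto simp flip: add intro!: imageI L2.subspace_add[OF subspace])
    show "c *\<^sub>C x \<in> T ` M" if "x \<in> T ` M" for c x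
      using that by (auto simp flip: scale intro!: imageI L2.subspace_scale[OF subspace])
  qed
  have "closed (T ` M)"
    by (rule closed_csubspace_between[OF B(2) closed_csubspace_annihilator subR NR])
       (use T B(3) in blast)
  then have "closedin (top_of_set M) (T ` M)"
    using T by (intro closed_subset) auto
  moreover have "M \<subseteq> L2.span (T ` M \<union> B)"
    using B(3) L2.span_mono[of "?N \<union> B" "T ` M \<union> B"] NR by blast
  ultimately show ?thesis
    unfolding fredholm_on_def using B V by blast
qed

text \<open>A weakly null sequence is also small against finitely many vectors spanning a complement
  of the range, so a normalisation of it is pointwise bounded on all of \<open>M\<close>, against uniform
  boundedness.\<close>

lemma (in closed_csubspace) not_fredholm_onI:
  fixes v :: "nat \<Rightarrow> L2"
  assumes v: "\<And>n. v n \<in> M" "\<And>n. norm (v n) = 1"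
    and weak: "\<And>x. x \<in> M \<Longrightarrow> (\<lambda>n. cinner x (v n)) \<longlonglongrightarrow> 0"
    and small: "\<And>x. x \<in> M \<Longrightarrow> \<exists>C. \<forall>n. cmod (cinner (T x) (v n)) \<le> C * e n"
    and e: "e \<longlonglongrightarrow> 0" "\<And>n. e n \<ge> 0"
  shows "\<not> fredholm_on M T"
proof
  assume "fredholm_on M T"
  then obtain B where B: "B \<subseteq> M" "finite B" "M \<subseteq> L2.span (T ` M \<union> B)"
    unfolding fredholm_on_def by blast
  \<comment> \<open>A common rate of decay for pairings with the range (through \<open>e\<close>)
    and with the complementary vectors in \<open>B\<close>. The term
    \<open>inverse (real (Suc n))\<close> keeps it strictly positive, so that \<open>v n\<close> can
    be divided by it.\<close>
  define d where "d n = e n + (\<Sum>b\<in>B. cmod (cinner b (v n))) + inverse (real (Suc n))" for n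
  have sum_nn: "(\<Sum>b\<in>B. cmod (cinner b (v n))) \<ge> 0" for n
    by (rule sum_nonneg) simp
  have d_pos: "d n > 0" for n
    unfolding d_def using e(2)[of n] sum_nn[of n] by (intro add_nonneg_pos add_nonneg_nonneg) auto
  have "d \<longlonglongrightarrow> 0 + (\<Sum>b\<in>B. cmod 0) + 0"
    unfolding d_def by (intro tendsto_intros e weak LIMSEQ_inverse_real_of_nat) (use B in blast)
  then have d0: "d \<longlonglongrightarrow> 0" by simp
  \<comment> \<open>The vectors whose pairings with \<open>v n\<close> decay at rate
    \<open>d n\<close> form a subspace. It contains the range and \<open>B\<close>, hence all of
    \<open>M\<close>.\<close>
  define S where "S = {y. \<exists>C\<ge>0. \<forall>n. cmod (cinner y (v n)) \<le> C * d n}"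
  have "T ` M \<union> B \<subseteq> S"
  proof
    fix y assume "y \<in> T ` M \<union> B"
    then show "y \<in> S"
    proof
      assume "y \<in> T ` M"
      then obtain C where C: "\<And>n. cmod (cinner y (v n)) \<le> C * e n" using small by blast
      have "cmod (cinner y (v n)) \<le> \<bar>C\<bar> * d n" for n
      proof -
        have "C * e n \<le> \<bar>C\<bar> * e n" using e(2) by (intro mult_right_mono) auto
        also have "\<dots> \<le> \<bar>C\<bar> * d n"
          using sum_nn[of n] by (intro mult_left_mono) (auto simp: d_def)
        finally show ?thesis using C[of n] by linarith
      qed
      then show ?thesis unfolding S_def using abs_ge_zero by blast
    next
      assume "y \<in> B"
      then have "cmod (cinner y (v n)) \<le> (\<Sum>b\<in>B. cmod (cinner b (v n)))" for n
        using B by (intro member_le_sum) auto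
      then have "cmod (cinner y (v n)) \<le> 1 * d n" for n
        unfolding d_def using e(2)[of n] by (simp add: add_increasing add_increasing2)
      then show ?thesis unfolding S_def using zero_le_one by blast
    qed
  qed
  moreover have "L2.subspace S"
  proof (rule L2.subspaceI)
    show "0 \<in> S" unfolding S_def by (auto intro!: exI[of _ 0])
    show "x + y \<in> S" if xy: "x \<in> S" "y \<in> S" for x y
    proof -
      obtain C D where *: "C \<ge> 0" "\<And>n. cmod (cinner x (v n)) \<le> C * d n"
        "D \<ge> 0" "\<And>n. cmod (cinner y (v n)) \<le> D * d n"
        using xy unfolding S_def by blast
      have "cmod (cinner (x + y) (v n)) \<le> (C + D) * d n" for n
        using norm_triangle_ineq[of "cinner x (v n)" "cinner y (v n)"] *(2)[of n] *(4)[of n]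
        by (simp add: distrib_right)
      then show ?thesis unfolding S_def using * by (intro CollectI exI[of _ "C + D"]) auto
    qed
    show "c *\<^sub>C x \<in> S" if x: "x \<in> S" for c x
    proof -
      obtain C where *: "C \<ge> 0" "\<And>n. cmod (cinner x (v n)) \<le> C * d n"
        using x unfolding S_def by blast
      have "cmod (cinner (c *\<^sub>C x) (v n)) \<le> (cmod c * C) * d n" for n
        using mult_left_mono[OF *(2)[of n], of "cmod c"] by (simp add: norm_mult mult.assoc)
      then show ?thesis unfolding S_def using * by (intro CollectI exI[of _ "cmod c * C"]) auto
    qed
  qed
  ultimately have "L2.span (T ` M \<union> B) \<subseteq> S" by (rule L2.span_minimal)
  then have MS: "M \<subseteq> S" using B(3) by blast
  define u where "u n = inverse (d n) *\<^sub>R v n" for n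
  have "\<exists>K. \<forall>n. norm (u n) \<le> K"
  proof (rule uniform_boundedness)
    show "u n \<in> M" for n unfolding u_def by (intro subspace_scaleR subspace v)
    fix y assume "y \<in> M"
    then obtain C where C: "\<And>n. cmod (cinner y (v n)) \<le> C * d n"
      using MS unfolding S_def by blast
    have "cmod (cinner y (u n)) \<le> C" for n
      using C[of n] d_pos[of n]
      by (simp add: u_def scaleR_eq_scaleC norm_mult norm_divide field_simps)
    then show "\<exists>K. \<forall>n. cmod (cinner y (u n)) \<le> K" by blast
  qed
  then obtain K where K: "\<And>n. norm (u n) \<le> K" by blast
  have "1 \<le> K * d n" for n
    using K[of n] d_pos[of n] v(2)[of n] by (simp add: u_def field_simps)
  moreover have "(\<lambda>n. K * d n) \<longlonglongrightarrow> K * 0" by (intro tendsto_intros d0)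
  ultimately have "1 \<le> K * 0"
    by (intro LIMSEQ_le_const) auto
  then show False by simp
qed

section \<open>Multiplication operators and Fourier series\<close>

lemma Linf_measurable [measurable_dest]: "a \<in> Linf \<Longrightarrow> a \<in> borel_measurable borel"
  unfolding Linf_def using measurable_cong_sets[OF sets_circle_measure refl] by auto

lemma LinfI:
  assumes "a \<in> borel_measurable borel" "AE z in circle_measure. cmod (a z) \<le> B"
  shows "a \<in> Linf"
  using assms by (auto simp: Linf_def)

lemma LinfE:
  assumes "a \<in> Linf"
  obtains B where "B \<ge> 0" "AE z in circle_measure. cmod (a z) \<le> B"
proof -
  obtain B where "AE z in circle_measure. cmod (a z) \<le> B"
    using assms by (auto simp: Linf_def)
  then have "AE z in circle_measure. cmod (a z) \<le> max B 0"
    by eventually_elim simp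
  then show ?thesis using that[of "max B 0"] by simp
qed

lemma Linf_mult [intro]: 
  assumes "a \<in> Linf" "b \<in> Linf"
  shows "(\<lambda>z. a z * b z) \<in> Linf"
proof -
  obtain A where A: "A \<ge> 0" "AE z in circle_measure. cmod (a z) \<le> A" by (rule LinfE[OF assms(1)])
  obtain B where B: "B \<ge> 0" "AE z in circle_measure. cmod (b z) \<le> B" by (rule LinfE[OF assms(2)])
  have [measurable]: "a \<in> borel_measurable borel" "b \<in> borel_measurable borel"
    using assms by (auto dest: Linf_measurable)
  show ?thesis
  proof (rule LinfI)
    show "AE z in circle_measure. cmod (a z * b z) \<le> A * B"
      using A(2) B(2) by eventually_elim (use A(1) in \<open>auto simp: norm_mult intro: mult_mono\<close>)
  qed measurable
qed

lemma Linf_add [intro]: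
  assumes "a \<in> Linf" "b \<in> Linf"
  shows "(\<lambda>z. a z + b z) \<in> Linf"
proof -
  obtain A where A: "AE z in circle_measure. cmod (a z) \<le> A" by (rule LinfE[OF assms(1)])
  obtain B where B: "AE z in circle_measure. cmod (b z) \<le> B" by (rule LinfE[OF assms(2)])
  have [measurable]: "a \<in> borel_measurable borel" "b \<in> borel_measurable borel"
    using assms by (auto dest: Linf_measurable)
  show ?thesis
  proof (rule LinfI)
    show "AE z in circle_measure. cmod (a z + b z) \<le> A + B"
      using A B by eventually_elim (metis add_mono norm_triangle_le)
  qed measurable
qed

lemma Linf_cnj [intro]: "a \<in> Linf \<Longrightarrow> (\<lambda>z. cnj (a z)) \<in> Linf"
  unfolding Linf_def by auto

lemma Linf_diff [intro]: "a \<in> Linf \<Longrightarrow> b \<in> Linf \<Longrightarrow> (\<lambda>z. a z - b z) \<in> Linf"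
  using Linf_add[OF _ Linf_mult[OF Linf_const[of "-1"]], of a b] by simp

lemma measurable_powi [measurable]: "(\<lambda>z. z powi n) \<in> borel_measurable (borel :: complex measure)"
  unfolding power_int_def by measurable

lemma Linf_powi: "(\<lambda>z. z powi n) \<in> Linf"
proof (rule LinfI)
  show "AE z in circle_measure. cmod (z powi n) \<le> 1"
    using AE_circle_norm by eventually_elim (simp add: norm_power_int)
qed measurable

lemmas Linf_intros = Linf_mult Linf_add Linf_diff Linf_cnj Linf_const Linf_id Linf_powi

lemma mult_L2_add: "mult_L2 a (f + g) = mult_L2 a f + mult_L2 a g"
  by transfer (auto simp: L2_rel_def distrib_left square_integrable_0
      intro!: square_integrable_mult_Linf square_integrable_add)

lemma mult_L2_scaleC: "mult_L2 a (c *\<^sub>C f) = c *\<^sub>C mult_L2 a f"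
  by transfer (auto simp: L2_rel_def square_integrable_0 mult.left_commute
      intro!: square_integrable_mult_Linf square_integrable_scale)

lemma mult_L2_diff: "mult_L2 a (f - g) = mult_L2 a f - mult_L2 a g"
  using mult_L2_add[of a "f - g" g] by (simp add: algebra_simps)

lemma mult_L2_0 [simp]: "mult_L2 a 0 = 0"
  using mult_L2_diff[of a 0 0] by simp

lemma mult_L2_mult:
  assumes "a \<in> Linf" "b \<in> Linf"
  shows "mult_L2 a (mult_L2 b f) = mult_L2 (\<lambda>z. a z * b z) f"
proof -
  have "(\<lambda>z. a z * b z) \<in> Linf" using assms by blast
  then show ?thesis
    using assms by transfer (auto simp: L2_rel_def mult.assoc intro!: square_integrable_mult_Linf)
qed

lemma mult_L2_cong_AE:
  assumes "a \<in> Linf" "b \<in> Linf" "AE z in circle_measure. a z = b z"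
  shows "mult_L2 a f = mult_L2 b f"
  using assms by transfer
    (auto simp: L2_rel_def intro!: square_integrable_mult_Linf elim!: eventually_mono)

lemma mult_L2_add_symbol:
  assumes "a \<in> Linf" "b \<in> Linf"
  shows "mult_L2 (\<lambda>z. a z + b z) f = mult_L2 a f + mult_L2 b f"
proof -
  have "(\<lambda>z. a z + b z) \<in> Linf" using assms by blast
  then show ?thesis
    using assms by transfer (auto simp: L2_rel_def distrib_right
        intro!: square_integrable_mult_Linf square_integrable_add)
qed

lemma mult_L2_const [simp]: "mult_L2 (\<lambda>_. c) f = c *\<^sub>C f"
  using Linf_const[of c] by transfer (auto simp: L2_rel_def intro: square_integrable_scale)

lemma mult_L2_diff_symbol:
  assumes "a \<in> Linf" "b \<in> Linf"
  shows "mult_L2 (\<lambda>z. a z - b z) f = mult_L2 a f - mult_L2 b f"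
proof -
  have "(\<lambda>z. a z - b z) \<in> Linf" using assms by blast
  from mult_L2_add_symbol[OF this assms(2), of f] show ?thesis by (simp add: algebra_simps)
qed

lemma cinner_mult_L2:
  assumes "a \<in> Linf"
  shows "cinner (mult_L2 a f) g = cinner f (mult_L2 (\<lambda>z. cnj (a z)) g)"
proof -
  have "(\<lambda>z. cnj (a z)) \<in> Linf" using assms by blast
  then show ?thesis
    using assms by transfer (simp add: ac_simps)
qed

lemma cnj_unit: "cmod w = 1 \<Longrightarrow> cnj w = inverse w"
  using complex_norm_square[of w] by (intro inverse_unique[symmetric]) simp

lemma unimodular_Linf: "unimodular a \<Longrightarrow> a \<in> Linf"
  by (simp add: unimodular_def)

lemma mult_L2_unimodular_cancel:
  assumes "unimodular a"
  shows "mult_L2 (\<lambda>z. cnj (a z)) (mult_L2 a f) = f"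
proof -
  note a = unimodular_Linf[OF assms]
  have "mult_L2 (\<lambda>z. cnj (a z)) (mult_L2 a f) = mult_L2 (\<lambda>z. cnj (a z) * a z) f"
    by (intro mult_L2_mult Linf_intros a)
  also have "\<dots> = mult_L2 (\<lambda>_. 1) f"
  proof (rule mult_L2_cong_AE)
    have "AE z in circle_measure. norm (a z) = 1" using assms by (simp add: unimodular_def)
    then show "AE z in circle_measure. cnj (a z) * a z = 1"
    proof eventually_elim
      case (elim z)
      then show ?case using cnj_unit[OF elim] by (cases "a z = 0") auto
    qed
  qed (intro Linf_intros a)+
  finally show ?thesis by simp
qed

lemma cinner_mult_L2_unimodular:
  assumes "unimodular a"
  shows "cinner (mult_L2 a f) (mult_L2 a g) = cinner f g"
  by (simp add: cinner_mult_L2 unimodular_Linf assms mult_L2_unimodular_cancel)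

lemma norm_mult_L2_unimodular:
  assumes "unimodular a"
  shows "norm (mult_L2 a f) = norm f"
proof -
  have "complex_of_real ((norm (mult_L2 a f))\<^sup>2) = complex_of_real ((norm f)\<^sup>2)"
    by (simp only: cinner_self[symmetric] cinner_mult_L2_unimodular[OF assms])
  then have "(norm (mult_L2 a f))\<^sup>2 = (norm f)\<^sup>2"
    using of_real_eq_iff by blast
  then show ?thesis by (simp add: power2_eq_iff_nonneg)
qed

lift_definition one_L2 :: L2 is "\<lambda>_. 1"
  by (simp add: L2_rel_def square_integrable_def)

definition mono_L2 :: "int \<Rightarrow> L2" where
  "mono_L2 n = mult_L2 (\<lambda>z. z powi n) one_L2"

lemma fourier_L2_eq: "fourier_L2 f n = cinner f (mono_L2 n)"
  unfolding mono_L2_def using Linf_powi[of n] by transfer (simp add: fourier_def)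

lemma fourier_eq: "a \<in> Linf \<Longrightarrow> fourier a n = fourier_L2 (mult_L2 a one_L2) n"
  by transfer simp

lemma mult_mono_L2: "mult_L2 (\<lambda>z. z powi m) (mono_L2 n) = mono_L2 (m + n)"
  unfolding mono_L2_def
proof (subst mult_L2_mult[OF Linf_powi Linf_powi], rule mult_L2_cong_AE)
  show "AE z in circle_measure. z powi m * z powi n = z powi (m + n)"
    using AE_circle_norm by eventually_elim (subst power_int_add, auto)
qed (intro Linf_intros)+

lemma integral_circle_measure:
  fixes f :: "complex \<Rightarrow> 'a::{banach, second_countable_topology}"
  assumes [measurable]: "f \<in> borel_measurable borel"
  shows "(\<integral>z. f z \<partial>circle_measure) = (\<integral>t. (indicator {0..2*pi} t / (2 * pi)) *\<^sub>R f (cis t) \<partial>lborel)"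
proof -
  have [measurable]: "cis \<in> borel_measurable borel" by (rule cis_borel_measurable)
  have U: "uniform_measure lborel {0..2*pi} = density lborel (\<lambda>t. ennreal (indicator {0..2*pi} t / (2*pi)))"
    unfolding uniform_measure_def
    by (intro density_cong) (auto simp: indicator_def divide_ennreal[symmetric] ennreal_1[symmetric]
        simp del: ennreal_1)
  have "(\<integral>z. f z \<partial>circle_measure) = (\<integral>t. f (cis t) \<partial>uniform_measure lborel {0..2*pi})"
    unfolding circle_measure_def
    by (rule integral_distr) (simp_all add: measurable_cong_sets[OF sets_uniform_measure refl])
  also have "\<dots> = (\<integral>t. (indicator {0..2*pi} t / (2 * pi)) *\<^sub>R f (cis t) \<partial>lborel)"
    unfolding U by (rule integral_density) auto
  finally show ?thesis .
qed

lemma integral_powi_circle: "(\<integral>z. z powi n \<partial>circle_measure) = (if n = 0 then 1 else 0)"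
proof (cases "n = 0")
  case True
  then show ?thesis using circle.prob_space by simp
next
  case False
  define F where "F t = (1 / (2 * pi * \<i> * n)) * cis (of_int n * t)" for t
  have "(\<integral>z. z powi n \<partial>circle_measure)
      = (\<integral>t. indicator {0..2*pi} t *\<^sub>R ((1 / (2*pi)) *\<^sub>R cis (of_int n * t)) \<partial>lborel)"
    by (subst integral_circle_measure) (auto simp: cis_power_int mult.commute)
  also have "\<dots> = F (2 * pi) - F 0"
  proof (rule integral_FTC_atLeastAtMost)
    fix t assume "0 \<le> t" "t \<le> 2 * pi"
    have "((\<lambda>z. exp (\<i> * of_int n * z)) has_field_derivative (\<i> * of_int n * exp (\<i> * of_int n * of_real t))) (at (of_real t))"
      by (auto intro!: derivative_eq_intros)
    from has_vector_derivative_real_field[OF this]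
    have "((\<lambda>t. cis (of_int n * t)) has_vector_derivative (\<i> * of_int n * cis (of_int n * t))) (at t within {0..2*pi})"
      by (simp add: cis_conv_exp mult.assoc)
    from has_vector_derivative_mult_right[OF this, of "1 / (2 * pi * \<i> * n)"]
    show "(F has_vector_derivative ((1 / (2*pi)) *\<^sub>R cis (of_int n * t))) (at t within {0..2*pi})"
      unfolding F_def using False by (simp add: scaleR_conv_of_real field_simps)
  qed (auto intro!: continuous_intros)
  also have "cis (of_int n * (2 * pi)) = 1"
    using cis_multiple_2pi[of n] by (simp add: mult.commute mult.left_commute)
  then have "F (2 * pi) - F 0 = 0" by (simp add: F_def)
  finally show ?thesis using False by simp
qed

lemma cinner_mono_L2: "cinner (mono_L2 m) (mono_L2 n) = (if m = n then 1 else 0)"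
proof -
  have "cinner (mono_L2 m) (mono_L2 n) = (\<integral>z. z powi m * cnj (z powi n) \<partial>circle_measure)"
    unfolding mono_L2_def using Linf_powi[of n] Linf_powi[of m] by transfer simp
  also have "\<dots> = (\<integral>z. z powi (m - n) \<partial>circle_measure)"
  proof (rule integral_cong_AE)
    show "AE z in circle_measure. z powi m * cnj (z powi n) = z powi (m - n)"
      using AE_circle_norm
    proof eventually_elim
      case (elim z)
      then have "cnj (z powi n) = inverse (z powi n)"
        by (intro cnj_unit) (simp add: norm_power_int)
      then show ?case using elim by (subst power_int_diff) (auto simp: divide_inverse)
    qed
  qed measurable
  finally show ?thesis by (simp add: integral_powi_circle)
qed

lemma fourier_L2_simps [simp]:
  "fourier_L2 (f + g) n = fourier_L2 f n + fourier_L2 g n"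
  "fourier_L2 (f - g) n = fourier_L2 f n - fourier_L2 g n"
  "fourier_L2 (c *\<^sub>C f) n = c * fourier_L2 f n"
  "fourier_L2 0 n = 0"
  by (simp_all add: fourier_L2_eq)

lemma cnj_powi_AE: "AE z in circle_measure. cnj (z powi n) = z powi (- n)"
  using AE_circle_norm
proof eventually_elim
  case (elim z)
  then have "cnj (z powi n) = inverse (z powi n)"
    by (intro cnj_unit) (simp add: norm_power_int)
  then show ?case by (simp add: power_int_minus)
qed

lemma cnj_powi_mult_L2: "mult_L2 (\<lambda>z. cnj (z powi n)) f = mult_L2 (\<lambda>z. z powi (- n)) f"
  by (rule mult_L2_cong_AE) (intro Linf_intros cnj_powi_AE)+

lemma fourier_L2_mult_powi: "fourier_L2 (mult_L2 (\<lambda>z. z powi m) f) n = fourier_L2 f (n - m)"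
  unfolding fourier_L2_eq cinner_mult_L2[OF Linf_powi] cnj_powi_mult_L2 mult_mono_L2
  by (simp only: diff_conv_add_uminus add.commute)

text \<open>Multipliers that preserve vanishing of all Fourier coefficients form an algebra, so
  Stone--Weierstrass applies to them without describing trigonometric polynomials explicitly.\<close>

definition null_multipliers :: "(complex \<Rightarrow> complex) set" where
  "null_multipliers = {a \<in> Linf. \<forall>g. (\<forall>n. fourier_L2 g n = 0) \<longrightarrow> (\<forall>n. fourier_L2 (mult_L2 a g) n = 0)}"

lemma null_multipliers_add:
  "a \<in> null_multipliers \<Longrightarrow> b \<in> null_multipliers \<Longrightarrow> (\<lambda>z. a z + b z) \<in> null_multipliers"
  unfolding null_multipliers_def by (auto simp: mult_L2_add_symbol)

lemma null_multipliers_mult: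
  "a \<in> null_multipliers \<Longrightarrow> b \<in> null_multipliers \<Longrightarrow> (\<lambda>z. a z * b z) \<in> null_multipliers"
  unfolding null_multipliers_def by (auto simp: mult_L2_mult[symmetric])

lemma null_multipliers_const: "(\<lambda>_. c) \<in> null_multipliers"
  unfolding null_multipliers_def by (auto simp: Linf_const)

lemma null_multipliers_powi: "(\<lambda>z. z powi n) \<in> null_multipliers"
  unfolding null_multipliers_def by (auto simp: Linf_powi fourier_L2_mult_powi)

text \<open>On the circle \<open>Re\<close> and \<open>Im\<close> are combinations of
  \<open>z\<close> and its inverse, but not off it. Membership therefore has to pass along equality
  almost everywhere.\<close>

lemma null_multipliers_cong:
  assumes "a \<in> null_multipliers" "b \<in> borel_measurable borel" "AE z in circle_measure. a z = b z"
  shows "b \<in> null_multipliers"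
proof -
  have a: "a \<in> Linf" using assms(1) by (simp add: null_multipliers_def)
  obtain B where "AE z in circle_measure. cmod (a z) \<le> B" by (rule LinfE[OF a])
  with assms(3) have "AE z in circle_measure. cmod (b z) \<le> B"
    by eventually_elim simp
  then have b: "b \<in> Linf" using assms(2) by (intro LinfI)
  have "mult_L2 b g = mult_L2 a g" for g
    by (rule mult_L2_cong_AE) (use a b assms(3) in \<open>auto elim: eventually_mono\<close>)
  then show ?thesis using assms(1) b by (simp add: null_multipliers_def)
qed

lemma null_multipliers_Re_Im:
  "(\<lambda>z. of_real (Re z)) \<in> null_multipliers" "(\<lambda>z. of_real (Im z)) \<in> null_multipliers"
proof -
  have 1: "AE z in circle_measure. z powi (-1) = cnj z"
    using cnj_powi_AE[of 1] by eventually_elim simp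
  have m: "(\<lambda>z. complex_of_real (Re z)) \<in> borel_measurable borel"
    "(\<lambda>z. complex_of_real (Im z)) \<in> borel_measurable borel"
    by measurable
  show "(\<lambda>z. of_real (Re z)) \<in> null_multipliers"
  proof (rule null_multipliers_cong[OF _ m(1)])
    show "(\<lambda>z. (1/2) * (z powi 1 + z powi (-1))) \<in> null_multipliers"
      by (intro null_multipliers_mult null_multipliers_add null_multipliers_const null_multipliers_powi)
    show "AE z in circle_measure. 1 / 2 * (z powi 1 + z powi - 1) = complex_of_real (Re z)"
      using 1 by eventually_elim (simp add: complex_eq_iff)
  qed
  show "(\<lambda>z. of_real (Im z)) \<in> null_multipliers"
  proof (rule null_multipliers_cong[OF _ m(2)])
    show "(\<lambda>z. (-\<i>/2) * (z powi 1 + (-1) * z powi (-1))) \<in> null_multipliers"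
      by (intro null_multipliers_mult null_multipliers_add null_multipliers_const null_multipliers_powi)
    show "AE z in circle_measure. -\<i> / 2 * (z powi 1 + (-1) * z powi - 1) = complex_of_real (Im z)"
      using 1 by eventually_elim (simp add: complex_eq_iff)
  qed
qed

lemma AE_circle_sphere: "AE z in circle_measure. z \<in> sphere 0 1"
  using AE_circle_norm by simp

text \<open>Stone--Weierstrass gives a multiplier \<open>p\<close> within \<open>e\<close> of
  \<open>k\<close> on the circle. Its integral against \<open>f\<close> is a zeroth Fourier
  coefficient and vanishes, and the error is at most \<open>e\<close> times the mean modulus of
  \<open>f\<close>.\<close>

lemma integral_continuous_eq_0:
  fixes k :: "complex \<Rightarrow> real"
  assumes f: "square_integrable f" and z: "\<And>n. fourier f n = 0" and k: "continuous_on UNIV k"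
  shows "(\<integral>z. f z * of_real (k z) \<partial>circle_measure) = 0"
proof -
  have [measurable]: "f \<in> borel_measurable borel" by (rule square_integrable_measurable[OF f])
  have [measurable]: "k \<in> borel_measurable borel"
    by (rule borel_measurable_continuous_onI[OF k])
  have fi: "integrable circle_measure f" by (rule square_integrable_imp_integrable[OF f])
  define R where "R = {p. continuous_on UNIV p \<and> (\<lambda>z. complex_of_real (p z)) \<in> null_multipliers}"
  interpret function_ring_on R "sphere 0 1"
  proof
    show "p \<in> R \<Longrightarrow> continuous_on (sphere 0 1) p" for p
      using continuous_on_subset by (auto simp: R_def)
    show "p \<in> R \<Longrightarrow> q \<in> R \<Longrightarrow> (\<lambda>x. p x + q x) \<in> R" for p q
      using null_multipliers_add by (auto simp: R_def intro!: continuous_intros)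
    show "p \<in> R \<Longrightarrow> q \<in> R \<Longrightarrow> (\<lambda>x. p x * q x) \<in> R" for p q
      using null_multipliers_mult by (auto simp: R_def intro!: continuous_intros)
    show "(\<lambda>_. c) \<in> R" for c
      using null_multipliers_const by (auto simp: R_def)
    have "Re \<in> R" "Im \<in> R"
      using null_multipliers_Re_Im by (auto simp: R_def intro!: continuous_intros)
    then show "\<exists>p\<in>R. p x \<noteq> p y" if "x \<noteq> y" for x y
      using that by (metis complex_eqI)
  qed simp
  have "cmod (\<integral>z. f z * of_real (k z) \<partial>circle_measure) \<le> e * (\<integral>z. cmod (f z) \<partial>circle_measure)" if "e > 0" for e
  proof -
    obtain p where p: "p \<in> R" "\<And>z. z \<in> sphere 0 1 \<Longrightarrow> \<bar>k z - p z\<bar> < e"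
      using Stone_Weierstrass_basic[of k e] continuous_on_subset[OF k] \<open>e > 0\<close> by blast
    have pL: "(\<lambda>z. complex_of_real (p z)) \<in> Linf"
      using p(1) by (simp add: R_def null_multipliers_def)
    have [measurable]: "p \<in> borel_measurable borel"
      using p(1) by (intro borel_measurable_continuous_onI) (simp add: R_def)
    have fp: "square_integrable (\<lambda>z. of_real (p z) * f z)"
      by (rule square_integrable_mult_Linf[OF pL f])
    have fo: "fourier_L2 (abs_L2 g) n = fourier g n" if "square_integrable g" for g n
      using that by (simp add: fourier_L2.abs_eq L2_rel_refl)
    have "mult_L2 (\<lambda>z. of_real (p z)) (abs_L2 f) = abs_L2 (\<lambda>z. of_real (p z) * f z)"
      using f pL by (simp add: mult_L2.abs_eq L2_rel_refl)
    moreover have "fourier_L2 (mult_L2 (\<lambda>z. of_real (p z)) (abs_L2 f)) 0 = 0"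
      using p(1) z fo[OF f] by (auto simp: R_def null_multipliers_def)
    ultimately have "fourier (\<lambda>z. of_real (p z) * f z) 0 = 0"
      using fo[OF fp] by simp
    then have 0: "(\<integral>z. of_real (p z) * f z \<partial>circle_measure) = 0"
      by (simp add: fourier_def)
    have ip: "integrable circle_measure (\<lambda>z. of_real (p z) * f z)"
      by (rule square_integrable_imp_integrable[OF fp])
    have bd: "AE z in circle_measure. cmod (of_real (k z - p z) * f z) \<le> e * cmod (f z)"
      using AE_circle_sphere
    proof eventually_elim
      case (elim z)
      then have "\<bar>k z - p z\<bar> * cmod (f z) \<le> e * cmod (f z)"
        using p(2)[OF elim] by (intro mult_right_mono) auto
      then show ?case by (simp only: norm_mult norm_of_real)
    qed
    have ie: "integrable circle_measure (\<lambda>z. e * cmod (f z))"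
      using fi by simp
    have id: "integrable circle_measure (\<lambda>z. of_real (k z - p z) * f z)"
      by (rule Bochner_Integration.integrable_bound[OF ie])
         (measurable, use bd in \<open>auto elim!: eventually_mono\<close>)
    have "(\<integral>z. f z * of_real (k z) \<partial>circle_measure)
        = (\<integral>z. of_real (k z - p z) * f z + of_real (p z) * f z \<partial>circle_measure)"
      by (simp add: algebra_simps)
    also have "\<dots> = (\<integral>z. of_real (k z - p z) * f z \<partial>circle_measure)"
      by (subst Bochner_Integration.integral_add[OF id ip]) (simp add: 0)
    finally have eq: "(\<integral>z. f z * of_real (k z) \<partial>circle_measure)
        = (\<integral>z. of_real (k z - p z) * f z \<partial>circle_measure)" .
    have "cmod (\<integral>z. f z * of_real (k z) \<partial>circle_measure) \<le> (\<integral>z. e * cmod (f z) \<partial>circle_measure)"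
      unfolding eq by (rule order_trans[OF integral_norm_bound integral_mono_AE[OF integrable_norm[OF id] ie bd]])
    then show ?thesis by simp
  qed
  then have *: "cmod (\<integral>z. f z * of_real (k z) \<partial>circle_measure) \<le> e * (\<integral>z. cmod (f z) \<partial>circle_measure)" if "e > 0" for e
    using that by blast
  have "((\<lambda>e. e * (\<integral>z. cmod (f z) \<partial>circle_measure)) \<longlongrightarrow> 0 * (\<integral>z. cmod (f z) \<partial>circle_measure)) (at_right 0)"
    by (intro tendsto_intros)
  then have "cmod (\<integral>z. f z * of_real (k z) \<partial>circle_measure) \<le> 0 * (\<integral>z. cmod (f z) \<partial>circle_measure)"
    by (rule tendsto_lowerbound) (use * in \<open>auto simp: eventually_at_right_field intro!: exI[of _ 1]\<close>)
  then show ?thesis by simp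
qed

text \<open>The indicator of a closed set is the pointwise limit of the continuous tents
  \<open>k j\<close>, which are bounded by 1, so dominated convergence applies.\<close>

lemma integral_closed_eq_0:
  assumes f: "square_integrable f" and z: "\<And>n. fourier f n = 0" and A: "closed A"
  shows "(\<integral>z. f z * of_real (indicator A z) \<partial>circle_measure) = 0"
\<comment> \<open>\<open>infdist\<close> to the empty set is 0 by convention; the tents would then
  be constantly 1.\<close>
proof (cases "A = {}")
  case False
  have [measurable]: "f \<in> borel_measurable borel" by (rule square_integrable_measurable[OF f])
  have [measurable]: "A \<in> sets borel" using A by simp
  define k where "k j z = max 0 (1 - real j * infdist z A)" for j z
  have kc: "continuous_on UNIV (k j)" for j
    unfolding k_def by (intro continuous_intros)
  have [measurable]: "k j \<in> borel_measurable borel" for j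
    by (rule borel_measurable_continuous_onI[OF kc])
  have lim: "(\<lambda>j. k j z) \<longlonglongrightarrow> indicator A z" for z
  proof (cases "z \<in> A")
    case True
    then show ?thesis by (simp add: k_def)
  next
    case out: False
    then have "infdist z A > 0"
      using A False by (simp add: infdist_pos_not_in_closed)
    then obtain N where N: "real N * infdist z A > 1"
      using reals_Archimedean3 by blast
    have "eventually (\<lambda>j. k j z = 0) sequentially"
      using eventually_ge_at_top[of N]
    proof eventually_elim
      case (elim j)
      then have "real N * infdist z A \<le> real j * infdist z A"
        using \<open>infdist z A > 0\<close> by (intro mult_right_mono) auto
      then show ?case using N by (simp add: k_def)
    qed
    then show ?thesis using out by (simp add: tendsto_eventually)
  qed
  have "(\<lambda>j. \<integral>z. f z * of_real (k j z) \<partial>circle_measure) \<longlonglongrightarrow> (\<integral>z. f z * of_real (indicator A z) \<partial>circle_measure)"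
  proof (rule integral_dominated_convergence[where w = "\<lambda>z. cmod (f z)"])
    show "integrable circle_measure (\<lambda>z. cmod (f z))"
      using square_integrable_imp_integrable[OF f] by simp
    show "AE z in circle_measure. (\<lambda>j. f z * of_real (k j z)) \<longlonglongrightarrow> f z * of_real (indicator A z)"
      by (intro AE_I2 tendsto_intros lim)
    have "\<bar>k j z\<bar> \<le> 1" for j z
      by (simp add: k_def infdist_nonneg)
    then show "AE z in circle_measure. cmod (f z * of_real (k j z)) \<le> cmod (f z)" for j
      by (intro AE_I2) (simp add: norm_mult mult_left_le)
  qed measurable
  then show ?thesis
    by (simp add: integral_continuous_eq_0[OF f z kc] LIMSEQ_const_iff)
qed simp

text \<open>Completeness of the trigonometric system. Closed sets are stable under intersection and
  generate the Borel sets, so a Dynkin argument makes the integral of \<open>f\<close> vanish over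
  every Borel set, and \<open>f\<close> is zero almost everywhere.\<close>

lemma L2_eqI_fourier_0:
  assumes "\<And>n. fourier_L2 F n = 0"
  shows "F = 0"
proof -
  obtain f where f: "square_integrable f" and F: "F = abs_L2 f" by (rule L2_cases)
  have z: "fourier f n = 0" for n
    using assms[of n] f by (simp add: F fourier_L2.abs_eq L2_rel_refl)
  have [measurable]: "f \<in> borel_measurable borel" by (rule square_integrable_measurable[OF f])
  have fi: "integrable circle_measure f" by (rule square_integrable_imp_integrable[OF f])
  have ind: "integrable circle_measure (\<lambda>z. f z * of_real (indicator A z))" if "A \<in> sets borel" for A
  proof -
    have "integrable circle_measure (\<lambda>z. indicator A z *\<^sub>R f z)"
      using that fi by (intro integrable_mult_indicator) auto
    then show ?thesis by (simp add: scaleR_conv_of_real mult.commute)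
  qed
  have all: "(\<integral>z. f z * of_real (indicator A z) \<partial>circle_measure) = 0" if "A \<in> sets borel" for A
  proof -
    have A: "A \<in> sigma_sets UNIV (Collect closed)"
      using that by (simp add: borel_eq_closed)
    have Is: "Int_stable (Collect closed :: complex set set)"
      by (auto simp: Int_stable_def)
    have sb: "B \<in> sets borel" if "B \<in> sigma_sets UNIV (Collect closed)" for B :: "complex set"
      using that by (simp add: borel_eq_closed)
    have cU: "Collect closed \<subseteq> Pow (UNIV :: complex set)" by simp
    from Is cU A show ?thesis
    proof (induction A rule: sigma_sets_induct_disjoint)
      case (basic A)
      then show ?case using integral_closed_eq_0[OF f z] by simp
    next
      case (compl A)
      have "(\<integral>z. f z * of_real (indicator (UNIV - A) z) \<partial>circle_measure)
          = (\<integral>z. f z - f z * of_real (indicator A z) \<partial>circle_measure)"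
        by (intro Bochner_Integration.integral_cong) (auto simp: indicator_def)
      also have "\<dots> = 0"
        using compl ind[OF sb] integral_continuous_eq_0[OF f z, of "\<lambda>_. 1"] fi by simp
      finally show ?case .
    next
      case (union A)
      have "(\<lambda>n. \<integral>z. f z * of_real (indicator (\<Union>i<n. A i) z) \<partial>circle_measure)
          \<longlonglongrightarrow> (\<integral>z. f z * of_real (indicator (\<Union>i. A i) z) \<partial>circle_measure)"
      proof (rule integral_dominated_convergence[where w = "\<lambda>z. cmod (f z)"])
        have [measurable]: "A i \<in> sets borel" for i using union sb by auto
        show "(\<lambda>z. f z * of_real (indicator (\<Union>i. A i) z)) \<in> borel_measurable circle_measure"
          "(\<lambda>z. f z * of_real (indicator (\<Union>i<n. A i) z)) \<in> borel_measurable circle_measure" for n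
          by measurable
        show "integrable circle_measure (\<lambda>z. cmod (f z))" using fi by simp
        show "AE z in circle_measure. (\<lambda>n. f z * of_real (indicator (\<Union>i<n. A i) z)) \<longlonglongrightarrow> f z * of_real (indicator (\<Union>i. A i) z)"
          by (intro AE_I2 tendsto_intros LIMSEQ_indicator_UN)
        show "AE z in circle_measure. cmod (f z * of_real (indicator (\<Union>i<n. A i) z)) \<le> cmod (f z)" for n
          by (intro AE_I2) (simp add: norm_mult indicator_def)
      qed
      moreover have "(\<integral>z. f z * of_real (indicator (\<Union>i<n. A i) z) \<partial>circle_measure) = 0" for n
      proof -
        have "(\<integral>z. f z * of_real (indicator (\<Union>i<n. A i) z) \<partial>circle_measure)
            = (\<integral>z. (\<Sum>i<n. f z * of_real (indicator (A i) z)) \<partial>circle_measure)"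
        proof (intro Bochner_Integration.integral_cong refl)
          fix z
          have "indicator (\<Union>i<n. A i) z = (\<Sum>i<n. indicator (A i) z :: real)"
            using union(1) by (intro indicator_UN_disjoint) (auto simp: disjoint_family_on_def)
          then show "f z * of_real (indicator (\<Union>i<n. A i) z) = (\<Sum>i<n. f z * of_real (indicator (A i) z))"
            by (simp add: sum_distrib_left)
        qed
        also have "\<dots> = (\<Sum>i<n. (\<integral>z. f z * of_real (indicator (A i) z) \<partial>circle_measure))"
          by (intro Bochner_Integration.integral_sum ind sb) (use union in auto)
        finally show ?thesis using union by simp
      qed
      ultimately show ?case by (simp add: LIMSEQ_const_iff)
    qed auto
  qed
  have "AE z in circle_measure. f z = 0"
  proof (rule circle.density_zero[OF fi])
    fix A assume "A \<in> sets circle_measure"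
    then show "set_lebesgue_integral circle_measure A f = 0"
      using all[of A] by (simp add: set_lebesgue_integral_def scaleR_conv_of_real mult.commute)
  qed
  then have "L2_rel f (\<lambda>_. 0)"
    using f by (simp add: L2_rel_def square_integrable_0)
  then show ?thesis
    unfolding F zero_L2.abs_eq by (rule Quotient3_rel_abs[OF Quotient3_L2])
qed

section \<open>The Hardy space and its kernel functions\<close>

lemma mult_L2_commute:
  assumes "a \<in> Linf" "b \<in> Linf"
  shows "mult_L2 a (mult_L2 b f) = mult_L2 b (mult_L2 a f)"
  using assms by (simp add: mult_L2_mult mult.commute)

lemma mult_L2_z: "mult_L2 (\<lambda>z. z) = mult_L2 (\<lambda>z. z powi 1)"
  by simp

lemma mono_L2_0: "mono_L2 0 = one_L2"
  by (simp add: mono_L2_def)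

lemma fourier_L2_z: "fourier_L2 (mult_L2 (\<lambda>z. z) f) n = fourier_L2 f (n - 1)"
  unfolding mult_L2_z by (rule fourier_L2_mult_powi)

lemma cinner_z_z [simp]: "cinner (mult_L2 (\<lambda>z. z) f) (mult_L2 (\<lambda>z. z) g) = cinner f g"
  by (rule cinner_mult_L2_unimodular) (use AE_circle_norm in \<open>simp add: unimodular_def Linf_id\<close>)

lemma norm_mono_L2 [simp]: "norm (mono_L2 n) = 1"
proof -
  have "complex_of_real ((norm (mono_L2 n))\<^sup>2) = 1"
    by (simp only: cinner_self[symmetric] cinner_mono_L2) simp
  then have "(norm (mono_L2 n))\<^sup>2 = 1"
    using of_real_eq_1_iff by blast
  then show ?thesis
    by (simp add: power2_eq_1_iff) (metis norm_ge_zero le_minus_one_simps(3))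
qed

lemma norm_one_L2 [simp]: "norm one_L2 = 1"
  using norm_mono_L2[of 0] by (simp add: mono_L2_0)

lemma fourier_L2_mono: "fourier_L2 (mono_L2 m) n = (if m = n then 1 else 0)"
  by (simp add: fourier_L2_eq cinner_mono_L2)

lemma fourier_L2_one: "fourier_L2 one_L2 n = (if n = 0 then 1 else 0)"
  using fourier_L2_mono[of 0 n] by (auto simp: mono_L2_0)

lemma fourier_L2_bound: "cmod (fourier_L2 f n) \<le> norm f"
  using cinner_bound[of f "mono_L2 n"] by (simp add: fourier_L2_eq)

interpretation H2: closed_csubspace H2
proof -
  interpret U: closed_csubspace UNIV
    by standard auto
  have "H2 = {f \<in> UNIV. \<forall>u\<in>mono_L2 ` {..<0}. cinner f u = 0}"
    by (auto simp: H2_def fourier_L2_eq)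
  then show "closed_csubspace H2"
    using U.closed_csubspace_annihilator[of "mono_L2 ` {..<0}"] by (simp only:)
qed

definition taylor_L2 :: "L2 \<Rightarrow> nat \<Rightarrow> L2" where
  "taylor_L2 f N = (\<Sum>k<N. fourier_L2 f (int k) *\<^sub>C mono_L2 (int k))"

lemma fourier_L2_sum: "fourier_L2 (sum g A) n = (\<Sum>i\<in>A. fourier_L2 (g i) n)"
  by (induction A rule: infinite_finite_induct) auto

lemma fourier_taylor_L2:
  "fourier_L2 (taylor_L2 f N) n = (if 0 \<le> n \<and> n < int N then fourier_L2 f n else 0)"
proof -
  have "fourier_L2 (taylor_L2 f N) n = (\<Sum>k<N. if k = nat n \<and> 0 \<le> n then fourier_L2 f n else 0)"
    unfolding taylor_L2_def fourier_L2_sum by (intro sum.cong) (auto simp: fourier_L2_mono)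
  also have "\<dots> = (if 0 \<le> n \<and> n < int N then fourier_L2 f n else 0)"
    by (cases "0 \<le> n") (auto simp: nat_less_iff)
  finally show ?thesis .
qed

lemma norm_sum_mono_L2:
  assumes "finite A"
  shows "(norm (\<Sum>k\<in>A. c k *\<^sub>C mono_L2 (int k)))\<^sup>2 = (\<Sum>k\<in>A. (cmod (c k))\<^sup>2)"
  using assms
proof (induction A rule: finite_induct)
  case (insert k A)
  have "cinner (c k *\<^sub>C mono_L2 (int k)) (\<Sum>j\<in>A. c j *\<^sub>C mono_L2 (int j)) = 0"
    using insert.hyps by (simp add: cinner.sum_right cinner_mono_L2) (intro sum.neutral, auto)
  from norm_add_orthogonal[OF this] insert show ?case
    by (simp add: power_mult_distrib)
qed simp

lemma taylor_L2_diff: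
  assumes "M \<le> N"
  shows "taylor_L2 f N - taylor_L2 f M = (\<Sum>k\<in>{M..<N}. fourier_L2 f (int k) *\<^sub>C mono_L2 (int k))"
proof -
  have "{..<N} - {..<M} = {M..<N}" by auto
  then show ?thesis
    unfolding taylor_L2_def using assms by (subst sum_diff[symmetric]) auto
qed

lemma bessel:
  "(\<Sum>k<N. (cmod (fourier_L2 f (int k)))\<^sup>2) \<le> (norm f)\<^sup>2"
proof -
  have "cinner (f - taylor_L2 f N) (mono_L2 (int k)) = 0" if "k < N" for k
    using fourier_taylor_L2[of f N "int k"] that by (simp add: fourier_L2_eq)
  then have "cinner (f - taylor_L2 f N) (taylor_L2 f N) = 0"
    unfolding taylor_L2_def[of f N, THEN arg_cong[where f = "cinner (f - taylor_L2 f N)"]]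
    by (simp add: cinner.sum_right del: cinner.diff_left)
  from norm_add_orthogonal[OF this]
  have "(norm f)\<^sup>2 = (norm (f - taylor_L2 f N))\<^sup>2 + (norm (taylor_L2 f N))\<^sup>2" by simp
  moreover have "(norm (taylor_L2 f N))\<^sup>2 = (\<Sum>k<N. (cmod (fourier_L2 f (int k)))\<^sup>2)"
    unfolding taylor_L2_def by (rule norm_sum_mono_L2) simp
  ultimately show ?thesis by simp
qed

lemma summable_fourier_L2: "summable (\<lambda>k. (cmod (fourier_L2 f (int k)))\<^sup>2)"
  by (rule summableI_nonneg_bounded[OF _ bessel]) simp

text \<open>Bessel's inequality makes the partial sums Cauchy. Their limit has the Fourier
  coefficients of \<open>f\<close>, and the completeness of the trigonometric system identifies it
  with \<open>f\<close>.\<close>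

lemma taylor_L2_tendsto:
  assumes "f \<in> H2"
  shows "taylor_L2 f \<longlonglongrightarrow> f"
proof -
  have "Cauchy (taylor_L2 f)"
  proof (rule CauchyI')
    fix e :: real assume "e > 0"
    then obtain M where M: "\<And>m n. m \<ge> M \<Longrightarrow> norm (\<Sum>k\<in>{m..<n}. (cmod (fourier_L2 f (int k)))\<^sup>2) < e\<^sup>2"
      using summable_fourier_L2[of f] unfolding summable_Cauchy by (meson zero_less_power)
    show "\<exists>M. \<forall>m\<ge>M. \<forall>n>m. dist (taylor_L2 f m) (taylor_L2 f n) < e"
    proof (intro exI allI impI)
      fix m n assume "M \<le> m" "m < n"
      then have "(norm (taylor_L2 f n - taylor_L2 f m))\<^sup>2 < e\<^sup>2"
        using M[of m n] by (simp add: taylor_L2_diff norm_sum_mono_L2)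
      then have "norm (taylor_L2 f n - taylor_L2 f m) < e"
        using \<open>e > 0\<close> by (auto intro: power2_less_imp_less[of _ e])
      then show "dist (taylor_L2 f m) (taylor_L2 f n) < e"
        by (simp add: dist_norm norm_minus_commute)
    qed
  qed
  then obtain g where g: "taylor_L2 f \<longlonglongrightarrow> g"
    using Cauchy_convergent convergent_def by blast
  have "fourier_L2 (g - f) n = 0" for n
  proof -
    have lim: "(\<lambda>N. fourier_L2 (taylor_L2 f N) n) \<longlonglongrightarrow> fourier_L2 g n"
      unfolding fourier_L2_eq by (intro cinner.tendsto g tendsto_const)
    moreover have "(\<lambda>N. fourier_L2 (taylor_L2 f N) n) \<longlonglongrightarrow> fourier_L2 f n"
    proof (cases "n < 0")
      case True
      then show ?thesis using assms by (simp add: fourier_taylor_L2 H2_def)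
    next
      case False
      show ?thesis
        by (rule tendsto_eventually)
           (use False in \<open>auto simp: fourier_taylor_L2 eventually_sequentially intro!: exI[of _ "Suc (nat n)"]\<close>)
    qed
    ultimately show ?thesis using LIMSEQ_unique by fastforce
  qed
  then have "g - f = 0" by (rule L2_eqI_fourier_0)
  then show ?thesis using g by simp
qed

lemma cinner_H2_sums:
  assumes "f \<in> H2"
  shows "(\<lambda>k. fourier_L2 f (int k) * cinner (mono_L2 (int k)) g) sums cinner f g"
proof -
  have "(\<lambda>N. cinner (taylor_L2 f N) g) \<longlonglongrightarrow> cinner f g"
    by (intro cinner.tendsto taylor_L2_tendsto assms tendsto_const)
  then show ?thesis
    by (simp add: sums_def taylor_L2_def cinner.sum_left)
qed

lemma norm_H2_sums:
  assumes "f \<in> H2"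
  shows "(\<lambda>k. (cmod (fourier_L2 f (int k)))\<^sup>2) sums (norm f)\<^sup>2"
proof -
  have "(\<lambda>N. (norm (taylor_L2 f N))\<^sup>2) \<longlonglongrightarrow> (norm f)\<^sup>2"
    by (intro tendsto_intros taylor_L2_tendsto assms)
  then show ?thesis
    by (simp add: sums_def taylor_L2_def norm_sum_mono_L2)
qed

lemma mono_L2_in_H2: "mono_L2 (int k) \<in> H2"
  by (simp add: H2_def fourier_L2_mono)

lemma one_L2_in_H2: "one_L2 \<in> H2"
  using mono_L2_in_H2[of 0] by (simp add: mono_L2_0)

lemma z_mult_in_H2: "f \<in> H2 \<Longrightarrow> mult_L2 (\<lambda>z. z) f \<in> H2"
  by (simp add: H2_def fourier_L2_z)

lemma Hinf_Linf: "a \<in> Hinf \<Longrightarrow> a \<in> Linf"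
  by (simp add: Hinf_def)

lemma mult_L2_mono_L2: "a \<in> Linf \<Longrightarrow> mult_L2 a (mono_L2 n) = mult_L2 (\<lambda>z. z powi n) (mult_L2 a one_L2)"
  unfolding mono_L2_def by (intro mult_L2_commute Linf_powi)

text \<open>For a monomial of degree \<open>k\<close> the coefficient of index \<open>n\<close> of
  the product is the coefficient of \<open>a\<close> of index \<open>n - k\<close>, which is
  negative. The expansion of \<open>h\<close> carries this over to \<open>H2\<close>.\<close>

lemma Hinf_mult_H2:
  assumes a: "a \<in> Hinf" and h: "h \<in> H2"
  shows "mult_L2 a h \<in> H2"
  unfolding H2_def
proof (intro CollectI allI impI)
  fix n :: int assume n: "n < 0"
  note aL = Hinf_Linf[OF a]
  have "cinner (mono_L2 (int k)) (mult_L2 (\<lambda>z. cnj (a z)) (mono_L2 n)) = 0" for k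
  proof -
    have "cinner (mono_L2 (int k)) (mult_L2 (\<lambda>z. cnj (a z)) (mono_L2 n)) = fourier_L2 (mult_L2 a (mono_L2 (int k))) n"
      by (simp add: fourier_L2_eq cinner_mult_L2[OF aL])
    also have "\<dots> = fourier a (n - int k)"
      by (simp only: mult_L2_mono_L2[OF aL] fourier_L2_mult_powi fourier_eq[OF aL])
    also have "\<dots> = 0" using a n by (simp add: Hinf_def)
    finally show ?thesis .
  qed
  then have "cinner h (mult_L2 (\<lambda>z. cnj (a z)) (mono_L2 n)) = 0"
    using cinner_H2_sums[OF h, of "mult_L2 (\<lambda>z. cnj (a z)) (mono_L2 n)"] sums_unique2[OF _ sums_zero]
    by simp
  then show "fourier_L2 (mult_L2 a h) n = 0"
    by (simp add: fourier_L2_eq cinner_mult_L2[OF aL])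
qed

section \<open>Szego kernels and point evaluation in the disc\<close>

definition szego :: "complex \<Rightarrow> complex \<Rightarrow> complex" where
  "szego w z = 1 / (1 - cnj w * z)"

definition szego_L2 :: "complex \<Rightarrow> L2" where
  "szego_L2 w = mult_L2 (szego w) one_L2"

lemma szego_denom: "cmod w < 1 \<Longrightarrow> cmod z \<le> 1 \<Longrightarrow> 1 - cnj w * z \<noteq> 0"
proof
  assume w: "cmod w < 1" "cmod z \<le> 1" and "1 - cnj w * z = 0"
  then have "cmod (cnj w * z) = 1" by (metis norm_one right_minus_eq)
  moreover have "cmod (cnj w * z) \<le> cmod w * 1"
    using w by (simp add: norm_mult mult_left_le)
  ultimately show False using w by simp
qed

lemma szego_Linf:
  assumes "cmod w < 1"
  shows "szego w \<in> Linf"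
proof (rule LinfI)
  show "szego w \<in> borel_measurable borel"
    unfolding szego_def by measurable
  show "AE z in circle_measure. cmod (szego w z) \<le> 1 / (1 - cmod w)"
    using AE_circle_norm
  proof eventually_elim
    case (elim z)
    have "1 - cmod w \<le> cmod (1 - cnj w * z)"
      using norm_triangle_ineq2[of 1 "cnj w * z"] elim by (simp add: norm_mult)
    then show ?case
      using assms by (simp add: szego_def norm_divide frac_le)
  qed
qed

text \<open>The geometric series of the kernel folded into a single step. Coefficients, point values
  and products with \<theta> are all derived from this recursion.\<close>

lemma szego_L2_rec:
  assumes "cmod w < 1"
  shows "szego_L2 w = one_L2 + cnj w *\<^sub>C mult_L2 (\<lambda>z. z) (szego_L2 w)"
proof -
  note s = szego_Linf[OF assms]
  have "cnj w *\<^sub>C mult_L2 (\<lambda>z. z) (szego_L2 w) = mult_L2 (\<lambda>z. cnj w * (z * szego w z)) one_L2"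
    unfolding szego_L2_def mult_L2_const[of "cnj w", symmetric]
    by (subst mult_L2_mult, (intro Linf_intros s)+, subst mult_L2_mult) (intro Linf_intros s refl)+
  moreover have "one_L2 = mult_L2 (\<lambda>_. 1) one_L2" by simp
  ultimately have "one_L2 + cnj w *\<^sub>C mult_L2 (\<lambda>z. z) (szego_L2 w)
      = mult_L2 (\<lambda>z. 1 + cnj w * (z * szego w z)) one_L2"
    by (subst mult_L2_add_symbol) (intro Linf_intros s, simp)+
  also have "\<dots> = szego_L2 w"
    unfolding szego_L2_def
  proof (rule mult_L2_cong_AE)
    show "AE z in circle_measure. 1 + cnj w * (z * szego w z) = szego w z"
      using AE_circle_norm
      by eventually_elim (use szego_denom[OF assms] in \<open>simp add: szego_def field_simps\<close>)
  qed (intro Linf_intros s)+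
  finally show ?thesis by simp
qed

lemma fourier_szego_L2:
  assumes w: "cmod w < 1"
  shows "fourier_L2 (szego_L2 w) n = (if n < 0 then 0 else cnj w ^ nat n)"
proof -
  let ?F = "fourier_L2 (szego_L2 w)"
  have rec: "?F n = (if n = 0 then 1 else 0) + cnj w * ?F (n - 1)" for n
    by (subst szego_L2_rec[OF w]) (simp add: fourier_L2_one fourier_L2_z)
  \<comment> \<open>Going down from a negative index, the recursion never meets the constant term,
    so each step contributes a factor \<open>cnj w\<close>. Coefficients are bounded by the norm,
    hence the value is 0.\<close>
  have neg: "?F n = 0" if "n < 0" for n
  proof -
    have eq: "?F n = cnj w ^ m * ?F (n - int m)" for m
    proof (induction m)
      case (Suc m)
      have "?F (n - int m) = cnj w * ?F (n - int (Suc m))"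
        using rec[of "n - int m"] that by (simp add: algebra_simps)
      then show ?case using Suc by simp
    qed simp
    have "cmod (?F n) \<le> cmod w ^ m * norm (szego_L2 w)" for m
      using eq[of m] fourier_L2_bound[of "szego_L2 w" "n - int m"]
      by (simp add: norm_mult norm_power mult_left_mono)
    moreover have "(\<lambda>m. cmod w ^ m * norm (szego_L2 w)) \<longlonglongrightarrow> 0 * norm (szego_L2 w)"
      by (intro tendsto_intros LIMSEQ_power_zero) (use w in simp)
    ultimately have "cmod (?F n) \<le> 0 * norm (szego_L2 w)"
      by (intro LIMSEQ_le_const) auto
    then show ?thesis by simp
  qed
  have "?F (int m) = cnj w ^ m" for m
  proof (induction m)
    case 0
    show ?case using rec[of 0] neg[of "-1"] by simp
  next
    case (Suc m)
    show ?case using rec[of "int (Suc m)"] Suc by simp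
  qed
  from this[of "nat n"] neg show ?thesis by auto
qed

lemma szego_L2_in_H2: "cmod w < 1 \<Longrightarrow> szego_L2 w \<in> H2"
  by (simp add: H2_def fourier_szego_L2)

lemma cinner_mono_szego_L2: "cmod w < 1 \<Longrightarrow> cinner (mono_L2 (int k)) (szego_L2 w) = w ^ k"
  using fourier_szego_L2[of w "int k"] cinner_commute[of "mono_L2 (int k)" "szego_L2 w"]
  by (simp add: fourier_L2_eq)

lemma eval_sums:
  assumes "f \<in> H2" "cmod w < 1"
  shows "(\<lambda>k. fourier_L2 f (int k) * w ^ k) sums cinner f (szego_L2 w)"
  using cinner_H2_sums[OF assms(1), of "szego_L2 w"] by (simp add: cinner_mono_szego_L2 assms(2))

lemma eval_z_mult:
  assumes "f \<in> H2" "cmod w < 1"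
  shows "cinner (mult_L2 (\<lambda>z. z) f) (szego_L2 w) = w * cinner f (szego_L2 w)"
proof -
  have "cinner (mult_L2 (\<lambda>z. z) f) one_L2 = fourier_L2 f (-1)"
    using fourier_L2_z[of f 0] by (simp add: fourier_L2_eq mono_L2_0)
  also have "\<dots> = 0" using assms by (simp add: H2_def)
  finally show ?thesis
    by (subst szego_L2_rec[OF assms(2)]) simp
qed

lemma disc_ext_sums:
  assumes "a \<in> Hinf" "cmod w < 1"
  shows "(\<lambda>k. fourier a (int k) * w ^ k) sums disc_ext a w"
    and disc_ext_eq: "disc_ext a w = cinner (mult_L2 a one_L2) (szego_L2 w)"
proof -
  have s: "(\<lambda>k. fourier a (int k) * w ^ k) sums cinner (mult_L2 a one_L2) (szego_L2 w)"
    using eval_sums[OF Hinf_mult_H2[OF assms(1) one_L2_in_H2] assms(2)]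
    by (simp add: fourier_eq Hinf_Linf assms)
  then show "disc_ext a w = cinner (mult_L2 a one_L2) (szego_L2 w)"
    unfolding disc_ext_def by (rule sums_unique[symmetric])
  with s show "(\<lambda>k. fourier a (int k) * w ^ k) sums disc_ext a w" by simp
qed

lemma disc_ext_holomorphic:
  assumes "a \<in> Hinf"
  shows "disc_ext a holomorphic_on ball 0 1"
  by (rule power_series_holomorphic[where a = "\<lambda>k. fourier a (int k)"])
     (use disc_ext_sums[OF assms] in simp)

text \<open>Evaluation is multiplicative on monomials because factors of \<open>z\<close> can be
  pulled out one at a time by \<open>eval_z_mult\<close>. The power series of \<open>h\<close> then
  gives the general case.\<close>

lemma eval_Hinf_mult:
  assumes a: "a \<in> Hinf" and h: "h \<in> H2" and w: "cmod w < 1"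
  shows "cinner (mult_L2 a h) (szego_L2 w) = disc_ext a w * cinner h (szego_L2 w)"
proof -
  note aL = Hinf_Linf[OF a]
  have mono: "cinner (mult_L2 a (mono_L2 (int k))) (szego_L2 w) = w ^ k * disc_ext a w" for k
  proof (induction k)
    case 0
    show ?case by (simp add: mono_L2_0 disc_ext_eq[OF a w])
  next
    case (Suc k)
    have "mono_L2 (int (Suc k)) = mult_L2 (\<lambda>z. z) (mono_L2 (int k))"
      using mult_mono_L2[of 1 "int k"] by simp
    then have "mult_L2 a (mono_L2 (int (Suc k))) = mult_L2 (\<lambda>z. z) (mult_L2 a (mono_L2 (int k)))"
      by (simp add: mult_L2_commute[OF aL Linf_id])
    then show ?case
      using Suc by (simp add: eval_z_mult Hinf_mult_H2 a mono_L2_in_H2 w)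
  qed
  have "(\<lambda>k. fourier_L2 h (int k) * cinner (mono_L2 (int k)) (mult_L2 (\<lambda>z. cnj (a z)) (szego_L2 w)))
      sums cinner h (mult_L2 (\<lambda>z. cnj (a z)) (szego_L2 w))"
    by (rule cinner_H2_sums[OF h])
  then have "(\<lambda>k. (fourier_L2 h (int k) * w ^ k) * disc_ext a w) sums cinner (mult_L2 a h) (szego_L2 w)"
    by (simp add: cinner_mult_L2[OF aL, symmetric] mono mult.assoc)
  moreover have "(\<lambda>k. (fourier_L2 h (int k) * w ^ k) * disc_ext a w) sums (cinner h (szego_L2 w) * disc_ext a w)"
    by (intro sums_mult2 eval_sums h w)
  ultimately show ?thesis
    by (metis sums_unique2 mult.commute)
qed

lemma cinner_szego_L2:
  assumes "cmod w < 1" "cmod z < 1"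
  shows "cinner (szego_L2 w) (szego_L2 z) = 1 / (1 - cnj w * z)"
proof -
  let ?c = "cinner (szego_L2 w) (szego_L2 z)"
  have "cinner one_L2 (szego_L2 z) = 1"
    using cinner_mono_szego_L2[of z 0] assms by (simp add: mono_L2_0)
  then have "?c = 1 + cnj w * (z * ?c)"
    by (subst szego_L2_rec[OF assms(1)]) (simp add: eval_z_mult szego_L2_in_H2 assms)
  then have "?c * (1 - cnj w * z) = 1" by (simp add: algebra_simps)
  then show ?thesis
    using szego_denom[of w z] assms by (simp add: field_simps)
qed

lemma cnj_mult_self: "cnj w * w = complex_of_real ((cmod w)\<^sup>2)"
  by (simp only: complex_norm_square mult.commute[of "cnj w"])

lemma norm_szego_L2:
  assumes "cmod w < 1"
  shows "(norm (szego_L2 w))\<^sup>2 = 1 / (1 - (cmod w)\<^sup>2)"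
proof -
  have "complex_of_real ((norm (szego_L2 w))\<^sup>2) = complex_of_real (1 / (1 - (cmod w)\<^sup>2))"
    by (simp only: cinner_self[symmetric] cinner_szego_L2[OF assms assms] cnj_mult_self
        of_real_divide of_real_diff of_real_1)
  then show ?thesis using of_real_eq_iff by blast
qed

section \<open>Model spaces and dual-band spaces\<close>

lemma zbar_eq_powi: "mult_L2 (\<lambda>z. cnj z) f = mult_L2 (\<lambda>z. z powi (-1)) f"
  using cnj_powi_mult_L2[of 1 f] by simp

lemma zbar_z [simp]: "mult_L2 (\<lambda>z. cnj z) (mult_L2 (\<lambda>z. z) f) = f"
  by (rule mult_L2_unimodular_cancel) (use AE_circle_norm in \<open>simp add: unimodular_def Linf_id\<close>)

lemma z_zbar [simp]: "mult_L2 (\<lambda>z. z) (mult_L2 (\<lambda>z. cnj z) f) = f"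
  using mult_L2_commute[OF Linf_id Linf_cnj[OF Linf_id], of f] by simp

lemma fourier_L2_zbar: "fourier_L2 (mult_L2 (\<lambda>z. cnj z) f) n = fourier_L2 f (n + 1)"
  unfolding zbar_eq_powi fourier_L2_mult_powi by simp

lemma zbar_mono: "mult_L2 (\<lambda>z. cnj z) (mono_L2 n) = mono_L2 (n - 1)"
  unfolding zbar_eq_powi mult_mono_L2 by simp

lemma zbar_one: "mult_L2 (\<lambda>z. cnj z) one_L2 = mono_L2 (-1)"
  using zbar_mono[of 0] by (simp add: mono_L2_0)

lemma cinner_z_left: "cinner (mult_L2 (\<lambda>z. z) f) g = cinner f (mult_L2 (\<lambda>z. cnj z) g)"
  by (rule cinner_mult_L2[OF Linf_id])

text \<open>The backward shift \<open>(f - f(0)) / z\<close>, written on the circle with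
  \<open>cnj z\<close>. For \<open>f\<close> in \<open>H2\<close> the subtracted term is the only
  part of \<open>cnj z * f\<close> outside \<open>H2\<close>.\<close>

definition bshift :: "L2 \<Rightarrow> L2" where
  "bshift f = mult_L2 (\<lambda>z. cnj z) f - fourier_L2 f 0 *\<^sub>C mono_L2 (-1)"

lemma bshift_in_H2: "f \<in> H2 \<Longrightarrow> bshift f \<in> H2"
proof -
  assume f: "f \<in> H2"
  have "fourier_L2 (bshift f) n = 0" if "n < 0" for n
  proof (cases "n = -1")
    case False
    then show ?thesis using f that
      by (simp add: bshift_def fourier_L2_zbar fourier_L2_mono H2_def)
  qed (simp add: bshift_def fourier_L2_zbar fourier_L2_mono)
  then show ?thesis by (simp add: H2_def)
qed

lemma bshift_decomp: "f = fourier_L2 f 0 *\<^sub>C one_L2 + mult_L2 (\<lambda>z. z) (bshift f)"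
proof -
  have "mult_L2 (\<lambda>z. z) (mono_L2 (-1)) = one_L2"
    using z_zbar[of one_L2] by (simp add: zbar_one)
  then show ?thesis
    by (simp add: bshift_def mult_L2_diff mult_L2_scaleC)
qed

lemma norm_mult_z [simp]: "norm (mult_L2 (\<lambda>z. z) f) = norm f"
  by (rule norm_mult_L2_unimodular) (use AE_circle_norm in \<open>simp add: unimodular_def Linf_id\<close>)

lemma (in closed_csubspace) compressed_shift_minus_in:
  "x \<in> M \<Longrightarrow> compressed_shift M x - \<mu> *\<^sub>C x \<in> M"
  unfolding compressed_shift_def by (intro L2.subspace_diff L2.subspace_scale subspace orth_proj_in)

lemma (in closed_csubspace) fredholm_shiftI:
  assumes V: "finite V" "\<And>x. x \<in> M \<Longrightarrow> compressed_shift M x - \<mu> *\<^sub>C x = 0 \<Longrightarrow> x \<in> L2.span V"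
    and U: "finite U" "\<And>y. y \<in> M \<Longrightarrow> (\<And>u. u \<in> U \<Longrightarrow> cinner y u = 0) \<Longrightarrow>
      y \<in> (\<lambda>f. compressed_shift M f - \<mu> *\<^sub>C f) ` M"
  shows "fredholm_on M (\<lambda>f. compressed_shift M f - \<mu> *\<^sub>C f)"
  by (rule fredholm_onI[OF compressed_shift_minus_in _ _ V U])
     (auto simp: compressed_shift_def orth_proj_add orth_proj_scaleC mult_L2_add mult_L2_scaleC
       L2.scale_right_distrib L2.scale_right_diff_distrib mult.commute)

text \<open>For \<open>\<bar>\<mu>\<bar> \<noteq> 1\<close>, compressing the multiplication by \<open>1 / (z - \<mu>)\<close> gives an inverse up to
  finite rank of the compressed shift minus \<open>\<mu>\<close>, because \<open>z M\<close> and \<open>cnj z M\<close> stick out of \<open>M\<close> only in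
  finitely many directions.\<close>

lemma (in closed_csubspace) fredholm_off_circle:
  assumes W: "finite W1" "finite W2"
    and zM: "\<And>m. m \<in> M \<Longrightarrow> \<exists>w\<in>L2.span W1. mult_L2 (\<lambda>z. z) m - w \<in> M"
    and zbM: "\<And>m. m \<in> M \<Longrightarrow> \<exists>w\<in>L2.span W2. mult_L2 (\<lambda>z. cnj z) m - w \<in> M"
    and mu: "cmod \<mu> \<noteq> 1"
  shows "fredholm_on M (\<lambda>f. compressed_shift M f - \<mu> *\<^sub>C f)"
proof -
  let ?P = "orth_proj M"
  define q where "q z = 1 / (z - \<mu>)" for z
  have q: "q \<in> Linf"
  proof (rule LinfI)
    show "q \<in> borel_measurable borel" unfolding q_def by measurable
    show "AE z in circle_measure. cmod (q z) \<le> 1 / \<bar>1 - cmod \<mu>\<bar>"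
      using AE_circle_norm
    proof eventually_elim
      case (elim z)
      have "\<bar>1 - cmod \<mu>\<bar> \<le> cmod (z - \<mu>)" using norm_triangle_ineq3[of z \<mu>] elim by simp
      then show ?case using mu by (simp add: q_def norm_divide frac_le)
    qed
  qed
  have zmu: "(\<lambda>z. z - \<mu>) \<in> Linf" by (intro Linf_intros)
  have mzmu: "mult_L2 (\<lambda>z. z - \<mu>) f = mult_L2 (\<lambda>z. z) f - \<mu> *\<^sub>C f" for f
    using mult_L2_diff_symbol[OF Linf_id Linf_const, of \<mu> f] by simp
  have AE1: "AE z in circle_measure. q z * (z - \<mu>) = 1"
    using AE_circle_norm by eventually_elim (use mu in \<open>auto simp: q_def\<close>)
  have qz: "mult_L2 q (mult_L2 (\<lambda>z. z - \<mu>) f) = f" for f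
  proof -
    have "mult_L2 q (mult_L2 (\<lambda>z. z - \<mu>) f) = mult_L2 (\<lambda>_. 1) f"
      unfolding mult_L2_mult[OF q zmu] by (rule mult_L2_cong_AE[OF Linf_mult[OF q zmu] Linf_const AE1])
    then show ?thesis by simp
  qed
  have zq: "mult_L2 (\<lambda>z. z - \<mu>) (mult_L2 q f) = f" for f
    using qz[of f] mult_L2_commute[OF q zmu] by simp
  have Teq: "compressed_shift M x - \<mu> *\<^sub>C x = ?P (mult_L2 (\<lambda>z. z - \<mu>) x)" if "x \<in> M" for x
    using that by (simp add: compressed_shift_def mzmu orth_proj_diff orth_proj_scaleC)
  let ?T = "\<lambda>f. compressed_shift M f - \<mu> *\<^sub>C f"
  \<comment> \<open>If \<open>?T x = 0\<close>, then \<open>(z - \<mu>) x = w - ?P w\<close> for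
    some \<open>w\<close> in the span of \<open>W1\<close>, so \<open>x\<close> is recovered by
    multiplying with \<open>q\<close>. Orthogonality of \<open>y\<close> to \<open>?U\<close> says
    that the part of \<open>q y\<close> outside \<open>M\<close> is orthogonal to
    \<open>W2\<close>.\<close>
  let ?V = "(\<lambda>w. mult_L2 q (w - ?P w)) ` W1"
  let ?U = "(\<lambda>w. mult_L2 (\<lambda>z. cnj (q z)) (w - ?P w)) ` W2"
  have Vspan: "mult_L2 q (w - ?P w) \<in> L2.span ?V" if "w \<in> L2.span W1" for w
    using that
  proof (induction rule: L2.span_induct_alt)
    case base
    then show ?case using orth_proj_ident[OF L2.subspace_0[OF subspace]] by (simp add: L2.span_zero)
  next
    case (step c x y)
    have "mult_L2 q (c *\<^sub>C x + y - ?P (c *\<^sub>C x + y)) = c *\<^sub>C mult_L2 q (x - ?P x) + mult_L2 q (y - ?P y)"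
      by (simp add: orth_proj_add orth_proj_scaleC mult_L2_add mult_L2_diff mult_L2_scaleC
          L2.scale_right_diff_distrib)
    moreover have "mult_L2 q (x - ?P x) \<in> L2.span ?V"
      using step by (intro L2.span_base) auto
    ultimately show ?case using step by (simp add: L2.span_add L2.span_scale)
  qed
  show ?thesis
  proof (rule fredholm_shiftI)
    show "finite ?V" "finite ?U" using W by auto
    show "x \<in> L2.span ?V" if x: "x \<in> M" and T0: "?T x = 0" for x
    proof -
      obtain w where w: "w \<in> L2.span W1" "mult_L2 (\<lambda>z. z) x - w \<in> M" using zM[OF x] by blast
      have "?P (mult_L2 (\<lambda>z. z) x) = ?P (mult_L2 (\<lambda>z. z) x - w) + ?P w"
        by (simp flip: orth_proj_add)
      then have "\<mu> *\<^sub>C x = (mult_L2 (\<lambda>z. z) x - w) + ?P w"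
        using T0 w(2) by (simp add: compressed_shift_def)
      then have "mult_L2 (\<lambda>z. z - \<mu>) x = w - ?P w" by (simp add: mzmu)
      then have "x = mult_L2 q (w - ?P w)" using qz[of x] by simp
      then show ?thesis using Vspan[OF w(1)] by simp
    qed
    show "y \<in> ?T ` M" if y: "y \<in> M" and U: "\<And>u. u \<in> ?U \<Longrightarrow> cinner y u = 0" for y
    proof -
      \<comment> \<open>The part of \<open>q y\<close> lost by projecting. Its compression under
        \<open>z - \<mu>\<close> must vanish for \<open>?P (mult_L2 q y)\<close> to be an exact
        preimage of \<open>y\<close>.\<close>
      define v where "v = mult_L2 q y - ?P (mult_L2 q y)"
      have vM: "cinner v m = 0" if "m \<in> M" for m unfolding v_def by (rule cinner_orth_proj[OF that])
      have vw: "cinner v w = 0" if "w \<in> L2.span W2" for w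
        using that
      proof (induction rule: L2.span_induct_alt)
        case (step c a b)
        have "cinner v a = cinner (mult_L2 q y) (a - ?P a)"
          by (simp add: v_def cinner_orth_proj_swap)
        also have "\<dots> = cinner y (mult_L2 (\<lambda>z. cnj (q z)) (a - ?P a))"
          by (rule cinner_mult_L2[OF q])
        also have "\<dots> = 0" using U step by blast
        finally show ?case using step by simp
      qed simp
      have "?P (mult_L2 (\<lambda>z. z) v) = 0"
      proof (rule orth_proj_eq_0)
        fix m assume "m \<in> M"
        then obtain w where w: "w \<in> L2.span W2" "mult_L2 (\<lambda>z. cnj z) m - w \<in> M" using zbM by blast
        have "cinner (mult_L2 (\<lambda>z. z) v) m = cinner v (mult_L2 (\<lambda>z. cnj z) m - w) + cinner v w"
          by (simp add: cinner_z_left)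
        then show "cinner (mult_L2 (\<lambda>z. z) v) m = 0"
          using vM[OF w(2)] vw[OF w(1)] by simp
      qed
      moreover have "?P v = 0" by (rule orth_proj_eq_0) (rule vM)
      ultimately have "?P (mult_L2 (\<lambda>z. z - \<mu>) v) = 0"
        by (simp add: mzmu orth_proj_diff orth_proj_scaleC)
      moreover have "mult_L2 (\<lambda>z. z - \<mu>) (?P (mult_L2 q y)) = y - mult_L2 (\<lambda>z. z - \<mu>) v"
        by (simp add: v_def mult_L2_diff zq)
      ultimately have "?T (?P (mult_L2 q y)) = y"
        using y by (subst Teq) (simp_all add: orth_proj_diff)
      then have "y = ?T (?P (mult_L2 q y))" by (rule sym)
      then show ?thesis by (rule image_eqI) (rule orth_proj_in)
    qed
  qed
qed

locale inner_symbol =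
  fixes \<theta> :: "complex \<Rightarrow> complex"
  assumes inner: "inner_fun \<theta>"
begin

abbreviation "K \<equiv> model_space \<theta>"
abbreviation "S f \<equiv> mult_L2 (\<lambda>z. z) f"

definition "theta1 = mult_L2 \<theta> one_L2"
definition "defect f = cinner (S f) theta1"

lemma Hinf: "\<theta> \<in> Hinf" and unim: "unimodular \<theta>" and Linf: "\<theta> \<in> Linf"
  using inner by (auto simp: inner_fun_def unimodular_def)

sublocale K: closed_csubspace K
proof -
  have "K = {f \<in> H2. \<forall>u\<in>mult_L2 \<theta> ` H2. cinner f u = 0}"
    by (auto simp: model_space_def)
  then show "closed_csubspace K"
    using H2.closed_csubspace_annihilator[of "mult_L2 \<theta> ` H2"] by (simp only:)
qed

lemma K_H2: "f \<in> K \<Longrightarrow> f \<in> H2"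
  and K_orth: "f \<in> K \<Longrightarrow> g \<in> H2 \<Longrightarrow> cinner f (mult_L2 \<theta> g) = 0"
  by (auto simp: model_space_def)

lemma KI: "f \<in> H2 \<Longrightarrow> (\<And>g. g \<in> H2 \<Longrightarrow> cinner f (mult_L2 \<theta> g) = 0) \<Longrightarrow> f \<in> K"
  by (auto simp: model_space_def)

lemma theta1_H2: "theta1 \<in> H2"
  unfolding theta1_def by (rule Hinf_mult_H2[OF Hinf one_L2_in_H2])

lemma norm_theta1: "norm theta1 = 1"
  by (simp add: theta1_def norm_mult_L2_unimodular unim)

lemma theta1_orth: "f \<in> K \<Longrightarrow> cinner f theta1 = 0"
  unfolding theta1_def by (rule K_orth[OF _ one_L2_in_H2])

lemma theta1_orth': "f \<in> K \<Longrightarrow> cinner theta1 f = 0"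
  using theta1_orth[of f] by (subst cinner_commute) simp

lemma norm_defect: "cmod (defect f) \<le> norm f"
  using cinner_bound[of "S f" theta1] by (simp add: defect_def norm_theta1)

text \<open>Split \<open>g\<close> into its constant term and \<open>z\<close> times its backward
  shift. The second part pairs to 0 with \<open>S f\<close> because \<open>z\<close> is isometric
  and \<open>f\<close> lies in \<open>K\<close>; subtracting the component along
  \<open>theta1\<close> removes the first.\<close>

lemma shift_minus_defect_in_K:
  assumes f: "f \<in> K"
  shows "S f - defect f *\<^sub>C theta1 \<in> K"
proof (rule KI)
  show "S f - defect f *\<^sub>C theta1 \<in> H2"
    by (intro L2.subspace_diff L2.subspace_scale H2.subspace z_mult_in_H2 K_H2 f theta1_H2)
  fix g assume g: "g \<in> H2"
  have "mult_L2 \<theta> g = fourier_L2 g 0 *\<^sub>C theta1 + S (mult_L2 \<theta> (bshift g))"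
    using bshift_decomp[of g] mult_L2_commute[OF Linf Linf_id]
    by (metis mult_L2_add mult_L2_scaleC theta1_def)
  then have "cinner (S f) (mult_L2 \<theta> g) = cnj (fourier_L2 g 0) * defect f"
    using K_orth[OF f bshift_in_H2[OF g]] by (simp add: defect_def)
  moreover have "cinner theta1 (mult_L2 \<theta> g) = cnj (fourier_L2 g 0)"
    using cinner_commute[of one_L2 g]
    by (simp add: theta1_def cinner_mult_L2_unimodular unim fourier_L2_eq mono_L2_0)
  ultimately show "cinner (S f - defect f *\<^sub>C theta1) (mult_L2 \<theta> g) = 0" by simp
qed

text \<open>Multiplying both arguments by \<open>z\<close> turns the pairing into that of
  \<open>f - f(0)\<close> with \<open>\<theta> z g\<close>. Here \<open>f\<close> contributes 0
  since it lies in \<open>K\<close>, and the constant contributes 0 since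
  \<open>\<theta> z g\<close> has no constant term.\<close>

lemma bshift_in_K:
  assumes f: "f \<in> K"
  shows "bshift f \<in> K"
proof (rule KI)
  show "bshift f \<in> H2" by (rule bshift_in_H2[OF K_H2[OF f]])
  fix g assume g: "g \<in> H2"
  have "cinner (bshift f) (mult_L2 \<theta> g) = cinner (S (bshift f)) (mult_L2 \<theta> (S g))"
    using mult_L2_commute[OF Linf Linf_id, of g] by simp
  also have "S (bshift f) = f - fourier_L2 f 0 *\<^sub>C one_L2"
    using bshift_decomp[of f] by (simp add: eq_diff_eq add.commute)
  also have "cinner (f - fourier_L2 f 0 *\<^sub>C one_L2) (mult_L2 \<theta> (S g)) = - fourier_L2 f 0 * cinner one_L2 (mult_L2 \<theta> (S g))"
    using K_orth[OF f z_mult_in_H2[OF g]] by simp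
  also have "cinner one_L2 (mult_L2 \<theta> (S g)) = cnj (fourier_L2 (mult_L2 \<theta> (S g)) 0)"
    by (subst cinner_commute) (simp add: fourier_L2_eq mono_L2_0)
  also have "mult_L2 \<theta> (S g) = S (mult_L2 \<theta> g)"
    by (rule mult_L2_commute[OF Linf Linf_id])
  also have "fourier_L2 \<dots> 0 = 0"
    using Hinf_mult_H2[OF Hinf g] by (simp add: fourier_L2_z H2_def)
  finally show "cinner (bshift f) (mult_L2 \<theta> g) = 0" by simp
qed

lemma compressed_shift_K: "f \<in> K \<Longrightarrow> compressed_shift K f = S f - defect f *\<^sub>C theta1"
  unfolding compressed_shift_def
  by (rule K.orth_proj_eqI) (auto simp: shift_minus_defect_in_K theta1_orth')

lemma fredholm_K_off_circle:
  assumes "cmod \<mu> \<noteq> 1"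
  shows "fredholm_on K (\<lambda>f. compressed_shift K f - \<mu> *\<^sub>C f)"
proof (rule K.fredholm_off_circle[OF _ _ _ _ assms])
  show "\<exists>w\<in>L2.span {theta1}. S m - w \<in> K" if "m \<in> K" for m
    using shift_minus_defect_in_K[OF that] by (auto intro: L2.span_scale L2.span_base)
  show "\<exists>w\<in>L2.span {mono_L2 (-1)}. mult_L2 (\<lambda>z. cnj z) m - w \<in> K" if "m \<in> K" for m
    using bshift_in_K[OF that] by (auto simp: bshift_def intro: L2.span_scale L2.span_base)
qed auto

section \<open>Reproducing kernels of the model space\<close>

text \<open>The projection of the Szego kernel to \<open>K\<close>; as a function it is
  \<open>(1 - cnj (\<theta>(w)) \<theta>(z)) / (1 - cnj w z)\<close>.\<close>

definition "kern w = szego_L2 w - cnj (disc_ext \<theta> w) *\<^sub>C mult_L2 \<theta> (szego_L2 w)"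

lemma kern_in_K:
  assumes w: "cmod w < 1"
  shows "kern w \<in> K"
proof (rule KI)
  show "kern w \<in> H2" unfolding kern_def
    by (intro L2.subspace_diff L2.subspace_scale H2.subspace szego_L2_in_H2 w Hinf_mult_H2 Hinf)
  fix g assume g: "g \<in> H2"
  have "cinner (szego_L2 w) (mult_L2 \<theta> g) = cnj (disc_ext \<theta> w) * cnj (cinner g (szego_L2 w))"
    by (subst cinner_commute) (simp add: eval_Hinf_mult Hinf g w)
  moreover have "cinner (mult_L2 \<theta> (szego_L2 w)) (mult_L2 \<theta> g) = cnj (cinner g (szego_L2 w))"
    by (subst cinner_mult_L2_unimodular[OF unim]) (rule cinner_commute)
  ultimately show "cinner (kern w) (mult_L2 \<theta> g) = 0"
    by (simp add: kern_def)
qed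

lemma cinner_kern:
  assumes "f \<in> K" "cmod w < 1"
  shows "cinner f (kern w) = cinner f (szego_L2 w)"
  using K_orth[OF assms(1) szego_L2_in_H2[OF assms(2)]] by (simp add: kern_def)

lemma cinner_kern_kern:
  assumes "cmod w < 1" "cmod z < 1"
  shows "cinner (kern w) (kern z) = (1 - cnj (disc_ext \<theta> w) * disc_ext \<theta> z) / (1 - cnj w * z)"
  using assms szego_denom[of w z]
  by (subst cinner_kern[OF kern_in_K])
     (simp_all add: kern_def eval_Hinf_mult Hinf szego_L2_in_H2 cinner_szego_L2 diff_divide_distrib)

lemma norm_kern:
  assumes "cmod w < 1"
  shows "(norm (kern w))\<^sup>2 = (1 - (cmod (disc_ext \<theta> w))\<^sup>2) / (1 - (cmod w)\<^sup>2)"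
proof -
  have "complex_of_real ((norm (kern w))\<^sup>2)
      = complex_of_real ((1 - (cmod (disc_ext \<theta> w))\<^sup>2) / (1 - (cmod w)\<^sup>2))"
    by (simp only: cinner_self[symmetric] cinner_kern_kern[OF assms assms] cnj_mult_self
        of_real_divide of_real_diff of_real_1)
  then show ?thesis using of_real_eq_iff by blast
qed

text \<open>The squared norm of a reproducing kernel is nonnegative, so the numerator in
  \<open>norm_kern\<close> is nonnegative; no maximum principle is involved.\<close>

lemma norm_disc_ext_le_1:
  assumes w: "cmod w < 1"
  shows "cmod (disc_ext \<theta> w) \<le> 1"
proof -
  have "(cmod w)\<^sup>2 < 1" using w by (simp add: abs_square_less_1)
  moreover have "0 \<le> (1 - (cmod (disc_ext \<theta> w))\<^sup>2) / (1 - (cmod w)\<^sup>2)"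
    by (subst norm_kern[OF w, symmetric]) simp
  ultimately have "(cmod (disc_ext \<theta> w))\<^sup>2 \<le> 1"
    by (simp add: zero_le_divide_iff)
  then show ?thesis by (simp add: abs_square_le_1)
qed

end

text \<open>Normalised Szego kernels approaching the circle are weakly null. A Taylor polynomial of
  \<open>x\<close> has values bounded by \<open>C\<close> while the normalising factor tends to 0,
  and the remainder is small in norm against a unit vector.\<close>

lemma eval_little_o:
  assumes x: "x \<in> H2" and w: "\<And>n. cmod (w n) < 1" "(\<lambda>n. cmod (w n)) \<longlonglongrightarrow> 1"
  shows "(\<lambda>n. cinner x (szego_L2 (w n)) * of_real (sqrt (1 - (cmod (w n))\<^sup>2))) \<longlonglongrightarrow> 0"
proof (rule LIMSEQ_I)
  fix e :: real assume e: "e > 0"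
  let ?s = "\<lambda>n. sqrt (1 - (cmod (w n))\<^sup>2)"
  have s0: "?s n > 0" for n using w(1)[of n] by (simp add: abs_square_less_1)
  obtain N where N: "norm (x - taylor_L2 x N) < e / 2"
    using LIMSEQ_D[OF taylor_L2_tendsto[OF x], of "e / 2"] e by (auto simp: norm_minus_commute)
  define C where "C = (\<Sum>k<N. cmod (fourier_L2 x (int k)))"
  have C0: "C \<ge> 0" unfolding C_def by (rule sum_nonneg) simp
  have bd: "cmod (cinner x (szego_L2 (w n))) * ?s n \<le> C * ?s n + e / 2" for n
  proof -
    have "cmod (cinner (taylor_L2 x N) (szego_L2 (w n))) = cmod (\<Sum>k<N. fourier_L2 x (int k) * w n ^ k)"
      by (simp add: taylor_L2_def cinner.sum_left cinner_mono_szego_L2 w)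
    also have "\<dots> \<le> C"
      unfolding C_def using w(1)[of n]
      by (intro sum_norm_le) (auto simp: norm_mult norm_power intro!: mult_left_le power_le_one)
    finally have 1: "cmod (cinner (taylor_L2 x N) (szego_L2 (w n))) \<le> C" .
    have ns: "norm (szego_L2 (w n)) * ?s n = 1"
    proof -
      have "(norm (szego_L2 (w n)) * ?s n)\<^sup>2 = 1"
        using norm_szego_L2[OF w(1)[of n]] s0[of n]
        by (simp add: power_mult_distrib real_sqrt_pow2_iff)
      moreover have "norm (szego_L2 (w n)) * ?s n \<ge> 0" using s0[of n] by simp
      ultimately show ?thesis by (metis one_power2 power2_eq_imp_eq zero_le_one)
    qed
    have "cmod (cinner (x - taylor_L2 x N) (szego_L2 (w n))) * ?s n
        \<le> (norm (x - taylor_L2 x N) * norm (szego_L2 (w n))) * ?s n"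
      using s0[of n] by (intro mult_right_mono cinner_bound) simp
    also have "\<dots> \<le> e / 2" using ns N by (simp add: mult.assoc)
    finally have 2: "cmod (cinner (x - taylor_L2 x N) (szego_L2 (w n))) * ?s n \<le> e / 2" .
    have "cmod (cinner x (szego_L2 (w n)))
        \<le> cmod (cinner (taylor_L2 x N) (szego_L2 (w n))) + cmod (cinner (x - taylor_L2 x N) (szego_L2 (w n)))"
      using norm_triangle_ineq[of "cinner (taylor_L2 x N) (szego_L2 (w n))" "cinner (x - taylor_L2 x N) (szego_L2 (w n))"]
      by simp
    also have "\<dots> \<le> C + cmod (cinner (x - taylor_L2 x N) (szego_L2 (w n)))" using 1 by simp
    finally have "cmod (cinner x (szego_L2 (w n))) * ?s n
        \<le> (C + cmod (cinner (x - taylor_L2 x N) (szego_L2 (w n)))) * ?s n"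
      using s0[of n] by (intro mult_right_mono) auto
    then show ?thesis using 2 by (simp add: distrib_right)
  qed
  have "(\<lambda>n. C * ?s n) \<longlonglongrightarrow> C * sqrt (1 - 1\<^sup>2)"
    by (intro tendsto_intros w)
  then have "(\<lambda>n. C * ?s n) \<longlonglongrightarrow> 0" by simp
  from LIMSEQ_D[OF this, of "e / 2"] e obtain n0 where n0: "\<And>n. n \<ge> n0 \<Longrightarrow> \<bar>C * ?s n\<bar> < e / 2"
    by auto
  have "norm (cinner x (szego_L2 (w n)) * of_real (?s n) - 0) < e" if "n \<ge> n0" for n
    using bd[of n] n0[OF that] s0[of n] C0 by (simp add: norm_mult abs_mult)
  then show "\<exists>n0. \<forall>n\<ge>n0. norm (cinner x (szego_L2 (w n)) * of_real (?s n) - 0) < e" by blast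
qed

context inner_symbol
begin

definition "nkern w = inverse (norm (kern w)) *\<^sub>R kern w"

text \<open>Where \<theta> is small, the kernel of \<open>K\<close> is comparable in norm to the
  Szego kernel. The numerator is at least 3/4, and the cruder \<open>(1/2)\<^sup>2\<close> is
  enough.\<close>

lemma norm_kern_ge:
  assumes w: "cmod w < 1" and th: "cmod (disc_ext \<theta> w) \<le> 1 / 2"
  shows "norm (kern w) * sqrt (1 - (cmod w)\<^sup>2) \<ge> 1 / 2" "norm (kern w) \<ge> 1 / 2"
proof -
  have w1: "1 - (cmod w)\<^sup>2 > 0" using w by (simp add: abs_square_less_1)
  have "(cmod (disc_ext \<theta> w))\<^sup>2 \<le> (1/2)\<^sup>2" by (intro power_mono th) simp
  then have t: "1 - (cmod (disc_ext \<theta> w))\<^sup>2 \<ge> (1/2)\<^sup>2" by (simp add: power2_eq_square)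
  have "(norm (kern w) * sqrt (1 - (cmod w)\<^sup>2))\<^sup>2 = 1 - (cmod (disc_ext \<theta> w))\<^sup>2"
    using w1 by (simp add: power_mult_distrib norm_kern[OF w])
  then have "(1/2)\<^sup>2 \<le> (norm (kern w) * sqrt (1 - (cmod w)\<^sup>2))\<^sup>2" using t by simp
  then show 1: "norm (kern w) * sqrt (1 - (cmod w)\<^sup>2) \<ge> 1 / 2"
    using w1 by (intro power2_le_imp_le[of "1/2"]) auto
  have "norm (kern w) * sqrt (1 - (cmod w)\<^sup>2) \<le> norm (kern w) * 1"
    using w1 by (intro mult_left_mono) auto
  with 1 show "norm (kern w) \<ge> 1 / 2" by simp
qed

text \<open>The Szego part evaluates \<open>S x\<close> at \<open>w\<close>. In the other part the
  recursion for the Szego kernel isolates \<open>theta1\<close>, and the rest is orthogonal because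
  \<open>x\<close> lies in \<open>K\<close>. So \<open>kern w\<close> is an eigenvector of the
  adjoint up to an error proportional to \<open>\<theta>(w)\<close>.\<close>

lemma cinner_shift_kern:
  assumes x: "x \<in> K" and w: "cmod w < 1"
  shows "cinner (S x) (kern w) = w * cinner x (kern w) - disc_ext \<theta> w * defect x"
proof -
  have "mult_L2 \<theta> (szego_L2 w) = theta1 + cnj w *\<^sub>C S (mult_L2 \<theta> (szego_L2 w))"
    using szego_L2_rec[OF w] mult_L2_commute[OF Linf Linf_id]
    by (metis mult_L2_add mult_L2_scaleC theta1_def)
  then have "cinner (S x) (mult_L2 \<theta> (szego_L2 w)) = defect x + w * cinner x (mult_L2 \<theta> (szego_L2 w))"
    by (metis cinner_simps(4) cinner_scaleC_right cinner_z_z complex_cnj_cnj defect_def)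
  also have "\<dots> = defect x" using K_orth[OF x szego_L2_in_H2[OF w]] by simp
  finally show ?thesis
    by (simp add: kern_def eval_z_mult[OF K_H2[OF x] w] K_orth[OF x szego_L2_in_H2[OF w]])
qed

text \<open>Both factors 2 come from \<open>norm_kern_ge\<close>: normalising by
  \<open>norm (kern (w n))\<close> costs at most twice the Szego normalisation, and dividing the
  error term by it at most doubles that term.\<close>

lemma nkern_props:
  fixes w :: "nat \<Rightarrow> complex"
  assumes w: "\<And>n. cmod (w n) < 1" "w \<longlonglongrightarrow> \<mu>" and mu: "cmod \<mu> = 1"
    and th: "\<And>n. cmod (disc_ext \<theta> (w n)) \<le> 1 / 2"
  shows "nkern (w n) \<in> K" "norm (nkern (w n)) = 1"
    and "x \<in> K \<Longrightarrow> (\<lambda>n. cinner x (nkern (w n))) \<longlonglongrightarrow> 0"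
    and "x \<in> K \<Longrightarrow> cmod (cinner (S x - \<mu> *\<^sub>C x) (nkern (w n)))
       \<le> norm x * (cmod (w n - \<mu>) + 2 * cmod (disc_ext \<theta> (w n)))"
proof -
  have nk: "norm (kern (w n)) > 0" for n
    using norm_kern_ge(2)[OF w(1)[of n] th[of n]] by linarith
  show "nkern (w n) \<in> K"
    unfolding nkern_def by (intro subspace_scaleR K.subspace kern_in_K w)
  show n1: "norm (nkern (w n)) = 1" for n
    using nk[of n] by (simp add: nkern_def)
  have ck: "cinner x (nkern (w n)) = cinner x (kern (w n)) / of_real (norm (kern (w n)))" for x n
    by (simp add: nkern_def scaleR_eq_scaleC field_simps)
  show "(\<lambda>n. cinner x (nkern (w n))) \<longlonglongrightarrow> 0" if xK: "x \<in> K"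
  proof (rule Lim_null_comparison)
    have "(\<lambda>n. cmod (w n)) \<longlonglongrightarrow> cmod \<mu>" by (intro tendsto_norm w)
    then have "(\<lambda>n. cinner x (szego_L2 (w n)) * of_real (sqrt (1 - (cmod (w n))\<^sup>2))) \<longlonglongrightarrow> 0"
      using mu by (intro eval_little_o K_H2 xK w) simp
    then have "(\<lambda>n. 2 * cmod (cinner x (szego_L2 (w n)) * of_real (sqrt (1 - (cmod (w n))\<^sup>2)))) \<longlonglongrightarrow> 2 * 0"
      by (intro tendsto_mult tendsto_const tendsto_norm_zero)
    then show "(\<lambda>n. 2 * cmod (cinner x (szego_L2 (w n)) * of_real (sqrt (1 - (cmod (w n))\<^sup>2)))) \<longlonglongrightarrow> 0"
      by simp
    have "cmod (cinner x (nkern (w n))) \<le> 2 * cmod (cinner x (szego_L2 (w n)) * of_real (sqrt (1 - (cmod (w n))\<^sup>2)))" for n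
    proof -
      have s0: "sqrt (1 - (cmod (w n))\<^sup>2) \<ge> 0" using w(1)[of n] by (simp add: abs_square_le_1)
      have "cmod (cinner x (nkern (w n))) = cmod (cinner x (szego_L2 (w n))) / norm (kern (w n))"
        unfolding ck cinner_kern[OF xK w(1)] by (simp add: norm_divide)
      also have "\<dots> \<le> cmod (cinner x (szego_L2 (w n))) * (2 * sqrt (1 - (cmod (w n))\<^sup>2))"
        using norm_kern_ge(1)[OF w(1)[of n] th[of n]] nk[of n]
          mult_left_mono[of 1 "norm (kern (w n)) * (2 * sqrt (1 - (cmod (w n))\<^sup>2))" "cmod (cinner x (szego_L2 (w n)))"]
        by (simp add: divide_le_eq ac_simps)
      also have "\<dots> = 2 * cmod (cinner x (szego_L2 (w n)) * of_real (sqrt (1 - (cmod (w n))\<^sup>2)))"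
        using s0 by (simp add: norm_mult)
      finally show ?thesis .
    qed
    then show "\<forall>\<^sub>F n in sequentially. cmod (cinner x (nkern (w n)))
        \<le> 2 * cmod (cinner x (szego_L2 (w n)) * of_real (sqrt (1 - (cmod (w n))\<^sup>2)))"
      by simp
  qed
  show "cmod (cinner (S x - \<mu> *\<^sub>C x) (nkern (w n)))
       \<le> norm x * (cmod (w n - \<mu>) + 2 * cmod (disc_ext \<theta> (w n)))" if x: "x \<in> K"
  proof -
    have "cinner (S x - \<mu> *\<^sub>C x) (kern (w n)) = (w n - \<mu>) * cinner x (kern (w n)) - disc_ext \<theta> (w n) * defect x"
      by (simp add: cinner_shift_kern[OF x w(1)] left_diff_distrib)
    then have "cinner (S x - \<mu> *\<^sub>C x) (nkern (w n))
        = (w n - \<mu>) * cinner x (nkern (w n)) - disc_ext \<theta> (w n) * defect x / of_real (norm (kern (w n)))"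
      unfolding ck by (simp add: diff_divide_distrib)
    also have "cmod \<dots> \<le> cmod (w n - \<mu>) * cmod (cinner x (nkern (w n)))
        + cmod (disc_ext \<theta> (w n)) * cmod (defect x) / norm (kern (w n))"
      by (rule order_trans[OF norm_triangle_ineq4]) (simp add: norm_mult norm_divide)
    also have "\<dots> \<le> cmod (w n - \<mu>) * norm x + (cmod (disc_ext \<theta> (w n)) * norm x) * 2"
    proof (intro add_mono mult_left_mono)
      show "cmod (cinner x (nkern (w n))) \<le> norm x"
        using cinner_bound[of x "nkern (w n)"] by (simp add: n1)
      have "cmod (disc_ext \<theta> (w n)) * cmod (defect x) / norm (kern (w n))
          \<le> (cmod (disc_ext \<theta> (w n)) * norm x) / (1 / 2)"
        using norm_kern_ge(2)[OF w(1)[of n] th[of n]]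
        by (intro frac_le mult_left_mono norm_defect) auto
      then show "cmod (disc_ext \<theta> (w n)) * cmod (defect x) / norm (kern (w n))
          \<le> (cmod (disc_ext \<theta> (w n)) * norm x) * 2" by simp
    qed simp
    finally show ?thesis by (simp add: algebra_simps)
  qed
qed

lemma not_fredholm_K:
  fixes w :: "nat \<Rightarrow> complex"
  assumes w: "\<And>n. cmod (w n) < 1" "w \<longlonglongrightarrow> \<mu>" and mu: "cmod \<mu> = 1"
    and th: "\<And>n. cmod (disc_ext \<theta> (w n)) \<le> 1 / 2" "(\<lambda>n. disc_ext \<theta> (w n)) \<longlonglongrightarrow> 0"
  shows "\<not> fredholm_on K (\<lambda>f. compressed_shift K f - \<mu> *\<^sub>C f)"
proof (rule K.not_fredholm_onI[where v = "\<lambda>n. nkern (w n)" and e = "\<lambda>n. cmod (w n - \<mu>) + 2 * cmod (disc_ext \<theta> (w n))"])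
  note np = nkern_props[OF w mu th(1)]
  show "nkern (w n) \<in> K" "norm (nkern (w n)) = 1" for n by (rule np)+
  show "(\<lambda>n. cinner x (nkern (w n))) \<longlonglongrightarrow> 0" if "x \<in> K" for x
    by (rule np(3)[OF that])
  have "cinner (compressed_shift K x - \<mu> *\<^sub>C x) (nkern (w n)) = cinner (S x - \<mu> *\<^sub>C x) (nkern (w n))" for x n
    using np(1)[of n] by (simp add: compressed_shift_def K.cinner_orth_proj_left)
  then show "\<exists>C. \<forall>n. cmod (cinner (compressed_shift K x - \<mu> *\<^sub>C x) (nkern (w n)))
      \<le> C * (cmod (w n - \<mu>) + 2 * cmod (disc_ext \<theta> (w n)))" if "x \<in> K" for x
    using np(4)[OF that] by auto
  have "(\<lambda>n. cmod (w n - \<mu>) + 2 * cmod (disc_ext \<theta> (w n))) \<longlonglongrightarrow> cmod (\<mu> - \<mu>) + 2 * cmod 0"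
    by (intro tendsto_intros w th)
  then show "(\<lambda>n. cmod (w n - \<mu>) + 2 * cmod (disc_ext \<theta> (w n))) \<longlonglongrightarrow> 0" by simp
qed auto

end

section \<open>Geometry of the dual-band space, Fredholmness off the circle and its failure on
  it\<close>

locale dual_band = inner_symbol +
  fixes \<phi> \<psi> :: "complex \<Rightarrow> complex"
  assumes uphi: "unimodular \<phi>" and upsi: "unimodular \<psi>"
    and orth: "f \<in> model_space \<theta> \<Longrightarrow> g \<in> model_space \<theta> \<Longrightarrow> cinner (mult_L2 \<phi> f) (mult_L2 \<psi> g) = 0"
begin

abbreviation "M \<equiv> dual_band_space \<phi> \<psi> \<theta>"
abbreviation "emb f g \<equiv> mult_L2 \<phi> f + mult_L2 \<psi> g"

lemma orth': "f \<in> K \<Longrightarrow> g \<in> K \<Longrightarrow> cinner (mult_L2 \<psi> g) (mult_L2 \<phi> f) = 0"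
  using orth[of f g] by (subst cinner_commute) simp

lemma emb_in_M: "f \<in> K \<Longrightarrow> g \<in> K \<Longrightarrow> emb f g \<in> M"
  by (auto simp: dual_band_space_def)

lemma M_cases:
  assumes "x \<in> M"
  obtains f g where "f \<in> K" "g \<in> K" "x = emb f g"
  using assms by (auto simp: dual_band_space_def)

lemma cinner_emb:
  "f \<in> K \<Longrightarrow> g \<in> K \<Longrightarrow> f' \<in> K \<Longrightarrow> g' \<in> K \<Longrightarrow> cinner (emb f g) (emb f' g') = cinner f f' + cinner g g'"
  by (simp add: orth orth' cinner_mult_L2_unimodular uphi upsi)

text \<open>The adjoint of the isometric embedding of \<open>K\<close> by \<phi>. On
  \<open>M\<close> it reads off the first band, because the second is orthogonal.\<close>

definition "comp1 x = orth_proj K (mult_L2 (\<lambda>z. cnj (\<phi> z)) x)"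
definition "comp2 x = orth_proj K (mult_L2 (\<lambda>z. cnj (\<psi> z)) x)"

lemma comp_in [simp]: "comp1 x \<in> K" "comp2 x \<in> K"
  by (simp_all add: comp1_def comp2_def)

lemma cinner_comp:
  assumes "h \<in> K"
  shows "cinner (comp1 x) h = cinner x (mult_L2 \<phi> h)" "cinner (comp2 x) h = cinner x (mult_L2 \<psi> h)"
  using assms cinner_mult_L2[OF Linf_cnj[OF unimodular_Linf[OF uphi]], of x h]
    cinner_mult_L2[OF Linf_cnj[OF unimodular_Linf[OF upsi]], of x h]
  by (simp_all add: comp1_def comp2_def K.cinner_orth_proj_left)

lemma comp_emb:
  assumes "f \<in> K" "g \<in> K"
  shows "comp1 (emb f g) = f" "comp2 (emb f g) = g"
proof -
  have "comp1 (emb f g) - f \<in> K" "comp2 (emb f g) - g \<in> K"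
    by (intro L2.subspace_diff K.subspace comp_in assms)+
  then have "cinner (comp1 (emb f g) - f) (comp1 (emb f g) - f) = 0"
    "cinner (comp2 (emb f g) - g) (comp2 (emb f g) - g) = 0"
    using assms by (simp_all only: cinner.diff_left cinner_comp)
      (simp_all only: cinner.add_left orth orth' cinner_mult_L2_unimodular uphi upsi, simp_all)
  then show "comp1 (emb f g) = f" "comp2 (emb f g) = g"
    by (simp_all only: cinner_self_eq_0 right_minus_eq)
qed

lemma comp_diff: "comp1 (x - y) = comp1 x - comp1 y" "comp2 (x - y) = comp2 x - comp2 y"
  by (simp_all add: comp1_def comp2_def mult_L2_diff K.orth_proj_diff)

lemma norm_comp_le: "norm (comp1 x) \<le> norm x" "norm (comp2 x) \<le> norm x"
proof -
  have u: "unimodular (\<lambda>z. cnj (\<phi> z))" "unimodular (\<lambda>z. cnj (\<psi> z))"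
    using uphi upsi by (auto simp: unimodular_def)
  show "norm (comp1 x) \<le> norm x" "norm (comp2 x) \<le> norm x"
    unfolding comp1_def comp2_def
    using K.norm_orth_proj_le norm_mult_L2_unimodular[OF u(1), of x] norm_mult_L2_unimodular[OF u(2), of x]
    by metis+
qed

sublocale M: closed_csubspace M
proof
  show "L2.subspace M"
  proof (rule L2.subspaceI)
    show "0 \<in> M" using emb_in_M[of 0 0] L2.subspace_0[OF K.subspace] by simp
    show "x + y \<in> M" if xy: "x \<in> M" "y \<in> M" for x y
    proof -
      obtain f g f' g' where *: "f \<in> K" "g \<in> K" "x = emb f g" "f' \<in> K" "g' \<in> K" "y = emb f' g'"
        using xy by (metis M_cases)
      have "x + y = emb (f + f') (g + g')" by (simp add: * mult_L2_add)
      then show ?thesis using * by (simp add: emb_in_M L2.subspace_add[OF K.subspace])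
    qed
    show "c *\<^sub>C x \<in> M" if x: "x \<in> M" for c x
    proof -
      obtain f g where *: "f \<in> K" "g \<in> K" "x = emb f g" using x by (rule M_cases)
      have "c *\<^sub>C x = emb (c *\<^sub>C f) (c *\<^sub>C g)"
        by (simp add: * mult_L2_scaleC L2.scale_right_distrib)
      then show ?thesis using * by (simp add: emb_in_M L2.subspace_scale[OF K.subspace])
    qed
  qed
  \<comment> \<open>\<open>M\<close> is the fixed-point set of this map. Each of its two summands is
    a contraction, so the map is Lipschitz with constant 2 and \<open>M\<close> is closed.\<close>
  define G where "G x = emb (comp1 x) (comp2 x)" for x
  have "M = {x. G x = x}"
    unfolding G_def by (auto simp: comp_emb intro: emb_in_M elim!: M_cases) (metis comp_in emb_in_M)
  moreover have "continuous_on UNIV G"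
  proof (rule lipschitz_on_continuous_on)
    show "2-lipschitz_on UNIV G"
    proof (rule lipschitz_onI)
      fix x y
      have "G x - G y = emb (comp1 (x - y)) (comp2 (x - y))"
        by (simp add: G_def comp_diff mult_L2_diff)
      then have "norm (G x - G y) \<le> norm (comp1 (x - y)) + norm (comp2 (x - y))"
        using norm_triangle_ineq[of "mult_L2 \<phi> (comp1 (x - y))" "mult_L2 \<psi> (comp2 (x - y))"]
        by (simp only: norm_mult_L2_unimodular uphi upsi)
      then show "dist (G x) (G y) \<le> 2 * dist x y"
        using norm_comp_le[of "x - y"] by (simp add: dist_norm)
    qed simp
  qed
  then have "closed {x. G x = x}" by (intro closed_Collect_eq continuous_on_id) auto
  ultimately show "closed M" by simp
qed

lemma mult_commute_z:
  "S (mult_L2 \<phi> f) = mult_L2 \<phi> (S f)" "S (mult_L2 \<psi> f) = mult_L2 \<psi> (S f)"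
  "mult_L2 (\<lambda>z. cnj z) (mult_L2 \<phi> f) = mult_L2 \<phi> (mult_L2 (\<lambda>z. cnj z) f)"
  "mult_L2 (\<lambda>z. cnj z) (mult_L2 \<psi> f) = mult_L2 \<psi> (mult_L2 (\<lambda>z. cnj z) f)"
  using uphi upsi by (auto intro!: mult_L2_commute Linf_intros dest: unimodular_Linf)

lemma fredholm_M_off_circle:
  assumes "cmod \<mu> \<noteq> 1"
  shows "fredholm_on M (\<lambda>f. compressed_shift M f - \<mu> *\<^sub>C f)"
proof (rule M.fredholm_off_circle[OF _ _ _ _ assms])
  show "finite {mult_L2 \<phi> theta1, mult_L2 \<psi> theta1}" "finite {mult_L2 \<phi> (mono_L2 (-1)), mult_L2 \<psi> (mono_L2 (-1))}"
    by auto
  fix m assume "m \<in> M"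
  then obtain f g where fg: "f \<in> K" "g \<in> K" "m = emb f g" by (rule M_cases)
  have "S m - (defect f *\<^sub>C mult_L2 \<phi> theta1 + defect g *\<^sub>C mult_L2 \<psi> theta1)
      = emb (S f - defect f *\<^sub>C theta1) (S g - defect g *\<^sub>C theta1)"
    by (simp add: fg mult_L2_add mult_L2_diff mult_L2_scaleC mult_commute_z)
  also have "\<dots> \<in> M" by (intro emb_in_M shift_minus_defect_in_K fg)
  finally show "\<exists>w\<in>L2.span {mult_L2 \<phi> theta1, mult_L2 \<psi> theta1}. S m - w \<in> M"
    by (rule bexI) (intro L2.span_add L2.span_scale L2.span_base, auto)
  have "mult_L2 (\<lambda>z. cnj z) m - (fourier_L2 f 0 *\<^sub>C mult_L2 \<phi> (mono_L2 (-1)) + fourier_L2 g 0 *\<^sub>C mult_L2 \<psi> (mono_L2 (-1)))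
      = emb (bshift f) (bshift g)"
    by (simp add: fg mult_L2_add mult_L2_diff mult_L2_scaleC mult_commute_z bshift_def)
  also have "\<dots> \<in> M" by (intro emb_in_M bshift_in_K fg)
  finally show "\<exists>w\<in>L2.span {mult_L2 \<phi> (mono_L2 (-1)), mult_L2 \<psi> (mono_L2 (-1))}. mult_L2 (\<lambda>z. cnj z) m - w \<in> M"
    by (rule bexI) (intro L2.span_add L2.span_scale L2.span_base, auto)
qed

text \<open>The kernels of \<open>K\<close> are placed in the first band. The second band meets them
  only through the overflow of \<open>S g\<close> along \<open>theta1\<close>, giving
  \<open>defect g * cinner h (nkern (w n))\<close>. The fixed vector \<open>h\<close> pairs to 0 in
  the limit by weak nullity, so this cross term fits into the rate \<open>e\<close>.\<close>

lemma not_fredholm_M: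
  fixes w :: "nat \<Rightarrow> complex"
  assumes w: "\<And>n. cmod (w n) < 1" "w \<longlonglongrightarrow> \<mu>" and mu: "cmod \<mu> = 1"
    and th: "\<And>n. cmod (disc_ext \<theta> (w n)) \<le> 1 / 2" "(\<lambda>n. disc_ext \<theta> (w n)) \<longlonglongrightarrow> 0"
  shows "\<not> fredholm_on M (\<lambda>f. compressed_shift M f - \<mu> *\<^sub>C f)"
proof -
  define h where "h = comp1 (mult_L2 \<psi> theta1)"
  define e where "e n = cmod (w n - \<mu>) + 2 * cmod (disc_ext \<theta> (w n)) + cmod (cinner h (nkern (w n)))" for n
  note np = nkern_props[OF w mu th(1)]
  have K0: "0 \<in> K" by (rule L2.subspace_0[OF K.subspace])
  have weak: "(\<lambda>n. cinner x (nkern (w n))) \<longlonglongrightarrow> 0" if "x \<in> K" for x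
    by (rule np(3)[OF that])
  show ?thesis
  proof (rule M.not_fredholm_onI[where v = "\<lambda>n. mult_L2 \<phi> (nkern (w n))" and e = e])
    show vM: "mult_L2 \<phi> (nkern (w n)) \<in> M" for n
      using emb_in_M[OF np(1)[of n] K0] by simp
    show "norm (mult_L2 \<phi> (nkern (w n))) = 1" for n
      by (simp only: norm_mult_L2_unimodular[OF uphi] np(2))
    have cin: "cinner x (mult_L2 \<phi> (nkern (w n))) = cinner (comp1 x) (nkern (w n))" for x n
      using cinner_comp(1)[OF np(1)] by simp
    show "(\<lambda>n. cinner x (mult_L2 \<phi> (nkern (w n)))) \<longlonglongrightarrow> 0" if "x \<in> M" for x
      unfolding cin by (rule weak) simp
    have "e \<longlonglongrightarrow> cmod (\<mu> - \<mu>) + 2 * cmod 0 + cmod 0"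
      unfolding e_def by (intro tendsto_intros w th weak) (simp add: h_def)
    then show "e \<longlonglongrightarrow> 0" by simp
    show "e n \<ge> 0" for n by (simp add: e_def)
    fix x assume "x \<in> M"
    then obtain f g where fg: "f \<in> K" "g \<in> K" "x = emb f g" by (rule M_cases)
    have "cmod (cinner (compressed_shift M x - \<mu> *\<^sub>C x) (mult_L2 \<phi> (nkern (w n))))
        \<le> (norm f + norm g) * e n" for n
    proof -
      let ?v = "nkern (w n)"
      have Sg: "S g = (S g - defect g *\<^sub>C theta1) + defect g *\<^sub>C theta1" by simp
      have "cinner (mult_L2 \<psi> (S g)) (mult_L2 \<phi> ?v) = defect g * cinner h ?v"
        unfolding h_def cinner_comp(1)[OF np(1)]
        using orth'[OF np(1)[of n] shift_minus_defect_in_K[OF fg(2)]]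
        by (subst Sg) (simp only: mult_L2_add cinner.add_left mult_L2_scaleC cinner_scaleC_left, simp)
      moreover have "cinner (mult_L2 \<psi> g) (mult_L2 \<phi> ?v) = 0" by (rule orth'[OF np(1) fg(2)])
      moreover have "cinner (compressed_shift M x) (mult_L2 \<phi> ?v) = cinner (S x) (mult_L2 \<phi> ?v)"
        unfolding compressed_shift_def by (rule M.cinner_orth_proj_left[OF vM])
      ultimately have "cinner (compressed_shift M x - \<mu> *\<^sub>C x) (mult_L2 \<phi> ?v)
          = cinner (S f - \<mu> *\<^sub>C f) ?v + defect g * cinner h ?v"
        by (simp add: fg(3) mult_L2_add mult_commute_z cinner_mult_L2_unimodular uphi L2.scale_right_distrib)
      also have "cmod \<dots> \<le> norm f * (cmod (w n - \<mu>) + 2 * cmod (disc_ext \<theta> (w n))) + norm g * cmod (cinner h ?v)"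
        by (intro order_trans[OF norm_triangle_ineq] add_mono np(4) fg)
           (simp add: norm_mult norm_defect mult_right_mono)
      also have "\<dots> \<le> norm f * e n + norm g * e n"
      proof (intro add_mono mult_left_mono norm_ge_zero)
        show "cmod (w n - \<mu>) + 2 * cmod (disc_ext \<theta> (w n)) \<le> e n" "cmod (cinner h ?v) \<le> e n"
          by (simp_all add: e_def)
      qed
      finally show ?thesis by (simp add: distrib_right)
    qed
    then show "\<exists>C. \<forall>n. cmod (cinner (compressed_shift M x - \<mu> *\<^sub>C x) (mult_L2 \<phi> (nkern (w n)))) \<le> C * e n"
      by blast
  qed
qed

end

section \<open>Boundary regularity where an inner function is bounded below\<close>

text \<open>Cauchy's formula at \<open>s\<close> over the rectangle with sides \<open>a\<close>,
  \<open>2 * a\<close>, \<open>a\<close>, \<open>2 * a\<close>; \<open>6 * a\<close> is its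
  perimeter. The number \<open>d\<close> bounds from below the distance of \<open>s\<close> to every
  side, and only the right side contributes an error, the integral of \<open>C * p\<close>.\<close>

lemma rectangle_bound:
  fixes H :: "complex \<Rightarrow> complex" and p :: "real \<Rightarrow> real"
  assumes a: "a > 0" and s: "- a < s" "s < 0" and b: "a < b" "0 < h"
    and hol: "H holomorphic_on box (Complex (- b) (- b)) (Complex h b)"
    and small: "\<And>\<zeta>. \<zeta> \<in> cbox (Complex (- a) (- a)) (Complex 0 a) \<Longrightarrow>
       Re \<zeta> = - a \<or> \<bar>Im \<zeta>\<bar> = a \<Longrightarrow> cmod (H \<zeta>) \<le> 1"
    and right: "\<And>t. \<bar>t\<bar> \<le> a \<Longrightarrow> cmod (H (Complex 0 t)) \<le> 1 + C * p t"
    and p: "p integrable_on {-a..a}"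
    and d: "d > 0" "d \<le> a" "d \<le> - s" "d \<le> s + a"
  shows "2 * pi * cmod (H (of_real s)) \<le> (6 * a + C * integral {-a..a} p) / d"
proof -
  define a1 a2 a3 a4 where "a1 = Complex (-a) (-a)" and "a2 = Complex 0 (-a)"
    and "a3 = Complex 0 a" and "a4 = Complex (-a) a"
  let ?B = "box (Complex (- b) (- b)) (Complex h b)"
  let ?s = "complex_of_real s"
  let ?f = "\<lambda>\<zeta>. H \<zeta> / (\<zeta> - ?s)"
  have rp: "rectpath a1 a3 = linepath a1 a2 +++ linepath a2 a3 +++ linepath a3 a4 +++ linepath a4 a1"
    by (simp add: rectpath_def Let_def a1_def a2_def a3_def a4_def)
  have sub: "path_image (rectpath a1 a3) \<subseteq> ?B - {?s}"
    using a s b by (auto simp: path_image_rectpath a1_def a3_def in_box_complex_iff)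
  have sin: "?s \<in> ?B" using s b by (simp add: in_box_complex_iff)
  have "(?f has_contour_integral (2 * pi * \<i> * winding_number (rectpath a1 a3) ?s * H ?s)) (rectpath a1 a3)"
    by (rule Cauchy_integral_formula_convex_simple[OF convex_box(2) hol]) 
       (use sub sin in \<open>auto simp: interior_open open_box\<close>)
  moreover have "winding_number (rectpath a1 a3) ?s = 1"
    by (rule winding_number_rectpath) (use s a in \<open>simp add: a1_def a3_def in_box_complex_iff\<close>)
  ultimately have I: "(?f has_contour_integral (2 * pi * \<i> * H ?s)) (rectpath a1 a3)" by simp
  have ci: "?f contour_integrable_on (linepath a1 a2 +++ linepath a2 a3 +++ linepath a3 a4 +++ linepath a4 a1)"
    using I unfolding rp by (rule has_contour_integral_integrable)
  have c1: "?f contour_integrable_on linepath a1 a2"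
    using ci by (rule contour_integrable_joinD1) simp
  have ci2: "?f contour_integrable_on (linepath a2 a3 +++ linepath a3 a4 +++ linepath a4 a1)"
    using ci by (rule contour_integrable_joinD2) (simp add: a2_def)
  have c2: "?f contour_integrable_on linepath a2 a3"
    using ci2 by (rule contour_integrable_joinD1) simp
  have ci3: "?f contour_integrable_on (linepath a3 a4 +++ linepath a4 a1)"
    using ci2 by (rule contour_integrable_joinD2) simp
  have c3: "?f contour_integrable_on linepath a3 a4"
    using ci3 by (rule contour_integrable_joinD1) simp
  have c4: "?f contour_integrable_on linepath a4 a1"
    using ci3 by (rule contour_integrable_joinD2) simp
  have tot: "2 * pi * \<i> * H ?s = contour_integral (linepath a1 a2) ?f + contour_integral (linepath a2 a3) ?f
      + contour_integral (linepath a3 a4) ?f + contour_integral (linepath a4 a1) ?f"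
    using contour_integral_unique[OF I] c1 c2 c3 c4 ci2 ci3 by (simp add: rp add.assoc)
  have bd: "cmod (?f \<zeta>) \<le> 1 / d" if "\<zeta> \<in> cbox (Complex (- a) (- a)) (Complex 0 a)" "Re \<zeta> = - a \<or> \<bar>Im \<zeta>\<bar> = a" for \<zeta>
  proof -
    have "d \<le> cmod (\<zeta> - ?s)"
      using that(2) abs_Re_le_cmod[of "\<zeta> - ?s"] abs_Im_le_cmod[of "\<zeta> - ?s"] d s by auto
    then show ?thesis using small[OF that] d by (simp add: norm_divide frac_le)
  qed
  have "cmod (contour_integral (linepath a1 a2) ?f) \<le> 1 / d * cmod (a2 - a1)"
    by (rule contour_integral_bound_linepath[OF c1])
       (use d a in \<open>auto simp: a1_def a2_def closed_segment_same_Im closed_segment_eq_real_ivl in_cbox_complex_iff intro!: bd[simplified]\<close>)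
  moreover have "cmod (contour_integral (linepath a3 a4) ?f) \<le> 1 / d * cmod (a4 - a3)"
    by (rule contour_integral_bound_linepath[OF c3])
       (use d a in \<open>auto simp: a3_def a4_def closed_segment_same_Im closed_segment_eq_real_ivl in_cbox_complex_iff intro!: bd[simplified]\<close>)
  moreover have "cmod (contour_integral (linepath a4 a1) ?f) \<le> 1 / d * cmod (a1 - a4)"
    by (rule contour_integral_bound_linepath[OF c4])
       (use d a in \<open>auto simp: a1_def a4_def closed_segment_same_Re closed_segment_eq_real_ivl in_cbox_complex_iff intro!: bd[simplified]\<close>)
  moreover have "cmod (a2 - a1) = a" "cmod (a4 - a3) = a" "cmod (a1 - a4) = 2 * a"
    using a by (auto simp: a1_def a2_def a3_def a4_def cmod_def real_sqrt_mult)
  moreover have "cmod (contour_integral (linepath a2 a3) ?f) \<le> (2 * a + C * integral {-a..a} p) / d"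
  proof -
    have "((\<lambda>x. ?f (Complex 0 x)) has_integral (- \<i> * contour_integral (linepath a2 a3) ?f)) {-a..a}"
      using has_contour_integral_integral[OF c2] a
      by (subst (asm) has_contour_integral_linepath_same_Re_iff) (auto simp: a2_def a3_def)
    then have i: "(\<lambda>x. ?f (Complex 0 x)) integrable_on {-a..a}"
      "integral {-a..a} (\<lambda>x. ?f (Complex 0 x)) = - \<i> * contour_integral (linepath a2 a3) ?f"
      by (auto intro: integral_unique)
    have ip: "((\<lambda>x. (1 + C * p x) / d) has_integral ((a - - a) *\<^sub>R 1 + C * integral {-a..a} p) / d) {-a..a}"
      using p a has_integral_const_real[of "1::real" "-a" a]
      by (intro has_integral_divide has_integral_add has_integral_mult_right integrable_integral) auto
    have "cmod (integral {-a..a} (\<lambda>x. ?f (Complex 0 x))) \<le> integral {-a..a} (\<lambda>x. (1 + C * p x) / d)"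
    proof (rule integral_norm_bound_integral[OF i(1)])
      show "(\<lambda>x. (1 + C * p x) / d) integrable_on {-a..a}" using ip by blast
      fix t assume t: "t \<in> {-a..a}"
      have "d \<le> cmod (Complex 0 t - ?s)"
        using abs_Re_le_cmod[of "Complex 0 t - ?s"] d s by simp
      moreover have "cmod (H (Complex 0 t)) \<le> 1 + C * p t" using t by (intro right) auto
      ultimately show "cmod (?f (Complex 0 t)) \<le> (1 + C * p t) / d"
        using d by (simp add: norm_divide) (meson frac_le norm_ge_zero order_trans)
    qed
    also have "\<dots> = (2 * a + C * integral {-a..a} p) / d"
      using integral_unique[OF ip] by simp
    finally show ?thesis by (simp add: i(2) norm_mult)
  qed
  ultimately have "cmod (2 * pi * \<i> * H ?s) \<le> a / d + (2 * a + C * integral {-a..a} p) / d + a / d + 2 * a / d"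
    unfolding tot by (intro order_trans[OF norm_triangle_ineq] add_mono order_trans[OF norm_triangle_ineq]) auto
  also have "\<dots> = (6 * a + C * integral {-a..a} p) / d"
    by (simp add: add_divide_distrib[symmetric] algebra_simps)
  finally show ?thesis by (simp add: norm_mult)
qed

text \<open>Bernoulli's inequality makes \<open>1 - x ^ n\<close> linear in \<open>1 - x\<close>.
  The point is to bound powers of \<open>1 / \<bar>F\<bar>\<close> by 1 plus a multiple of
  \<open>1 - \<bar>F\<bar>\<^sup>2\<close>, whose arc means tend to 0.\<close>

lemma inverse_power_bound:
  fixes x :: real
  assumes "0 < \<epsilon>" "\<epsilon> \<le> x" "x \<le> 1"
  shows "(1 / x) ^ n \<le> 1 + real n / \<epsilon> ^ n * (1 - x\<^sup>2)"
proof -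
  have x: "x > 0" using assms by linarith
  have "1 + real n * (x - 1) \<le> (1 + (x - 1)) ^ n"
    using assms x by (intro Bernoulli_inequality) linarith
  then have "1 - x ^ n \<le> real n * (1 - x)" by (simp add: algebra_simps)
  also have "\<dots> \<le> real n * (1 - x\<^sup>2)"
    using assms x by (intro mult_left_mono) (auto simp: power2_eq_square mult_left_le)
  finally have 1: "1 - x ^ n \<le> real n * (1 - x\<^sup>2)" .
  have "(1 / x) ^ n = 1 + (1 - x ^ n) / x ^ n"
    using x by (simp add: power_divide diff_divide_distrib)
  also have "(1 - x ^ n) / x ^ n \<le> real n * (1 - x\<^sup>2) / \<epsilon> ^ n"
    using 1 assms x by (intro frac_le power_mono) (auto simp: abs_square_le_1)
  finally show ?thesis by simp
qed

text \<open>The factor \<open>exp (- N * (1 - cnj l * z))\<close> beats \<open>1 / \<epsilon>\<close> on the sides of the rectangle inside the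
  disc, and has modulus at most \<open>1\<close> everywhere. High powers of the product with \<open>1 / F\<close> stay bounded
  in the mean on all four sides, hence at interior points, so the product itself is bounded by \<open>1\<close>.\<close>

lemma radial_estimate:
  fixes F :: "complex \<Rightarrow> complex" and \<rho> :: "nat \<Rightarrow> real" and l :: complex
  assumes hol: "F holomorphic_on ball 0 1" and le1: "\<And>z. cmod z < 1 \<Longrightarrow> cmod (F z) \<le> 1"
    and l: "cmod l = 1" and a: "0 < a" "a < 1" and eps: "0 < \<epsilon>" "\<epsilon> < 1"
    and low: "\<And>\<zeta>. - 3 * a < Re \<zeta> \<Longrightarrow> Re \<zeta> < 0 \<Longrightarrow> \<bar>Im \<zeta>\<bar> < 2 * a \<Longrightarrow> \<epsilon> \<le> cmod (F (l * exp \<zeta>))"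
    and rho: "\<And>j. 0 < \<rho> j" "\<And>j. \<rho> j < 1" "\<rho> \<longlonglongrightarrow> 1"
    and conv: "(\<lambda>j. integral {-a..a} (\<lambda>t. 1 - (cmod (F (of_real (\<rho> j) * l * cis t)))\<^sup>2)) \<longlonglongrightarrow> 0"
    and s: "- a < s" "s < 0"
  shows "1 - cmod (F (l * of_real (exp s))) \<le> ln (1 / \<epsilon>) / min (1 - exp (- a)) (1 - cos a) * (1 - exp s)"
proof -
  \<comment> \<open>A lower bound for \<open>1 - Re (cnj l * z)\<close> on three sides of the
    rectangle: the left side has modulus at most \<open>exp (- a)\<close>, and the horizontal sides
    have cosine \<open>cos a\<close>. With \<open>N * c = ln (1 / \<epsilon>)\<close> the
    exponential factor there is at most \<epsilon>.\<close>
  define c where "c = min (1 - exp (- a)) (1 - cos a)"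
  have "cos a < 1"
    using a cos_monotone_0_pi[of 0 a] pi_gt3 by auto
  then have c: "c > 0" using a by (simp add: c_def)
  define N where "N = ln (1 / \<epsilon>) / c"
  have N: "N > 0" using eps c by (simp add: N_def)
  define G where "G z = exp (- of_real N * (1 - cnj l * z)) / F z" for z
  have ll: "cnj l * l = 1" by (simp only: cnj_mult_self l) simp
  define d where "d = min a (min (- s) (s + a))"
  have d: "d > 0" "d \<le> a" "d \<le> - s" "d \<le> s + a" using s a by (auto simp: d_def)
  have nG: "cmod (G (of_real r * l * exp \<zeta>)) = exp (- N * (1 - r * exp (Re \<zeta>) * cos (Im \<zeta>))) / cmod (F (of_real r * l * exp \<zeta>))" for r \<zeta>
  proof -
    have "cnj l * (of_real r * l * exp \<zeta>) = (cnj l * l) * (of_real r * exp \<zeta>)" by simp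
    also have "Re \<dots> = r * exp (Re \<zeta>) * cos (Im \<zeta>)" by (simp only: ll mult_1_left) (simp add: Re_exp)
    finally show ?thesis by (simp add: G_def norm_divide)
  qed
  \<comment> \<open>For fixed \<open>n\<close> the arc term disappears as the dilation tends to 1,
    however large \<open>C\<close> is. What remains does not depend on \<open>n\<close>, so the
    modulus cannot exceed 1.\<close>
  have key: "cmod (G (l * of_real (exp s))) ^ n \<le> 6 * a / (2 * pi * d)" for n
  proof -
    define C where "C = real n / \<epsilon> ^ n"
    have C: "C \<ge> 0" using eps by (simp add: C_def)
    have ev: "eventually (\<lambda>j. ln (\<rho> j) > - a) sequentially"
    proof -
      have "(\<lambda>j. ln (\<rho> j)) \<longlonglongrightarrow> ln 1" by (intro tendsto_ln rho) simp
      then show ?thesis using a by (intro order_tendstoD) auto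
    qed
    have ev': "eventually (\<lambda>j. 2 * pi * cmod (G (of_real (\<rho> j) * l * exp (of_real s)) ^ n)
        \<le> (6 * a + C * integral {-a..a} (\<lambda>t. 1 - (cmod (F (of_real (\<rho> j) * l * cis t)))\<^sup>2)) / d) sequentially"
      using ev
    proof eventually_elim
      case (elim j)
      let ?r = "\<rho> j"
      have r: "0 < ?r" "?r < 1" by (rule rho)+
      define L where "L = ln ?r"
      have L: "L < 0" "- a < L" "?r = exp L" using r elim by (simp_all add: L_def)
      have expr: "of_real ?r * l * exp \<zeta> = l * exp (\<zeta> + of_real L)" for \<zeta> :: complex
        unfolding L(3) by (simp add: exp_add exp_of_real)
      \<comment> \<open>Since \<open>L > - a\<close>, the dilation uses up one \<open>a\<close> of
        the width \<open>3 * a\<close> granted by \<open>low\<close>.\<close>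
      have lowr: "\<epsilon> \<le> cmod (F (of_real ?r * l * exp \<zeta>))"
        if "- 2 * a < Re \<zeta>" "Re \<zeta> < - ln ?r" "\<bar>Im \<zeta>\<bar> < 2 * a" for \<zeta> :: complex
      proof -
        have "\<epsilon> \<le> cmod (F (l * exp (\<zeta> + of_real L)))"
        proof (rule low)
          have "Re (\<zeta> + of_real L) = Re \<zeta> + L" "Im (\<zeta> + of_real L) = Im \<zeta>" by simp_all
          then show "- 3 * a < Re (\<zeta> + of_real L)" "Re (\<zeta> + of_real L) < 0" "\<bar>Im (\<zeta> + of_real L)\<bar> < 2 * a"
            using that(1,2)[folded L_def] that(3) L(2) by linarith+
        qed
        then show ?thesis by (simp only: expr)
      qed
      have inb: "cmod (of_real ?r * l * exp \<zeta>) < 1" if "Re \<zeta> < - ln ?r" for \<zeta> :: complex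
      proof -
        have "cmod (of_real ?r * l * exp \<zeta>) = exp (Re \<zeta> + L)"
          unfolding expr using l by (simp add: norm_mult)
        then show ?thesis using that by (simp add: L_def)
      qed
      have lnr: "ln ?r < 0" using L(1) by (simp add: L_def)
      \<comment> \<open>Dilation by \<open>?r\<close> moves the right side of the rectangle to the
        circle of radius \<open>?r\<close>, so the function is holomorphic a distance
        \<open>- ln ?r\<close> beyond it.\<close>
      show ?case
      proof (rule rectangle_bound[where b = "2 * a" and h = "- ln ?r" and C = C
            and H = "\<lambda>\<zeta>. G (of_real ?r * l * exp \<zeta>) ^ n" and p = "\<lambda>t. 1 - (cmod (F (of_real ?r * l * cis t)))\<^sup>2"])
        let ?B = "box (Complex (- (2 * a)) (- (2 * a))) (Complex (- ln ?r) (2 * a))"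
        have "(\<lambda>\<zeta>. of_real ?r * l * exp \<zeta>) holomorphic_on ?B"
          by (intro holomorphic_intros)
        moreover have "(\<lambda>\<zeta>. of_real ?r * l * exp \<zeta>) ` ?B \<subseteq> ball 0 1"
        proof
          fix z assume "z \<in> (\<lambda>\<zeta>. of_real ?r * l * exp \<zeta>) ` ?B"
          then obtain \<zeta> where "z = of_real ?r * l * exp \<zeta>" "\<zeta> \<in> ?B" by blast
          then show "z \<in> ball 0 1" using inb[of \<zeta>] by (simp add: in_box_complex_iff)
        qed
        ultimately have "(F \<circ> (\<lambda>\<zeta>. of_real ?r * l * exp \<zeta>)) holomorphic_on ?B"
          by (rule holomorphic_on_compose_gen[OF _ hol])
        then have "(\<lambda>\<zeta>. F (of_real ?r * l * exp \<zeta>)) holomorphic_on ?B"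
          by (simp only: o_def)
        moreover have "F (of_real ?r * l * exp \<zeta>) \<noteq> 0" if "\<zeta> \<in> box (Complex (- (2 * a)) (- (2 * a))) (Complex (- ln ?r) (2 * a))" for \<zeta>
          using lowr[of \<zeta>] that eps by (auto simp: in_box_complex_iff abs_less_iff)
        ultimately show "(\<lambda>\<zeta>. G (of_real ?r * l * exp \<zeta>) ^ n) holomorphic_on box (Complex (- (2 * a)) (- (2 * a))) (Complex (- ln ?r) (2 * a))"
          unfolding G_def
          by (intro holomorphic_on_power holomorphic_on_divide holomorphic_on_exp' holomorphic_intros) simp_all
      next
        fix \<zeta> assume z: "\<zeta> \<in> cbox (Complex (- a) (- a)) (Complex 0 a)" "Re \<zeta> = - a \<or> \<bar>Im \<zeta>\<bar> = a"
        have z': "- a \<le> Re \<zeta>" "Re \<zeta> \<le> 0" "\<bar>Im \<zeta>\<bar> \<le> a" using z(1) by (auto simp: in_cbox_complex_iff)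
        have cp: "cos (Im \<zeta>) \<ge> 0" using z'(3) a pi_gt3 by (intro cos_ge_zero) auto
        have 1: "exp (Re \<zeta>) * cos (Im \<zeta>) \<le> 1 - c"
        proof (cases "Re \<zeta> = - a")
          case True
          then have "exp (Re \<zeta>) * cos (Im \<zeta>) \<le> exp (- a) * 1" using cp by (intro mult_mono) auto
          then show ?thesis by (simp add: c_def)
        next
          case False
          then have "cos (Im \<zeta>) = cos a" using z(2) by (metis cos_abs_real)
          moreover have "exp (Re \<zeta>) * cos (Im \<zeta>) \<le> 1 * cos (Im \<zeta>)" using z' cp by (intro mult_right_mono) auto
          ultimately show ?thesis by (simp add: c_def)
        qed
        have 2: "?r * (exp (Re \<zeta>) * cos (Im \<zeta>)) \<le> 1 * (exp (Re \<zeta>) * cos (Im \<zeta>))"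
          using r cp by (intro mult_right_mono) auto
        from 1 2 have "c \<le> 1 - ?r * exp (Re \<zeta>) * cos (Im \<zeta>)"
          unfolding mult_1_left mult.assoc by linarith
        then have "N * c \<le> N * (1 - ?r * exp (Re \<zeta>) * cos (Im \<zeta>))" using N by (intro mult_left_mono) auto
        then have "exp (- N * (1 - ?r * exp (Re \<zeta>) * cos (Im \<zeta>))) \<le> exp (- (N * c))" by simp
        also have "exp (- (N * c)) = \<epsilon>" using c eps by (simp add: N_def ln_div)
        finally have "cmod (G (of_real ?r * l * exp \<zeta>)) \<le> 1"
          unfolding nG using lowr[of \<zeta>] z' a lnr eps by (simp add: divide_le_eq_1)
        then show "cmod (G (of_real ?r * l * exp \<zeta>) ^ n) \<le> 1"
          by (simp add: norm_power power_le_one)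
      next
        fix t :: real assume t: "\<bar>t\<bar> \<le> a"
        have e: "exp (Complex 0 t) = cis t" by (simp add: cis_conv_exp Complex_eq)
        have lo: "\<epsilon> \<le> cmod (F (of_real ?r * l * cis t))"
          using lowr[of "Complex 0 t"] t a lnr by (simp add: e)
        have up: "cmod (F (of_real ?r * l * cis t)) \<le> 1"
          using le1 inb[of "Complex 0 t"] lnr by (simp add: e)
        have "?r * cos t \<le> ?r * 1" using r by (intro mult_left_mono cos_le_one) simp
        then have "0 \<le> 1 - ?r * cos t" using r by linarith
        then have "exp (- N * (1 - ?r * cos t)) \<le> 1" using N by (simp add: mult_nonneg_nonneg)
        then have "cmod (G (of_real ?r * l * exp (Complex 0 t))) \<le> 1 / cmod (F (of_real ?r * l * cis t))"
          unfolding nG using eps lo by (simp add: e divide_right_mono)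
        then have "cmod (G (of_real ?r * l * exp (Complex 0 t))) ^ n \<le> (1 / cmod (F (of_real ?r * l * cis t))) ^ n"
          by (intro power_mono) auto
        also have "\<dots> \<le> 1 + C * (1 - (cmod (F (of_real ?r * l * cis t)))\<^sup>2)"
          unfolding C_def by (rule inverse_power_bound[OF eps(1) lo up])
        finally show "cmod (G (of_real ?r * l * exp (Complex 0 t)) ^ n) \<le> 1 + C * (1 - (cmod (F (of_real ?r * l * cis t)))\<^sup>2)"
          by (simp add: norm_power)
      next
        have "continuous_on {-a..a} (\<lambda>t. F (of_real ?r * l * cis t))"
          by (rule continuous_on_compose2[OF holomorphic_on_imp_continuous_on[OF hol]])
             (use r l in \<open>auto intro!: continuous_intros simp: norm_mult\<close>)
        then show "(\<lambda>t. 1 - (cmod (F (of_real ?r * l * cis t)))\<^sup>2) integrable_on {-a..a}"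
          by (intro integrable_continuous_real continuous_intros)
      qed (use a s d lnr in auto)
    qed
    have L1: "(\<lambda>j. 2 * pi * cmod (G (of_real (\<rho> j) * l * exp (of_real s)) ^ n)) \<longlonglongrightarrow> 2 * pi * cmod (G (of_real 1 * l * exp (of_real s)) ^ n)"
    proof -
      let ?z = "of_real 1 * l * exp (complex_of_real s)"
      have zin: "?z \<in> ball 0 1" using s l by (simp add: norm_mult)
      have "F ?z \<noteq> 0" using low[of "of_real s"] s a eps by auto
      moreover have "isCont F ?z"
        using holomorphic_on_imp_continuous_on[OF hol] zin
        by (subst (asm) continuous_on_eq_continuous_at) (rule open_ball, erule bspec)
      ultimately have "isCont G ?z" unfolding G_def by (intro continuous_intros) auto
      then show ?thesis
        by (intro tendsto_intros isCont_tendsto_compose[of _ G] rho)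
    qed
    have L2: "(\<lambda>j. (6 * a + C * integral {-a..a} (\<lambda>t. 1 - (cmod (F (of_real (\<rho> j) * l * cis t)))\<^sup>2)) / d) \<longlonglongrightarrow> (6 * a + C * 0) / d"
      using d by (intro tendsto_intros conv) auto
    have "2 * pi * cmod (G (of_real 1 * l * exp (of_real s)) ^ n) \<le> (6 * a + C * 0) / d"
      by (rule tendsto_le[OF sequentially_bot L2 L1 ev'])
    then show ?thesis
      using d pi_gt_zero by (simp add: norm_power field_simps exp_of_real)
  qed
  have G1: "cmod (G (l * of_real (exp s))) \<le> 1"
  proof (rule ccontr)
    assume "\<not> ?thesis"
    then obtain n where "6 * a / (2 * pi * d) < cmod (G (l * of_real (exp s))) ^ n"
      using real_arch_pow[of "cmod (G (l * of_real (exp s)))" "6 * a / (2 * pi * d)"] by auto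
    then show False using key[of n] by linarith
  qed
  have F0: "cmod (F (l * of_real (exp s))) > 0"
    using low[of "of_real s"] s a eps by (auto simp: exp_of_real)
  have "exp (- N * (1 - exp s)) \<le> cmod (F (l * of_real (exp s)))"
    using G1 nG[of 1 "of_real s"] F0 by (simp add: exp_of_real divide_le_eq_1)
  moreover have "1 + (- N * (1 - exp s)) \<le> exp (- N * (1 - exp s))" by (rule exp_ge_add_one_self)
  ultimately have "1 - cmod (F (l * of_real (exp s))) \<le> N * (1 - exp s)" by simp
  then show ?thesis by (simp add: N_def c_def)
qed

text \<open>Every point near \<mu> is \<open>l * exp s\<close> with \<open>l\<close> on the circle
  near \<mu>, and the constant of \<open>radial_estimate\<close> does not depend on
  \<open>l\<close>. Passing from moduli to their squares costs a factor 2.\<close>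

lemma boundary_estimate:
  fixes F :: "complex \<Rightarrow> complex" and \<rho> :: "nat \<Rightarrow> real"
  assumes hol: "F holomorphic_on ball 0 1" and le1: "\<And>z. cmod z < 1 \<Longrightarrow> cmod (F z) \<le> 1"
    and mu: "cmod \<mu> = 1" and r: "0 < r" and eps: "0 < \<epsilon>" "\<epsilon> < 1"
    and low: "\<And>z. cmod z < 1 \<Longrightarrow> dist z \<mu> < r \<Longrightarrow> \<epsilon> \<le> cmod (F z)"
    and rho: "\<And>j. 0 < \<rho> j" "\<And>j. \<rho> j < 1" "\<rho> \<longlonglongrightarrow> 1"
    and conv: "\<And>(l::complex) a. cmod l = 1 \<Longrightarrow> 0 < a \<Longrightarrow> a < 1 \<Longrightarrow>
      (\<lambda>j. integral {-a..a} (\<lambda>t. 1 - (cmod (F (of_real (\<rho> j) * l * cis t)))\<^sup>2)) \<longlonglongrightarrow> 0"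
  obtains C r' where "C > 0" "r' > 0"
    "\<And>w. cmod w < 1 \<Longrightarrow> dist w \<mu> < r' \<Longrightarrow> 1 - (cmod (F w))\<^sup>2 \<le> C * (1 - (cmod w)\<^sup>2)"
proof -
  have "isCont exp (0::complex)" by (intro continuous_intros)
  then obtain \<delta> where \<delta>: "\<delta> > 0" "\<And>\<zeta>::complex. dist \<zeta> 0 < \<delta> \<Longrightarrow> dist (exp \<zeta>) (exp 0) < r / 2"
    using r unfolding continuous_at_eps_delta by (metis half_gt_zero)
  \<comment> \<open>The logarithmic box has real parts up to \<open>3 * a\<close> and imaginary
    parts up to \<open>2 * a\<close> in modulus, so \<open>5 * a < \<delta>\<close> keeps its
    exponentials within \<open>r / 2\<close> of 1.\<close>
  define a where "a = min (1/2) (\<delta> / 6)"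
  have a: "0 < a" "a < 1" "5 * a < \<delta>" using \<delta> by (auto simp: a_def)
  define N where "N = ln (1 / \<epsilon>) / min (1 - exp (- a)) (1 - cos a)"
  have "cos a < 1" using a cos_monotone_0_pi[of 0 a] pi_gt3 by auto
  then have N: "N > 0" unfolding N_def using a eps by (intro divide_pos_pos) auto
  \<comment> \<open>The first bound puts the radial projection \<open>l\<close> of \<open>w\<close>
    within \<open>r / 2\<close> of \<mu>; the second ensures \<open>cmod w > exp (- a)\<close>, that
    is \<open>s > - a\<close>.\<close>
  define r' where "r' = min (r / 4) (1 - exp (- a))"
  have r'_le: "r' \<le> r / 4" unfolding r'_def by (rule min.cobounded1)
  have r': "r' > 0" using r a by (simp add: r'_def)
  have "1 - (cmod (F w))\<^sup>2 \<le> (2 * N) * (1 - (cmod w)\<^sup>2)" if w: "cmod w < 1" "dist w \<mu> < r'" for w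
  proof -
    have "1 - cmod w \<le> dist w \<mu>" using mu norm_triangle_ineq2[of \<mu> w] by (simp add: dist_norm norm_minus_commute)
    then have we: "exp (- a) < cmod w" using w(2) by (simp add: r'_def)
    then have w0: "cmod w > 0" using exp_gt_zero[of "-a"] by linarith
    define l where "l = w / of_real (cmod w)"
    define s where "s = ln (cmod w)"
    have l: "cmod l = 1" using w0 by (simp add: l_def norm_divide)
    have es: "exp s = cmod w" using w0 by (simp add: s_def)
    have s: "- a < s" "s < 0"
      using we w(1) es exp_less_cancel_iff[of "- a" s] exp_less_one_iff[of s] by auto
    have lw: "l * of_real (exp s) = w" using w0 by (simp add: es l_def)
    have "l - w = l * of_real (1 - cmod w)" using lw es by (simp add: right_diff_distrib)
    then have "dist l w = 1 - cmod w"
      unfolding dist_norm using l w by (simp only: norm_mult norm_of_real) simp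
    then have "dist l \<mu> < 2 * r'"
      using dist_triangle[of l \<mu> w] w(2) \<open>1 - cmod w \<le> dist w \<mu>\<close> by linarith
    then have lm: "dist l \<mu> < r / 2" using r'_le by linarith
    have "1 - cmod (F (l * of_real (exp s))) \<le> N * (1 - exp s)"
      unfolding N_def
    proof (rule radial_estimate[OF hol le1 l a(1,2) eps _ rho conv[OF l a(1,2)] s])
      fix \<zeta> assume z: "- 3 * a < Re \<zeta>" "Re \<zeta> < 0" "\<bar>Im \<zeta>\<bar> < 2 * a"
      have "cmod \<zeta> \<le> \<bar>Re \<zeta>\<bar> + \<bar>Im \<zeta>\<bar>" by (rule cmod_le)
      then have "dist (exp \<zeta>) (exp 0) < r / 2" using z a by (intro \<delta>) simp
      moreover have "dist (l * exp \<zeta>) l = dist (exp \<zeta>) (exp 0)"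
      proof -
        have "l * exp \<zeta> - l = l * (exp \<zeta> - 1)" by (simp add: algebra_simps)
        then show ?thesis using l by (simp add: dist_norm norm_mult)
      qed
      ultimately have "dist (l * exp \<zeta>) \<mu> < r"
        using lm dist_triangle[of "l * exp \<zeta>" \<mu> l] by linarith
      then show "\<epsilon> \<le> cmod (F (l * exp \<zeta>))"
        using z l by (intro low) (simp_all add: norm_mult)
    qed
    then have 1: "1 - cmod (F w) \<le> N * (1 - cmod w)" unfolding lw unfolding es .
    have "1 - (cmod (F w))\<^sup>2 = (1 - cmod (F w)) * (1 + cmod (F w))" by (simp add: power2_eq_square algebra_simps)
    also have "\<dots> \<le> (1 - cmod (F w)) * 2" using le1[OF w(1)] by (intro mult_left_mono) auto
    also have "\<dots> \<le> (N * (1 - cmod w)) * 2" using 1 by simp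
    also have "\<dots> \<le> (N * (1 - (cmod w)\<^sup>2)) * 2"
      using N w by (intro mult_right_mono mult_left_mono) (auto simp: power2_eq_square mult_left_le)
    finally show ?thesis by simp
  qed
  with N r' that[of "2 * N" r'] show ?thesis by auto
qed

section \<open>Radial means of an inner function\<close>

lemma disc_ext_measurable [measurable]: "disc_ext a \<in> borel_measurable borel"
  unfolding disc_ext_def suminf_eq_lim by (intro borel_measurable_lim_metric) measurable

context inner_symbol
begin

lemma AE_norm_theta: "AE z in circle_measure. cmod (\<theta> z) = 1"
  using unim by (simp add: unimodular_def)

lemma theta_measurable [measurable]: "\<theta> \<in> borel_measurable borel"
  by (rule Linf_measurable[OF Linf])

lemma fourier_theta_le_1: "cmod (fourier \<theta> n) \<le> 1"
  using fourier_L2_bound[of theta1 n] by (simp add: fourier_eq[OF Linf] norm_theta1 flip: theta1_def)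

lemma fourier_theta_sums_1: "(\<lambda>k. (cmod (fourier \<theta> (int k)))\<^sup>2) sums 1"
  using norm_H2_sums[OF theta1_H2] by (simp add: norm_theta1 fourier_eq[OF Linf] flip: theta1_def)

text \<open>Abel means of the series of squared coefficients of \<theta>. Equivalently, the product
  of the dilate \<open>\<theta>(\<rho> z)\<close> with \<theta> in \<open>L2\<close>.\<close>

definition "radial_mean \<rho> = (\<Sum>k. \<rho> ^ k * (cmod (fourier \<theta> (int k)))\<^sup>2)"

lemma summable_radial_mean: "0 \<le> \<rho> \<Longrightarrow> \<rho> < 1 \<Longrightarrow> summable (\<lambda>k. \<rho> ^ k * (cmod (fourier \<theta> (int k)))\<^sup>2)"
  using fourier_theta_sums_1[THEN sums_summable]
  by (rule summable_comparison_test'[where N = 0]) (simp add: abs_mult mult_left_le_one_le power_le_one)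

text \<open>Finitely many coefficients already carry almost the whole sum 1, and a finite sum is
  continuous in the radius. Nonnegative terms keep the mean between that finite sum and 1.\<close>

lemma radial_mean_tendsto_1:
  assumes rho: "\<And>j. 0 < \<rho> j" "\<And>j. \<rho> j < 1" "\<rho> \<longlonglongrightarrow> 1"
  shows "(\<lambda>j. radial_mean (\<rho> j)) \<longlonglongrightarrow> 1"
proof (rule LIMSEQ_I)
  fix e :: real assume e: "e > 0"
  let ?c = "\<lambda>k. (cmod (fourier \<theta> (int k)))\<^sup>2"
  obtain N where N: "norm ((\<Sum>k<N. ?c k) - 1) < e"
    using fourier_theta_sums_1 LIMSEQ_D[of "\<lambda>N. \<Sum>k<N. ?c k" 1 e] e unfolding sums_def by blast
  have "(\<lambda>j. \<Sum>k<N. \<rho> j ^ k * ?c k) \<longlonglongrightarrow> (\<Sum>k<N. 1 ^ k * ?c k)"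
    by (intro tendsto_intros rho)
  moreover have "1 - e < (\<Sum>k<N. 1 ^ k * ?c k)" using N by simp
  ultimately have "eventually (\<lambda>j. 1 - e < (\<Sum>k<N. \<rho> j ^ k * ?c k)) sequentially"
    by (rule order_tendstoD)
  then obtain J where J: "\<And>j. j \<ge> J \<Longrightarrow> 1 - e < (\<Sum>k<N. \<rho> j ^ k * ?c k)"
    by (auto simp: eventually_sequentially)
  have "norm (radial_mean (\<rho> j) - 1) < e" if "j \<ge> J" for j
  proof -
    have r: "0 \<le> \<rho> j" "\<rho> j < 1" "\<rho> j \<le> 1" using rho(1,2)[of j] by auto
    have "(\<Sum>k<N. \<rho> j ^ k * ?c k) \<le> radial_mean (\<rho> j)"
      unfolding radial_mean_def using r by (intro sum_le_suminf summable_radial_mean) auto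
    moreover have "radial_mean (\<rho> j) \<le> (\<Sum>k. ?c k)"
      unfolding radial_mean_def using r fourier_theta_sums_1[THEN sums_summable]
      by (intro suminf_le summable_radial_mean) (auto intro!: mult_left_le_one_le power_le_one)
    moreover have "(\<Sum>k. ?c k) = 1" using fourier_theta_sums_1 by (simp add: sums_iff)
    ultimately show ?thesis using J[OF that] e by simp
  qed
  then show "\<exists>J. \<forall>j\<ge>J. norm (radial_mean (\<rho> j) - 1) < e" by blast
qed

text \<open>Coefficients of \<theta> are at most 1 in modulus, so the series is dominated by a
  geometric one and may be integrated term by term.\<close>

lemma integral_radial:
  assumes r: "0 < \<rho>" "\<rho> < 1"
  shows "(\<integral>z. disc_ext \<theta> (of_real \<rho> * z) * cnj (\<theta> z) \<partial>circle_measure) = of_real (radial_mean \<rho>)"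
proof -
  let ?f = "\<lambda>k z. fourier \<theta> (int k) * (of_real \<rho> * z) ^ k * cnj (\<theta> z)"
  have fLinf: "?f k \<in> Linf" for k
  proof -
    have "(\<lambda>z. fourier \<theta> (int k) * of_real \<rho> ^ k * (z powi int k) * cnj (\<theta> z)) \<in> Linf"
      by (intro Linf_intros Linf)
    then show ?thesis by (simp add: power_mult_distrib mult.assoc)
  qed
  have bd: "AE z in circle_measure. cmod (?f k z) \<le> \<rho> ^ k" for k
    using AE_norm_theta AE_circle_norm
  proof eventually_elim
    case (elim z)
    have "cmod (fourier \<theta> (int k)) * \<rho> ^ k \<le> 1 * \<rho> ^ k"
      using r by (intro mult_right_mono fourier_theta_le_1) auto
    then show ?case using elim r by (simp add: norm_mult norm_power)
  qed
  have int: "integrable circle_measure (?f k)" for k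
    by (rule circle.integrable_const_bound[OF bd]) (simp add: Linf_measurable fLinf)
  have intn: "(\<integral>z. cmod (?f k z) \<partial>circle_measure) \<le> \<rho> ^ k" for k
    using integral_mono_AE[OF integrable_norm[OF int] _ bd] circle.prob_space by simp
  have sg: "summable (\<lambda>k. \<rho> ^ k)" using r by (intro summable_geometric) auto
  have "(\<lambda>k. \<integral>z. ?f k z \<partial>circle_measure) sums (\<integral>z. (\<Sum>k. ?f k z) \<partial>circle_measure)"
  proof (rule sums_integral)
    have "AE z in circle_measure. \<forall>k. cmod (?f k z) \<le> \<rho> ^ k"
      using bd by (simp add: AE_all_countable)
    then show "AE z in circle_measure. summable (\<lambda>k. norm (?f k z))"
      by eventually_elim (rule summable_comparison_test'[OF sg, of 0], simp)
    show "summable (\<lambda>k. \<integral>z. norm (?f k z) \<partial>circle_measure)"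
      by (rule summable_comparison_test'[OF sg, of 0]) (simp add: intn)
  qed (rule int)
  moreover have "(\<integral>z. ?f k z \<partial>circle_measure) = of_real (\<rho> ^ k * (cmod (fourier \<theta> (int k)))\<^sup>2)" for k
  proof -
    have "(\<integral>z. ?f k z \<partial>circle_measure) = (\<integral>z. (fourier \<theta> (int k) * of_real \<rho> ^ k) * cnj (\<theta> z * cnj (z powi int k)) \<partial>circle_measure)"
      by (rule Bochner_Integration.integral_cong) (auto simp: power_mult_distrib)
    also have "\<dots> = (fourier \<theta> (int k) * of_real \<rho> ^ k) * cnj (fourier \<theta> (int k))"
      unfolding fourier_def[of \<theta>] by (simp only: integral_mult_right_zero Bochner_Integration.integral_cnj)
    also have "\<dots> = of_real \<rho> ^ k * (cnj (fourier \<theta> (int k)) * fourier \<theta> (int k))"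
      by simp
    also have "\<dots> = of_real (\<rho> ^ k * (cmod (fourier \<theta> (int k)))\<^sup>2)"
      by (simp only: cnj_mult_self of_real_mult of_real_power)
    finally show ?thesis .
  qed
  ultimately have 1: "(\<lambda>k. complex_of_real (\<rho> ^ k * (cmod (fourier \<theta> (int k)))\<^sup>2)) sums (\<integral>z. (\<Sum>k. ?f k z) \<partial>circle_measure)"
    by simp
  have 2: "(\<lambda>k. complex_of_real (\<rho> ^ k * (cmod (fourier \<theta> (int k)))\<^sup>2)) sums of_real (radial_mean \<rho>)"
    unfolding radial_mean_def using r by (intro sums_of_real summable_sums summable_radial_mean) auto
  have "(\<integral>z. (\<Sum>k. ?f k z) \<partial>circle_measure) = (\<integral>z. disc_ext \<theta> (of_real \<rho> * z) * cnj (\<theta> z) \<partial>circle_measure)"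
  proof (rule integral_cong_AE)
    show "AE z in circle_measure. (\<Sum>k. ?f k z) = disc_ext \<theta> (of_real \<rho> * z) * cnj (\<theta> z)"
      using AE_circle_norm
    proof eventually_elim
      case (elim z)
      then have "cmod (of_real \<rho> * z) < 1" using r by (simp add: norm_mult)
      from sums_mult2[OF disc_ext_sums(1)[OF Hinf this]]
      show ?case by (simp add: sums_iff)
    qed
    show "(\<lambda>z. \<Sum>k. ?f k z) \<in> borel_measurable circle_measure"
      unfolding suminf_eq_lim by (intro borel_measurable_lim_metric) measurable
  qed measurable
  with sums_unique2[OF 1 2] show ?thesis by simp
qed

text \<open>Both integrands are at most \<open>2 * (1 - Re (F * cnj \<theta>))\<close> almost
  everywhere: expand \<open>\<bar>\<theta> - F\<bar>\<^sup>2\<close> using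
  \<open>\<bar>\<theta>\<bar> = 1\<close>, then use \<open>\<bar>F\<bar> \<le> 1\<close> for the
  first bound and nonnegativity of the square for the second.\<close>

lemma radial_defects:
  assumes r: "0 < \<rho>" "\<rho> < 1"
  shows "integrable circle_measure (\<lambda>z. (cmod (\<theta> z - disc_ext \<theta> (of_real \<rho> * z)))\<^sup>2)"
    "(\<integral>z. (cmod (\<theta> z - disc_ext \<theta> (of_real \<rho> * z)))\<^sup>2 \<partial>circle_measure) \<le> 2 * (1 - radial_mean \<rho>)"
    "(\<integral>z. 1 - (cmod (disc_ext \<theta> (of_real \<rho> * z)))\<^sup>2 \<partial>circle_measure) \<le> 2 * (1 - radial_mean \<rho>)"
proof -
  let ?F = "\<lambda>z. disc_ext \<theta> (of_real \<rho> * z)"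
  have F1: "AE z in circle_measure. cmod (?F z) \<le> 1"
    using AE_circle_norm by eventually_elim (use r in \<open>intro norm_disc_ext_le_1, simp add: norm_mult\<close>)
  have Fm: "?F \<in> borel_measurable borel" by measurable
  have FL: "?F \<in> Linf" by (rule LinfI[OF Fm F1])
  have i0: "integrable circle_measure (\<lambda>z. ?F z * cnj (\<theta> z))"
  proof (rule circle.integrable_const_bound)
    show "AE z in circle_measure. cmod (?F z * cnj (\<theta> z)) \<le> 1"
      using F1 AE_norm_theta by eventually_elim (simp add: norm_mult)
  qed (use Fm in measurable)
  have i1: "integrable circle_measure (\<lambda>z. 2 * (1 - Re (?F z * cnj (\<theta> z))))"
    using i0 by (intro Bochner_Integration.integrable_diff integrable_mult_right integrable_Re) auto
  have I1: "(\<integral>z. 2 * (1 - Re (?F z * cnj (\<theta> z))) \<partial>circle_measure) = 2 * (1 - radial_mean \<rho>)"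
  proof -
    have "(\<integral>z. 1 - Re (?F z * cnj (\<theta> z)) \<partial>circle_measure) = 1 - (\<integral>z. Re (?F z * cnj (\<theta> z)) \<partial>circle_measure)"
      using integrable_Re[OF i0] circle.prob_space by (subst Bochner_Integration.integral_diff) auto
    also have "(\<integral>z. Re (?F z * cnj (\<theta> z)) \<partial>circle_measure) = radial_mean \<rho>"
      using integral_Re[OF i0] integral_radial[OF r] by simp
    finally show ?thesis by (simp only: integral_mult_right_zero)
  qed
  have key: "AE z in circle_measure. (cmod (\<theta> z - ?F z))\<^sup>2 \<le> 2 * (1 - Re (?F z * cnj (\<theta> z)))
      \<and> 1 - (cmod (?F z))\<^sup>2 \<le> 2 * (1 - Re (?F z * cnj (\<theta> z)))"
    using F1 AE_norm_theta
  proof eventually_elim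
    case (elim z)
    have t: "(Re (\<theta> z))\<^sup>2 + (Im (\<theta> z))\<^sup>2 = 1" using elim(2) by (simp add: cmod_def)
    have F: "(Re (?F z))\<^sup>2 + (Im (?F z))\<^sup>2 \<le> 1" using elim(1) by (simp add: cmod_def)
    have e: "(cmod (\<theta> z - ?F z))\<^sup>2 = 1 + ((Re (?F z))\<^sup>2 + (Im (?F z))\<^sup>2) - 2 * Re (?F z * cnj (\<theta> z))"
      unfolding cmod_power2 t[symmetric] by (simp add: power2_eq_square algebra_simps)
    have "0 \<le> (cmod (\<theta> z - ?F z))\<^sup>2" by simp
    have arith: "A = 1 + B - 2 * X \<Longrightarrow> B \<le> 1 \<Longrightarrow> 0 \<le> A \<Longrightarrow> A \<le> 2 * (1 - X) \<and> 1 - B \<le> 2 * (1 - X)"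
      for A B X :: real by auto
    show ?case unfolding cmod_power2[of "?F z"] by (rule arith[OF e F \<open>0 \<le> (cmod (\<theta> z - ?F z))\<^sup>2\<close>])
  qed
  have m: "(\<lambda>z. (cmod (\<theta> z - ?F z))\<^sup>2) \<in> borel_measurable borel" using Fm by measurable
  show i2: "integrable circle_measure (\<lambda>z. (cmod (\<theta> z - ?F z))\<^sup>2)"
    by (rule Bochner_Integration.integrable_bound[OF i1]) (use m key in \<open>auto elim!: eventually_mono\<close>)
  have "(\<integral>z. (cmod (\<theta> z - ?F z))\<^sup>2 \<partial>circle_measure) \<le> (\<integral>z. 2 * (1 - Re (?F z * cnj (\<theta> z))) \<partial>circle_measure)"
    by (rule integral_mono_AE[OF i2 i1]) (use key in \<open>auto elim!: eventually_mono\<close>)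
  then show "(\<integral>z. (cmod (\<theta> z - ?F z))\<^sup>2 \<partial>circle_measure) \<le> 2 * (1 - radial_mean \<rho>)"
    by (simp only: I1)
  have i3: "integrable circle_measure (\<lambda>z. 1 - (cmod (?F z))\<^sup>2)"
    by (rule circle.integrable_const_bound[where B = 1])
       (use F1 Fm in \<open>auto elim!: eventually_mono simp: abs_square_le_1\<close>)
  have "(\<integral>z. 1 - (cmod (?F z))\<^sup>2 \<partial>circle_measure) \<le> (\<integral>z. 2 * (1 - Re (?F z * cnj (\<theta> z))) \<partial>circle_measure)"
    by (rule integral_mono_AE[OF i3 i1]) (use key in \<open>auto elim!: eventually_mono\<close>)
  then show "(\<integral>z. 1 - (cmod (?F z))\<^sup>2 \<partial>circle_measure) \<le> 2 * (1 - radial_mean \<rho>)"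
    by (simp only: I1)
qed

lemma arc_integral_bound:
  assumes r: "0 < \<rho>" "\<rho> < 1" and l: "cmod l = 1" and a: "0 < a" "a < 1"
  shows "0 \<le> integral {-a..a} (\<lambda>t. 1 - (cmod (disc_ext \<theta> (of_real \<rho> * l * cis t)))\<^sup>2)"
    "integral {-a..a} (\<lambda>t. 1 - (cmod (disc_ext \<theta> (of_real \<rho> * l * cis t)))\<^sup>2) \<le> 8 * pi * (1 - radial_mean \<rho>)"
proof -
  define p where "p t = 1 - (cmod (disc_ext \<theta> (of_real \<rho> * cis t)))\<^sup>2" for t
  have p0: "p t \<ge> 0" for t
  proof -
    have "cmod (disc_ext \<theta> (of_real \<rho> * cis t)) \<le> 1"
      using r by (intro norm_disc_ext_le_1) (simp add: norm_mult)
    then show ?thesis by (simp add: p_def abs_square_le_1)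
  qed
  have pc: "continuous_on A p" for A
    unfolding p_def
    by (intro continuous_intros continuous_on_compose2[OF holomorphic_on_imp_continuous_on[OF disc_ext_holomorphic[OF Hinf]]])
       (use r in \<open>auto simp: norm_mult\<close>)
  have pi: "p integrable_on {u..v}" for u v by (intro integrable_continuous_real pc)
  define t0 where "t0 = Arg l"
  have lt: "l = cis t0" unfolding t0_def using l by (metis cis_Arg_unique Arg_correct cis_Arg norm_zero sgn_eq zero_neq_one div_by_1 of_real_1)
  have t0: "- pi < t0" "t0 \<le> pi" unfolding t0_def using Arg_bounded by auto
  have shift: "integral {-a..a} (\<lambda>t. 1 - (cmod (disc_ext \<theta> (of_real \<rho> * l * cis t)))\<^sup>2) = integral {t0 - a..t0 + a} p"
  proof -
    have "(p has_integral integral {t0 - a..t0 + a} p) {t0 - a..t0 + a}" by (intro integrable_integral pi)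
    from has_integral_shift_real_ivl[OF this, of t0]
    have "((\<lambda>t. p (t + t0)) has_integral integral {t0 - a..t0 + a} p) {-a..a}" by simp
    moreover have "p (t + t0) = 1 - (cmod (disc_ext \<theta> (of_real \<rho> * l * cis t)))\<^sup>2" for t
      by (simp add: p_def lt mult.assoc cis_mult add.commute)
    ultimately show ?thesis by (simp add: integral_unique)
  qed
  show "0 \<le> integral {-a..a} (\<lambda>t. 1 - (cmod (disc_ext \<theta> (of_real \<rho> * l * cis t)))\<^sup>2)"
    unfolding shift by (rule Henstock_Kurzweil_Integration.integral_nonneg[OF pi p0])
  \<comment> \<open>The arc may cross the branch cut of \<open>Arg\<close>, so it is enlarged to two
    full periods. Each contributes at most \<open>2 * pi\<close> times
    \<open>2 * (1 - radial_mean \<rho>)\<close>, whence the constant \<open>8 * pi\<close>.\<close>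
  have "integral {t0 - a..t0 + a} p \<le> integral {-(2*pi)..2*pi} p"
    using t0 a pi_gt3 by (intro integral_subset_le pi) (auto simp: p0)
  also have "\<dots> = integral {-(2*pi)..0} p + integral {0..2*pi} p"
    by (intro Henstock_Kurzweil_Integration.integral_combine[symmetric] pi) auto
  also have "integral {-(2*pi)..0} p = integral {0..2*pi} p"
  proof -
    have "(p has_integral integral {-(2*pi)..0} p) {-(2*pi)..0}" by (intro integrable_integral pi)
    from has_integral_shift_real_ivl[OF this, of "-(2*pi)"]
    have "((\<lambda>t. p (t - 2*pi)) has_integral integral {-(2*pi)..0} p) {0..2*pi}" by simp
    moreover have "p (t - 2*pi) = p t" for t
      by (simp add: p_def cis_divide[symmetric])
    ultimately show ?thesis by (simp add: integral_unique)
  qed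
  also have "integral {0..2*pi} p = 2 * pi * (\<integral>z. 1 - (cmod (disc_ext \<theta> (of_real \<rho> * z)))\<^sup>2 \<partial>circle_measure)"
  proof -
    have "(\<integral>z. 1 - (cmod (disc_ext \<theta> (of_real \<rho> * z)))\<^sup>2 \<partial>circle_measure)
        = (\<integral>t. (indicator {0..2*pi} t / (2 * pi)) *\<^sub>R p t \<partial>lborel)"
      unfolding p_def by (rule integral_circle_measure) measurable
    also have "\<dots> = (\<integral>t. indicator {0..2*pi} t *\<^sub>R p t \<partial>lborel) / (2 * pi)"
      by (subst Bochner_Integration.integral_divide_zero[symmetric]) (simp add: ac_simps)
    also have "(\<integral>t. indicator {0..2*pi} t *\<^sub>R p t \<partial>lborel) = integral {0..2*pi} p"
    proof -
      have "set_integrable lborel {0..2*pi} p" by (rule borel_integrable_atLeastAtMost'[OF pc])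
      from set_borel_integral_eq_integral(2)[OF this] show ?thesis by (simp add: set_lebesgue_integral_def)
    qed
    finally show ?thesis by (simp add: field_simps)
  qed
  also have "(\<integral>z. 1 - (cmod (disc_ext \<theta> (of_real \<rho> * z)))\<^sup>2 \<partial>circle_measure) \<le> 2 * (1 - radial_mean \<rho>)"
    by (rule radial_defects(3)[OF r])
  finally show "integral {-a..a} (\<lambda>t. 1 - (cmod (disc_ext \<theta> (of_real \<rho> * l * cis t)))\<^sup>2) \<le> 8 * pi * (1 - radial_mean \<rho>)"
    unfolding shift by (simp add: algebra_simps)
qed

end

section \<open>The bounded quotient and invertibility of the truncated shift minus \<mu>\<close>

context inner_symbol
begin

text \<open>In the kernel inequality \<open>w\<close> is sent to \<mu> along a radius, then
  \<open>z\<close> to almost every boundary point near \<mu>. This bounds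
  \<open>\<theta> - c'\<close> by a multiple of \<open>\<bar>z - \<mu>\<bar>\<close> there;
  elsewhere the denominator is bounded below.\<close>

lemma theta_quotient_bounded:
  assumes mu: "cmod \<mu> = 1" and r: "0 < r" and eps: "0 < \<epsilon>" "\<epsilon> < 1"
    and low: "\<And>z. cmod z < 1 \<Longrightarrow> dist z \<mu> < r \<Longrightarrow> \<epsilon> \<le> cmod (disc_ext \<theta> z)"
  obtains c g where "c \<noteq> 0" "g \<in> Linf" "AE z in circle_measure. (z - \<mu>) * g z = \<theta> z - c"
proof -
  let ?F = "disc_ext \<theta>"
  define \<rho> where "\<rho> j = 1 - inverse (real (Suc (Suc j)))" for j
  have rho01: "0 < \<rho> j" "\<rho> j < 1" for j
    by (simp_all add: \<rho>_def inverse_eq_divide divide_simps)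
  have rho1: "\<rho> \<longlonglongrightarrow> 1"
  proof -
    have "(\<lambda>j. 1 - inverse (real (Suc (Suc j)))) \<longlonglongrightarrow> 1 - 0"
      by (intro tendsto_intros LIMSEQ_Suc[OF LIMSEQ_inverse_real_of_nat])
    then show ?thesis unfolding \<rho>_def[abs_def] by (simp only: diff_zero)
  qed
  have rm: "(\<lambda>j. 1 - radial_mean (\<rho> j)) \<longlonglongrightarrow> 0"
    using tendsto_diff[OF tendsto_const radial_mean_tendsto_1[OF rho01 rho1], of 1] by simp
  have arc: "(\<lambda>j. integral {-a..a} (\<lambda>t. 1 - (cmod (?F (of_real (\<rho> j) * l * cis t)))\<^sup>2)) \<longlonglongrightarrow> 0"
    if "cmod l = 1" "0 < a" "a < 1" for l a
  proof (rule tendsto_sandwich[OF _ _ tendsto_const])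
    show "(\<lambda>j. 8 * pi * (1 - radial_mean (\<rho> j))) \<longlonglongrightarrow> 0"
      using tendsto_mult[OF tendsto_const rm, of "8 * pi"] by simp
  qed (use arc_integral_bound[OF rho01 that] in \<open>auto intro: always_eventually\<close>)
  have "\<exists>C>0. \<exists>r'>0. \<forall>w. cmod w < 1 \<longrightarrow> dist w \<mu> < r' \<longrightarrow> 1 - (cmod (?F w))\<^sup>2 \<le> C * (1 - (cmod w)\<^sup>2)"
  proof (rule boundary_estimate[of ?F \<mu> r \<epsilon> \<rho>])
    show "?F holomorphic_on ball 0 1" by (rule disc_ext_holomorphic[OF Hinf])
    show "cmod (?F z) \<le> 1" if "cmod z < 1" for z by (rule norm_disc_ext_le_1[OF that])
    show "\<epsilon> \<le> cmod (?F z)" if "cmod z < 1" "dist z \<mu> < r" for z by (rule low[OF that])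
    show "(\<lambda>j. integral {-a..a} (\<lambda>t. 1 - (cmod (?F (of_real (\<rho> j) * l * cis t)))\<^sup>2)) \<longlonglongrightarrow> 0"
      if "cmod l = 1" "0 < a" "a < 1" for l a by (rule arc[OF that])
  qed (rule mu r eps rho01 rho1 | blast)+
  then obtain C r' where C: "C > 0" "r' > 0"
    and est: "\<And>w. cmod w < 1 \<Longrightarrow> dist w \<mu> < r' \<Longrightarrow> 1 - (cmod (?F w))\<^sup>2 \<le> C * (1 - (cmod w)\<^sup>2)"
    by blast
  have nk: "(norm (kern w))\<^sup>2 \<le> C" if "cmod w < 1" "dist w \<mu> < r'" for w
    unfolding norm_kern[OF that(1)] using est[OF that] that by (simp add: divide_le_eq abs_square_less_1)
  have lip: "cmod (1 - cnj (?F w) * ?F z) \<le> C * cmod (1 - cnj w * z)"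
    if w: "cmod w < 1" "dist w \<mu> < r'" and z: "cmod z < 1" "dist z \<mu> < r'" for w z
  proof -
    have "norm (kern w) * norm (kern z) \<le> sqrt C * sqrt C"
      using nk[OF w] nk[OF z] by (intro mult_mono real_le_rsqrt) (use C in auto)
    then have "cmod (cinner (kern w) (kern z)) \<le> C"
      using cinner_bound[of "kern w" "kern z"] C by simp
    then have "cmod (1 - cnj (?F w) * ?F z) / cmod (1 - cnj w * z) \<le> C"
      by (simp add: cinner_kern_kern w z norm_divide)
    then show ?thesis
      using szego_denom[of w z] w z by (simp add: divide_le_eq)
  qed
  let ?w = "\<lambda>j. of_real (\<rho> j) * \<mu>"
  have w1: "cmod (?w j) < 1" for j using rho01[of j] mu by (simp add: norm_mult)
  have wlim: "?w \<longlonglongrightarrow> \<mu>"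
    using tendsto_mult[OF tendsto_of_real[OF rho1] tendsto_const[of \<mu>]] by simp
  have "?F (?w j) \<in> cball 0 1" for j using norm_disc_ext_le_1[OF w1] by simp
  \<comment> \<open>A cluster value of \<theta> along the radius to \<mu>; whether a limit exists is
    left open.\<close>
  from compact_cball[of "0::complex" 1, unfolded compact_def, rule_format, of "\<lambda>j. ?F (?w j)", OF this]
  obtain c k where k: "strict_mono k" "((\<lambda>j. ?F (?w j)) \<circ> k) \<longlonglongrightarrow> c"
    by blast
  have wk: "(\<lambda>j. ?w (k j)) \<longlonglongrightarrow> \<mu>" using LIMSEQ_subseq_LIMSEQ[OF wlim k(1)] by (simp add: o_def)
  have Fk: "(\<lambda>j. ?F (?w (k j))) \<longlonglongrightarrow> c" using k(2) by (simp add: o_def)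
  have evk: "eventually (\<lambda>j. dist (?w (k j)) \<mu> < r') sequentially"
    using wk C(2) by (rule tendstoD)
  \<comment> \<open>The right-hand side is 0, so \<open>c\<close> has modulus at least 1 and can be
    inverted.\<close>
  have "1 - (cmod c)\<^sup>2 \<le> C * (1 - (cmod \<mu>)\<^sup>2)"
  proof (rule tendsto_le[OF sequentially_bot])
    show "(\<lambda>j. C * (1 - (cmod (?w (k j)))\<^sup>2)) \<longlonglongrightarrow> C * (1 - (cmod \<mu>)\<^sup>2)" by (intro tendsto_intros wk)
    show "(\<lambda>j. 1 - (cmod (?F (?w (k j))))\<^sup>2) \<longlonglongrightarrow> 1 - (cmod c)\<^sup>2" by (intro tendsto_intros Fk)
    show "eventually (\<lambda>j. 1 - (cmod (?F (?w (k j))))\<^sup>2 \<le> C * (1 - (cmod (?w (k j)))\<^sup>2)) sequentially"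
      using evk by eventually_elim (intro est w1)
  qed
  then have c0: "c \<noteq> 0" using mu by auto
  have cF: "cmod (1 - cnj c * ?F z) \<le> C * cmod (z - \<mu>)" if z: "cmod z < 1" "dist z \<mu> < r'" for z
  proof -
    have "cmod (1 - cnj c * ?F z) \<le> C * cmod (1 - cnj \<mu> * z)"
    proof (rule tendsto_le[OF sequentially_bot])
      show "(\<lambda>j. C * cmod (1 - cnj (?w (k j)) * z)) \<longlonglongrightarrow> C * cmod (1 - cnj \<mu> * z)" by (intro tendsto_intros wk)
      show "(\<lambda>j. cmod (1 - cnj (?F (?w (k j))) * ?F z)) \<longlonglongrightarrow> cmod (1 - cnj c * ?F z)" by (intro tendsto_intros Fk)
      show "eventually (\<lambda>j. cmod (1 - cnj (?F (?w (k j))) * ?F z) \<le> C * cmod (1 - cnj (?w (k j)) * z)) sequentially"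
        using evk by eventually_elim (intro lip w1 z)
    qed
    also have "1 - cnj \<mu> * z = cnj \<mu> * (\<mu> - z)"
      using cnj_mult_self[of \<mu>] mu by (simp add: right_diff_distrib)
    also have "cmod \<dots> = cmod (z - \<mu>)" using mu by (simp add: norm_mult norm_minus_commute)
    finally show ?thesis .
  qed
  \<comment> \<open>The dilates converge to \<theta> in mean square, so a subsequence converges
    almost everywhere. This carries the interior inequality \<open>cF\<close> to the boundary
    function.\<close>
  define u where "u j z = (cmod (\<theta> z - ?F (of_real (\<rho> j) * z)))\<^sup>2" for j z
  have ui: "integrable circle_measure (u j)" for j unfolding u_def by (rule radial_defects(1)[OF rho01])
  have "(\<lambda>j. \<integral>z. norm (u j z) \<partial>circle_measure) \<longlonglongrightarrow> 0"
  proof (rule tendsto_sandwich[OF _ _ tendsto_const])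
    show "(\<lambda>j. 2 * (1 - radial_mean (\<rho> j))) \<longlonglongrightarrow> 0"
      using tendsto_mult[OF tendsto_const rm, of 2] by simp
    have "(\<integral>z. norm (u j z) \<partial>circle_measure) \<le> 2 * (1 - radial_mean (\<rho> j))" for j
      using radial_defects(2)[OF rho01] by (simp add: u_def)
    then show "\<forall>\<^sub>F j in sequentially. (\<integral>z. norm (u j z) \<partial>circle_measure) \<le> 2 * (1 - radial_mean (\<rho> j))" by simp
  qed simp
  from tendsto_L1_AE_subseq[OF ui this] obtain i where i: "strict_mono i"
    and AEu: "AE z in circle_measure. (\<lambda>j. u (i j) z) \<longlonglongrightarrow> 0" by blast
  have bound: "AE z in circle_measure. dist z \<mu> < r' \<longrightarrow> cmod (1 - cnj c * \<theta> z) \<le> C * cmod (z - \<mu>)"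
    using AEu AE_circle_norm
  proof (eventually_elim, intro impI)
    case (elim z)
    assume z: "dist z \<mu> < r'"
    have "(\<lambda>j. sqrt (u (i j) z)) \<longlonglongrightarrow> sqrt 0" by (intro tendsto_real_sqrt elim)
    then have "(\<lambda>j. cmod (?F (of_real (\<rho> (i j)) * z) - \<theta> z)) \<longlonglongrightarrow> 0" by (simp add: u_def norm_minus_commute)
    then have F: "(\<lambda>j. ?F (of_real (\<rho> (i j)) * z)) \<longlonglongrightarrow> \<theta> z" by (simp add: tendsto_norm_zero_iff LIM_zero_iff)
    have "(\<lambda>j. \<rho> (i j)) \<longlonglongrightarrow> 1" using LIMSEQ_subseq_LIMSEQ[OF rho1 i] by (simp add: o_def)
    from tendsto_mult[OF tendsto_of_real[OF this] tendsto_const[of z]]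
    have zl: "(\<lambda>j. of_real (\<rho> (i j)) * z) \<longlonglongrightarrow> z" by simp
    have "(\<lambda>j. dist (of_real (\<rho> (i j)) * z) \<mu>) \<longlonglongrightarrow> dist z \<mu>" by (intro tendsto_intros zl)
    then have ev: "eventually (\<lambda>j. dist (of_real (\<rho> (i j)) * z) \<mu> < r') sequentially"
      using z by (rule order_tendstoD)
    show "cmod (1 - cnj c * \<theta> z) \<le> C * cmod (z - \<mu>)"
    proof (rule tendsto_le[OF sequentially_bot])
      show "(\<lambda>j. C * cmod (of_real (\<rho> (i j)) * z - \<mu>)) \<longlonglongrightarrow> C * cmod (z - \<mu>)" by (intro tendsto_intros zl)
      show "(\<lambda>j. cmod (1 - cnj c * ?F (of_real (\<rho> (i j)) * z))) \<longlonglongrightarrow> cmod (1 - cnj c * \<theta> z)" by (intro tendsto_intros F)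
      show "eventually (\<lambda>j. cmod (1 - cnj c * ?F (of_real (\<rho> (i j)) * z)) \<le> C * cmod (of_real (\<rho> (i j)) * z - \<mu>)) sequentially"
        using ev by eventually_elim (intro cF, use elim rho01 in \<open>simp_all add: norm_mult abs_of_pos\<close>)
    qed
  qed
  define c' where "c' = 1 / cnj c"
  define g where "g z = (\<theta> z - c') / (z - \<mu>)" for z
  have c'0: "c' \<noteq> 0" using c0 by (simp add: c'_def)
  have ce: "cmod (\<theta> z - c') = cmod (1 - cnj c * \<theta> z) / cmod c" for z
  proof -
    have "\<theta> z - c' = - ((1 - cnj c * \<theta> z) / cnj c)" using c0 by (simp add: c'_def field_simps)
    then show ?thesis by (simp add: norm_divide)
  qed
  have AEg: "AE z in circle_measure. cmod (g z) \<le> max (C / cmod c) ((1 + cmod c') / r') \<and> (z - \<mu>) * g z = \<theta> z - c'"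
    using bound AE_norm_theta
  proof eventually_elim
    case (elim z)
    show ?case
    proof (cases "dist z \<mu> < r'")
      case True
      then have b: "cmod (\<theta> z - c') \<le> C / cmod c * cmod (z - \<mu>)"
        using elim c0 by (simp add: ce divide_right_mono)
      show ?thesis
      \<comment> \<open>At \<open>z = \<mu>\<close> division by zero gives \<open>g z = 0\<close>,
        while \<open>b\<close> forces \<open>\<theta> z = c'\<close>, so the identity holds there
        too.\<close>
      proof (cases "z = \<mu>")
        case True
        then show ?thesis using b C c0 by (simp add: g_def le_max_iff_disj)
      next
        case False
        then have "cmod (g z) \<le> C / cmod c" using b by (simp add: g_def norm_divide divide_le_eq)
        then show ?thesis using False by (simp add: g_def)
      qed
    next
      case False
      then have f: "r' \<le> cmod (z - \<mu>)" by (simp add: dist_norm)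
      have "cmod (\<theta> z - c') \<le> 1 + cmod c'" using norm_triangle_ineq4[of "\<theta> z" c'] elim by simp
      then have "cmod (g z) \<le> (1 + cmod c') / r'" unfolding g_def norm_divide using f C by (intro frac_le) auto
      moreover have "z \<noteq> \<mu>" using f C by auto
      ultimately show ?thesis by (simp add: g_def)
    qed
  qed
  have gL: "g \<in> Linf"
  proof (rule LinfI)
    show "g \<in> borel_measurable borel" unfolding g_def by measurable
    show "AE z in circle_measure. cmod (g z) \<le> max (C / cmod c) ((1 + cmod c') / r')"
      using AEg by eventually_elim simp
  qed
  have "AE z in circle_measure. (z - \<mu>) * g z = \<theta> z - c'" using AEg by eventually_elim simp
  with c'0 gL that show ?thesis by blast
qed

text \<open>For negative indices the equation reduces to a recursion with factor \<mu>. All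
  coefficients below a negative index then have the same modulus, and Bessel's inequality forces
  them to vanish.\<close>

lemma theta_quotient_Hinf:
  assumes mu: "cmod \<mu> = 1" and g: "g \<in> Linf" and eq: "AE z in circle_measure. (z - \<mu>) * g z = \<theta> z - c"
  shows "g \<in> Hinf"
proof -
  let ?G = "mult_L2 g one_L2"
  have "mult_L2 (\<lambda>z. z - \<mu>) ?G = mult_L2 (\<lambda>z. \<theta> z - c) one_L2"
    by (subst mult_L2_mult, (intro Linf_intros g)+, rule mult_L2_cong_AE, (intro Linf_intros g Linf)+, rule eq)
  then have "S ?G - \<mu> *\<^sub>C ?G = theta1 - c *\<^sub>C one_L2"
    by (simp add: mult_L2_diff_symbol Linf_id Linf_const Linf theta1_def)
  then have F: "fourier_L2 (S ?G - \<mu> *\<^sub>C ?G) n = fourier_L2 (theta1 - c *\<^sub>C one_L2) n" for n by simp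
  have rec: "fourier_L2 ?G (n - 1) = \<mu> * fourier_L2 ?G n" if "n < 0" for n
    using F[of n] theta1_H2 that by (simp add: fourier_L2_z fourier_L2_one H2_def)
  have cst: "cmod (fourier_L2 ?G (n - int m)) = cmod (fourier_L2 ?G n)" if "n < 0" for n m
  proof (induction m)
    case (Suc m)
    have "fourier_L2 ?G (n - int (Suc m)) = \<mu> * fourier_L2 ?G (n - int m)"
      using rec[of "n - int m"] that by (simp add: algebra_simps)
    then show ?case using Suc mu by (simp add: norm_mult)
  qed simp
  have "fourier_L2 ?G n = 0" if n: "n < 0" for n
  proof (rule ccontr)
    assume nz: "fourier_L2 ?G n \<noteq> 0"
    let ?x = "(cmod (fourier_L2 ?G n))\<^sup>2"
    have "real m * ?x \<le> (norm ?G)\<^sup>2" for m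
    proof -
      \<comment> \<open>\<open>bessel\<close> covers nonnegative indices only. This shift moves the
        coefficients with indices from \<open>n - m + 1\<close> to \<open>n\<close> to the indices
        from 0 to \<open>m - 1\<close>.\<close>
      let ?f = "mult_L2 (\<lambda>z. z powi (int m - 1 - n)) ?G"
      have "norm ?f = norm ?G"
        by (rule norm_mult_L2_unimodular)
           (use AE_circle_norm Linf_powi in \<open>auto simp: unimodular_def norm_power_int elim!: eventually_mono\<close>)
      moreover have "cmod (fourier_L2 ?f (int k)) = cmod (fourier_L2 ?G n)" if "k < m" for k
      proof -
        have e: "int k - (int m - 1 - n) = n - int (m - 1 - k)" using that by simp
        show ?thesis unfolding fourier_L2_mult_powi e by (rule cst[OF n])
      qed
      ultimately show ?thesis using bessel[of ?f m] by simp
    qed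
    moreover have "?x > 0" using nz by simp
    then obtain m where "real m * ?x > (norm ?G)\<^sup>2" using reals_Archimedean3 by blast
    ultimately show False by (meson not_le)
  qed
  then show ?thesis using g by (simp add: Hinf_def fourier_eq[OF g])
qed

text \<open>With \<open>(z - \<mu>) g = \<theta> - c\<close>, compressing the multiplication by \<open>g\<close> inverts \<open>A - \<mu>\<close> up to the
  factor \<open>- c\<close>, since \<open>\<theta>\<close> compresses to \<open>0\<close>.\<close>

lemma compressed_shift_inverse:
  assumes g: "g \<in> Hinf" and c: "c \<noteq> 0" and eq: "AE z in circle_measure. (z - \<mu>) * g z = \<theta> z - c"
  defines "R \<equiv> \<lambda>y. (- inverse c) *\<^sub>C orth_proj K (mult_L2 g y)"
  shows "x \<in> K \<Longrightarrow> R (compressed_shift K x - \<mu> *\<^sub>C x) = x"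
    and "y \<in> K \<Longrightarrow> compressed_shift K (R y) - \<mu> *\<^sub>C R y = y"
proof -
  let ?P = "orth_proj K"
  note gL = Hinf_Linf[OF g]
  have zmu: "(\<lambda>z. z - \<mu>) \<in> Linf" by (intro Linf_intros)
  have mzmu: "mult_L2 (\<lambda>z. z - \<mu>) f = S f - \<mu> *\<^sub>C f" for f
    using mult_L2_diff_symbol[OF Linf_id Linf_const, of \<mu> f] by simp
  have zg: "mult_L2 (\<lambda>z. z - \<mu>) (mult_L2 g f) = mult_L2 \<theta> f - c *\<^sub>C f" for f
  proof -
    have "mult_L2 (\<lambda>z. z - \<mu>) (mult_L2 g f) = mult_L2 (\<lambda>z. \<theta> z - c) f"
      by (subst mult_L2_mult[OF zmu gL], rule mult_L2_cong_AE, (intro Linf_intros gL Linf)+, rule eq)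
    also have "\<dots> = mult_L2 \<theta> f - c *\<^sub>C f"
      by (simp add: mult_L2_diff_symbol Linf Linf_const)
    finally show ?thesis .
  qed
  have Pth: "?P (mult_L2 \<theta> h) = 0" if "h \<in> H2" for h
  proof (rule K.orth_proj_eq_0)
    fix k assume "k \<in> K"
    then show "cinner (mult_L2 \<theta> h) k = 0" using K_orth[OF _ that] by (subst cinner_commute) simp
  qed
  have PK: "?P (mult_L2 \<theta> f - c *\<^sub>C f) = - c *\<^sub>C f" if "f \<in> K" for f
    using that Pth[OF K_H2[OF that]] by (simp add: K.orth_proj_diff K.orth_proj_scaleC)
  have cc: "(- inverse c) *\<^sub>C (- c *\<^sub>C f) = f" for f using c by simp
  show "R (compressed_shift K x - \<mu> *\<^sub>C x) = x" if x: "x \<in> K"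
  proof -
    have "compressed_shift K x - \<mu> *\<^sub>C x = mult_L2 (\<lambda>z. z - \<mu>) x - defect x *\<^sub>C theta1"
      by (simp add: compressed_shift_K x mzmu)
    \<comment> \<open>The overflow term stays harmless: \<open>g\<close> times \<open>theta1\<close>
      is \<theta> times an element of \<open>H2\<close> and compresses to 0.\<close>
    then have "mult_L2 g (compressed_shift K x - \<mu> *\<^sub>C x)
        = (mult_L2 \<theta> x - c *\<^sub>C x) - defect x *\<^sub>C mult_L2 \<theta> (mult_L2 g one_L2)"
      by (simp add: mult_L2_diff mult_L2_scaleC mult_L2_commute[OF gL zmu] zg theta1_def mult_L2_commute[OF gL Linf])
    then have "?P (mult_L2 g (compressed_shift K x - \<mu> *\<^sub>C x)) = - c *\<^sub>C x"
      using PK[OF x] Pth[OF Hinf_mult_H2[OF g one_L2_in_H2]]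
      by (simp only: K.orth_proj_diff K.orth_proj_scaleC) (simp add: K.orth_proj_diff K.orth_proj_scaleC)
    then show ?thesis unfolding R_def by (simp only: cc)
  qed
  show "compressed_shift K (R y) - \<mu> *\<^sub>C R y = y" if y: "y \<in> K"
  proof -
    define v where "v = mult_L2 g y - ?P (mult_L2 g y)"
    have v2: "v \<in> H2" unfolding v_def
      by (intro L2.subspace_diff H2.subspace Hinf_mult_H2 g K_H2 y K.orth_proj_in)
    have vK: "cinner v k = 0" if "k \<in> K" for k unfolding v_def by (rule K.cinner_orth_proj[OF that])
    \<comment> \<open>\<open>v\<close> is orthogonal to \<open>K\<close> and lies in
      \<open>H2\<close>. Applying \<open>cnj z\<close> to an element of \<open>K\<close> leaves
      \<open>K\<close> only along \<open>mono_L2 (-1)\<close>, which is orthogonal to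
      \<open>H2\<close>.\<close>
    have "?P (S v) = 0"
    proof (rule K.orth_proj_eq_0)
      fix k assume k: "k \<in> K"
      have "mult_L2 (\<lambda>z. cnj z) k = bshift k + fourier_L2 k 0 *\<^sub>C mono_L2 (-1)" by (simp add: bshift_def)
      moreover have "cinner v (mono_L2 (-1)) = 0" using v2 by (simp add: H2_def fourier_L2_eq)
      ultimately show "cinner (S v) k = 0" using vK[OF bshift_in_K[OF k]] by (simp add: cinner_z_left)
    qed
    moreover have "?P v = 0" by (rule K.orth_proj_eq_0) (rule vK)
    ultimately have Pv: "?P (mult_L2 (\<lambda>z. z - \<mu>) v) = 0"
      by (simp add: mzmu K.orth_proj_diff K.orth_proj_scaleC)
    have "mult_L2 (\<lambda>z. z - \<mu>) (?P (mult_L2 g y)) = (mult_L2 \<theta> y - c *\<^sub>C y) - mult_L2 (\<lambda>z. z - \<mu>) v"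
      by (simp add: v_def mult_L2_diff zg)
    then have "?P (mult_L2 (\<lambda>z. z - \<mu>) (?P (mult_L2 g y))) = - c *\<^sub>C y"
      by (simp only: K.orth_proj_diff[of "mult_L2 \<theta> y - c *\<^sub>C y"] Pv PK[OF y]) simp
    moreover have "compressed_shift K (R y) - \<mu> *\<^sub>C R y = (- inverse c) *\<^sub>C ?P (mult_L2 (\<lambda>z. z - \<mu>) (?P (mult_L2 g y)))"
      unfolding R_def compressed_shift_def
      by (simp only: mult_L2_scaleC K.orth_proj_scaleC mzmu K.orth_proj_diff K.orth_proj_ident[OF K.orth_proj_in]
          L2.scale_right_diff_distrib L2.scale_scale mult.commute[of \<mu>])
    ultimately show ?thesis by (simp only: cc)
  qed
qed

lemma fredholm_K_on_circle:
  assumes g: "g \<in> Hinf" and c: "c \<noteq> 0" and eq: "AE z in circle_measure. (z - \<mu>) * g z = \<theta> z - c"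
  shows "fredholm_on K (\<lambda>f. compressed_shift K f - \<mu> *\<^sub>C f)"
proof (rule K.fredholm_shiftI[where U = "{}" and V = "{}"])
  let ?R = "\<lambda>y. (- inverse c) *\<^sub>C orth_proj K (mult_L2 g y)"
  let ?T = "\<lambda>f. compressed_shift K f - \<mu> *\<^sub>C f"
  note inv = compressed_shift_inverse[OF g c eq]
  show "x \<in> L2.span {}" if "x \<in> K" "?T x = 0" for x
  proof -
    have "x = ?R 0" using inv(1)[OF that(1)] that(2) by simp
    then show ?thesis using K.orth_proj_ident[OF L2.subspace_0[OF K.subspace]] by simp
  qed
  show "y \<in> ?T ` K" if "y \<in> K" for y
    by (rule image_eqI[of y ?T "?R y"])
       (rule inv(2)[OF that, symmetric], intro L2.subspace_scale K.subspace K.orth_proj_in)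
qed auto

end

section \<open>The dual-band shift at points of the circle where \<theta> is bounded below\<close>

context dual_band
begin

lemma compressed_shift_M:
  assumes "f \<in> K" "h \<in> K"
  shows "compressed_shift M (emb f h) = emb (compressed_shift K f) (compressed_shift K h)
     + (defect f *\<^sub>C orth_proj M (mult_L2 \<phi> theta1) + defect h *\<^sub>C orth_proj M (mult_L2 \<psi> theta1))"
proof -
  have "S (emb f h) = emb (compressed_shift K f) (compressed_shift K h)
     + (defect f *\<^sub>C mult_L2 \<phi> theta1 + defect h *\<^sub>C mult_L2 \<psi> theta1)"
    by (simp add: compressed_shift_K assms mult_L2_add mult_L2_diff mult_L2_scaleC mult_commute_z)
  moreover have "emb (compressed_shift K f) (compressed_shift K h) \<in> M"
    unfolding compressed_shift_def by (intro emb_in_M K.orth_proj_in)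
  ultimately show ?thesis
    unfolding compressed_shift_def[of M]
    by (simp only: M.orth_proj_add[of "emb (compressed_shift K f) (compressed_shift K h)"]
        M.orth_proj_add[of "defect f *\<^sub>C mult_L2 \<phi> theta1"] M.orth_proj_scaleC M.orth_proj_ident)
qed

lemma comp_linear:
  "comp1 (x + y) = comp1 x + comp1 y" "comp2 (x + y) = comp2 x + comp2 y"
  "comp1 (a *\<^sub>C x) = a *\<^sub>C comp1 x" "comp2 (a *\<^sub>C x) = a *\<^sub>C comp2 x"
  by (simp_all add: comp1_def comp2_def mult_L2_add mult_L2_scaleC K.orth_proj_add K.orth_proj_scaleC)

lemma comp_emb_add:
  assumes "f \<in> K" "h \<in> K"
  shows "comp1 (emb f h + y) = f + comp1 y" "comp2 (emb f h + y) = h + comp2 y"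
  by (simp_all only: comp_linear(1,2)[of "emb f h"] comp_emb[OF assms])

text \<open>The operator is an invertible direct sum plus a term of rank at most two built from
  \<open>p\<close> and \<open>q\<close>. Applying \<open>R\<close> in each band confines the kernel
  to a finite span; where the two defects of the candidate preimage vanish, the perturbation does
  not act and the preimage is exact.\<close>

lemma fredholm_M_on_circle:
  assumes g: "g \<in> Hinf" and c: "c \<noteq> 0" and eq: "AE z in circle_measure. (z - \<mu>) * g z = \<theta> z - c"
  shows "fredholm_on M (\<lambda>f. compressed_shift M f - \<mu> *\<^sub>C f)"
proof -
  define R where "R = (\<lambda>y. (- inverse c) *\<^sub>C orth_proj K (mult_L2 g y))"
  have RK: "R y \<in> K" for y unfolding R_def by (intro L2.subspace_scale K.subspace K.orth_proj_in)
  have R1: "x \<in> K \<Longrightarrow> R (compressed_shift K x - \<mu> *\<^sub>C x) = x" for x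
    unfolding R_def by (rule compressed_shift_inverse(1)[OF g c eq])
  have R2: "y \<in> K \<Longrightarrow> compressed_shift K (R y) - \<mu> *\<^sub>C R y = y" for y
    unfolding R_def by (rule compressed_shift_inverse(2)[OF g c eq])
  have Rlin: "R (x + y) = R x + R y" "R (a *\<^sub>C x) = a *\<^sub>C R x" for x y a
    by (simp_all add: R_def mult_L2_add mult_L2_scaleC K.orth_proj_add K.orth_proj_scaleC
        L2.scale_right_distrib mult.commute)
  let ?T = "\<lambda>f. compressed_shift M f - \<mu> *\<^sub>C f"
  define p q where "p = orth_proj M (mult_L2 \<phi> theta1)" and "q = orth_proj M (mult_L2 \<psi> theta1)"
  have T: "?T (emb f h) = emb (compressed_shift K f - \<mu> *\<^sub>C f) (compressed_shift K h - \<mu> *\<^sub>C h)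
      + (defect f *\<^sub>C p + defect h *\<^sub>C q)" if "f \<in> K" "h \<in> K" for f h
    unfolding compressed_shift_M[OF that] p_def q_def
    by (simp add: mult_L2_diff mult_L2_scaleC L2.scale_right_distrib)
  note TK = K.compressed_shift_minus_in[of _ \<mu>]
  \<comment> \<open>The vector representing, up to the factor \<open>- inverse c\<close>, the
    functional \<open>defect (R f)\<close> on \<open>K\<close>, found by moving \<open>z\<close>,
    \<open>g\<close> and the projections to the other side.\<close>
  define u where "u = orth_proj K (mult_L2 (\<lambda>z. cnj (g z)) (orth_proj K (mult_L2 (\<lambda>z. cnj z) theta1)))"
  have uK: "u \<in> K" by (simp add: u_def)
  have dR: "defect (R f) = - inverse c * cinner f u" if "f \<in> K" for f
  proof -
    have "defect (R f) = - inverse c * cinner (orth_proj K (mult_L2 g f)) (mult_L2 (\<lambda>z. cnj z) theta1)"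
      unfolding defect_def R_def cinner_z_left by (rule cinner_scaleC_left)
    also have "cinner (orth_proj K (mult_L2 g f)) (mult_L2 (\<lambda>z. cnj z) theta1)
        = cinner (mult_L2 g f) (orth_proj K (mult_L2 (\<lambda>z. cnj z) theta1))"
      by (rule K.cinner_orth_proj_swap)
    also have "\<dots> = cinner f (mult_L2 (\<lambda>z. cnj (g z)) (orth_proj K (mult_L2 (\<lambda>z. cnj z) theta1)))"
      by (rule cinner_mult_L2[OF Hinf_Linf[OF g]])
    also have "\<dots> = cinner f u" unfolding u_def by (rule K.cinner_orth_proj_right[OF that, symmetric])
    finally show ?thesis .
  qed
  have K0: "0 \<in> K" by (rule L2.subspace_0[OF K.subspace])
  \<comment> \<open>Solving the two band equations for a kernel element expresses each band through
    \<open>R\<close> of the corresponding components of \<open>p\<close> and \<open>q\<close>, with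
    the defects as coefficients.\<close>
  let ?V = "{mult_L2 \<phi> (R (comp1 p)), mult_L2 \<phi> (R (comp1 q)), mult_L2 \<psi> (R (comp2 p)), mult_L2 \<psi> (R (comp2 q))}"
  let ?U = "{mult_L2 \<phi> u, mult_L2 \<psi> u}"
  show ?thesis
  proof (rule M.fredholm_shiftI[where U = ?U and V = ?V])
    show "x \<in> L2.span ?V" if x: "x \<in> M" and T0: "?T x = 0" for x
    proof -
      obtain f h where fh: "f \<in> K" "h \<in> K" "x = emb f h" using x by (rule M_cases)
      have e: "emb (compressed_shift K f - \<mu> *\<^sub>C f) (compressed_shift K h - \<mu> *\<^sub>C h)
          + (defect f *\<^sub>C p + defect h *\<^sub>C q) = 0"
        using T0 unfolding fh(3) T[OF fh(1,2)] .
      have z: "comp1 0 = 0" "comp2 0 = 0" using comp_emb[OF K0 K0] by simp_all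
      have "(compressed_shift K f - \<mu> *\<^sub>C f) + (defect f *\<^sub>C comp1 p + defect h *\<^sub>C comp1 q) = 0"
        using arg_cong[OF e, of comp1] unfolding comp_emb_add[OF TK[OF fh(1)] TK[OF fh(2)]] unfolding comp_linear z .
      then have "R ((compressed_shift K f - \<mu> *\<^sub>C f) + (defect f *\<^sub>C comp1 p + defect h *\<^sub>C comp1 q)) = R 0" by simp
      moreover have R0: "R 0 = 0" using Rlin(2)[of 0 0] by simp
      ultimately have "f + (defect f *\<^sub>C R (comp1 p) + defect h *\<^sub>C R (comp1 q)) = 0"
        unfolding Rlin(1)[of "compressed_shift K f - \<mu> *\<^sub>C f"] R1[OF fh(1)] unfolding Rlin by simp
      then have f: "f = - (defect f *\<^sub>C R (comp1 p) + defect h *\<^sub>C R (comp1 q))"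
        by (simp only: eq_neg_iff_add_eq_0)
      have "(compressed_shift K h - \<mu> *\<^sub>C h) + (defect f *\<^sub>C comp2 p + defect h *\<^sub>C comp2 q) = 0"
        using arg_cong[OF e, of comp2] unfolding comp_emb_add[OF TK[OF fh(1)] TK[OF fh(2)]] unfolding comp_linear z .
      then have "R ((compressed_shift K h - \<mu> *\<^sub>C h) + (defect f *\<^sub>C comp2 p + defect h *\<^sub>C comp2 q)) = R 0" by simp
      then have "h + (defect f *\<^sub>C R (comp2 p) + defect h *\<^sub>C R (comp2 q)) = 0"
        unfolding Rlin(1)[of "compressed_shift K h - \<mu> *\<^sub>C h"] R1[OF fh(2)] unfolding Rlin by (simp only: R0)
      then have h: "h = - (defect f *\<^sub>C R (comp2 p) + defect h *\<^sub>C R (comp2 q))"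
        by (simp only: eq_neg_iff_add_eq_0)
      have neg: "mult_L2 a (- y) = - mult_L2 a y" for a y using mult_L2_diff[of a 0 y] by simp
      have "mult_L2 \<phi> f = - (defect f *\<^sub>C mult_L2 \<phi> (R (comp1 p)) + defect h *\<^sub>C mult_L2 \<phi> (R (comp1 q)))"
        by (subst f) (simp only: neg mult_L2_add mult_L2_scaleC)
      then have "mult_L2 \<phi> f \<in> L2.span ?V"
        by (simp only:) (intro L2.span_neg L2.span_add L2.span_scale L2.span_base, auto)
      moreover have "mult_L2 \<psi> h = - (defect f *\<^sub>C mult_L2 \<psi> (R (comp2 p)) + defect h *\<^sub>C mult_L2 \<psi> (R (comp2 q)))"
        by (subst h) (simp only: neg mult_L2_add mult_L2_scaleC)
      then have "mult_L2 \<psi> h \<in> L2.span ?V"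
        by (simp only:) (intro L2.span_neg L2.span_add L2.span_scale L2.span_base, auto)
      ultimately show ?thesis unfolding fh(3) by (rule L2.span_add)
    qed
    show "y \<in> ?T ` M" if y: "y \<in> M" and U: "\<And>u. u \<in> ?U \<Longrightarrow> cinner y u = 0" for y
    proof -
      obtain f h where fh: "f \<in> K" "h \<in> K" "y = emb f h" using y by (rule M_cases)
      have "cinner f u = 0" "cinner h u = 0"
        using U[of "mult_L2 \<phi> u"] U[of "mult_L2 \<psi> u"] cinner_emb[OF fh(1,2) uK K0] cinner_emb[OF fh(1,2) K0 uK]
        unfolding fh(3) by simp_all
      then have "defect (R f) = 0" "defect (R h) = 0" by (simp_all add: dR fh)
      then have "?T (emb (R f) (R h)) = y"
        unfolding T[OF RK RK] R2[OF fh(1)] R2[OF fh(2)] fh(3) by simp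
      then show ?thesis by (rule image_eqI[OF sym]) (rule emb_in_M[OF RK RK])
    qed
  qed auto
qed

end

section \<open>The essential spectrum\<close>

text \<open>After moving \<psi> to the left the pairing splits in two. The first term pairs
  \<open>f\<close> with \<theta> times \<open>cnj A\<^sub>m * g\<close>, the second pairs \<theta>
  times \<open>A\<^sub>p * f\<close> with \<open>g\<close>; both products lie in
  \<open>\<theta> H2\<close>, which is orthogonal to \<open>K\<close>.\<close>

lemma (in inner_symbol) multiplied_model_spaces_orthogonal:
  assumes "unimodular \<phi>" "unimodular \<psi>" "A\<^sub>p \<in> Hinf" "(\<lambda>z. cnj (A\<^sub>m z)) \<in> Hinf"
    and eq: "AE z in circle_measure. cnj (\<psi> z) * \<phi> z = A\<^sub>m z * cnj (\<theta> z) + A\<^sub>p z * \<theta> z"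
    and f: "f \<in> K" and g: "g \<in> K"
  shows "cinner (mult_L2 \<phi> f) (mult_L2 \<psi> g) = 0"
proof -
  note phi = unimodular_Linf[OF assms(1)] and psi = unimodular_Linf[OF assms(2)] and Ap = Hinf_Linf[OF assms(3)]
  have Am: "A\<^sub>m \<in> Linf" using Linf_cnj[OF Hinf_Linf[OF assms(4)]] by simp
  have "cinner (mult_L2 \<phi> f) (mult_L2 \<psi> g) = cinner (mult_L2 (\<lambda>z. cnj (\<psi> z)) (mult_L2 \<phi> f)) g"
    using cinner_mult_L2[OF Linf_cnj[OF psi], of "mult_L2 \<phi> f" g] by simp
  also have "mult_L2 (\<lambda>z. cnj (\<psi> z)) (mult_L2 \<phi> f) = mult_L2 (\<lambda>z. A\<^sub>m z * cnj (\<theta> z) + A\<^sub>p z * \<theta> z) f"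
    by (subst mult_L2_mult, (intro Linf_intros phi psi)+, rule mult_L2_cong_AE,
        (intro Linf_intros phi psi Am Ap Linf)+, rule eq)
  also have "\<dots> = mult_L2 (\<lambda>z. A\<^sub>m z * cnj (\<theta> z)) f + mult_L2 (\<lambda>z. A\<^sub>p z * \<theta> z) f"
    by (rule mult_L2_add_symbol) (intro Linf_intros Am Ap Linf)+
  also have "cinner \<dots> g = cinner (mult_L2 (\<lambda>z. A\<^sub>m z * cnj (\<theta> z)) f) g + cinner (mult_L2 (\<lambda>z. A\<^sub>p z * \<theta> z) f) g"
    by simp
  also have "cinner (mult_L2 (\<lambda>z. A\<^sub>m z * cnj (\<theta> z)) f) g = cinner f (mult_L2 \<theta> (mult_L2 (\<lambda>z. cnj (A\<^sub>m z)) g))"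
  proof -
    have "cinner (mult_L2 (\<lambda>z. A\<^sub>m z * cnj (\<theta> z)) f) g = cinner f (mult_L2 (\<lambda>z. cnj (A\<^sub>m z * cnj (\<theta> z))) g)"
      by (intro cinner_mult_L2 Linf_intros Am Linf)
    also have "mult_L2 (\<lambda>z. cnj (A\<^sub>m z * cnj (\<theta> z))) g = mult_L2 \<theta> (mult_L2 (\<lambda>z. cnj (A\<^sub>m z)) g)"
      by (subst mult_L2_mult[OF Linf Linf_cnj[OF Am]]) (simp add: mult.commute)
    finally show ?thesis .
  qed
  also have "\<dots> = 0" by (rule K_orth[OF f Hinf_mult_H2[OF assms(4) K_H2[OF g]]])
  also have "mult_L2 (\<lambda>z. A\<^sub>p z * \<theta> z) f = mult_L2 \<theta> (mult_L2 A\<^sub>p f)"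
    by (subst mult_L2_commute[OF Linf Ap]) (simp add: mult_L2_mult[OF Ap Linf])
  also have "cinner (mult_L2 \<theta> (mult_L2 A\<^sub>p f)) g = 0"
    using K_orth[OF g Hinf_mult_H2[OF assms(3) K_H2[OF f]]] by (subst cinner_commute) simp
  finally show ?thesis by simp
qed

text \<open>Translates the extended-real limit inferior into the two inputs of the analysis: a
  sequence for the failure of Fredholmness, a uniform lower bound for the bounded quotient.\<close>

lemma (in inner_symbol) liminf_cases:
  fixes \<mu> :: complex
  assumes mu: "cmod \<mu> = 1"
  shows "Liminf (at \<mu> within ball 0 1) (\<lambda>z. ereal (norm (disc_ext \<theta> z))) = 0 \<Longrightarrow>
      \<exists>w. (\<forall>n. cmod (w n) < 1) \<and> w \<longlonglongrightarrow> \<mu> \<and> (\<forall>n. cmod (disc_ext \<theta> (w n)) \<le> 1 / 2)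
        \<and> (\<lambda>n. disc_ext \<theta> (w n)) \<longlonglongrightarrow> 0"
    and "Liminf (at \<mu> within ball 0 1) (\<lambda>z. ereal (norm (disc_ext \<theta> z))) \<noteq> 0 \<Longrightarrow>
      \<exists>r>0. \<exists>\<epsilon>>0. \<epsilon> < 1 \<and> (\<forall>z. cmod z < 1 \<longrightarrow> dist z \<mu> < r \<longrightarrow> \<epsilon> \<le> cmod (disc_ext \<theta> z))"
proof -
  let ?F = "\<lambda>z. ereal (norm (disc_ext \<theta> z))" and ?A = "at \<mu> within ball 0 1"
  have mub: "\<mu> \<notin> ball 0 1" using mu by simp
  show "\<exists>w. (\<forall>n. cmod (w n) < 1) \<and> w \<longlonglongrightarrow> \<mu> \<and> (\<forall>n. cmod (disc_ext \<theta> (w n)) \<le> 1 / 2)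
        \<and> (\<lambda>n. disc_ext \<theta> (w n)) \<longlonglongrightarrow> 0"
    if L: "Liminf ?A ?F = 0"
  proof -
    have "\<exists>z. cmod z < 1 \<and> dist z \<mu> < e \<and> cmod (disc_ext \<theta> z) < e" if e: "e > 0" for e
    proof (rule ccontr)
      assume neg: "\<not> ?thesis"
      have n: "e \<le> cmod (disc_ext \<theta> z)" if "cmod z < 1" "dist z \<mu> < e" for z
        using neg that by (meson not_le)
      have "eventually (\<lambda>z. ereal e \<le> ?F z) ?A"
        unfolding eventually_at using e by (intro exI[of _ e]) (auto intro: n)
      then have "ereal e \<le> Liminf ?A ?F" by (rule Liminf_bounded)
      then show False using e L by simp
    qed
    \<comment> \<open>The double \<open>Suc\<close> makes the radii start at 1/2, which is the
      smallness required of \<theta> from the first index on.\<close>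
    then have "\<exists>z. cmod z < 1 \<and> dist z \<mu> < inverse (real (Suc (Suc n))) \<and> cmod (disc_ext \<theta> z) < inverse (real (Suc (Suc n)))" for n
      by simp
    then obtain w where w: "\<And>n. cmod (w n) < 1" "\<And>n. dist (w n) \<mu> < inverse (real (Suc (Suc n)))"
      "\<And>n. cmod (disc_ext \<theta> (w n)) < inverse (real (Suc (Suc n)))" by metis
    have i0: "(\<lambda>n. inverse (real (Suc (Suc n)))) \<longlonglongrightarrow> 0"
      by (rule LIMSEQ_Suc[OF LIMSEQ_inverse_real_of_nat])
    have "(\<lambda>n. dist (w n) \<mu>) \<longlonglongrightarrow> 0"
    proof (rule tendsto_sandwich[OF _ _ tendsto_const i0])
      show "\<forall>\<^sub>F n in sequentially. dist (w n) \<mu> \<le> inverse (real (Suc (Suc n)))"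
        by (intro always_eventually allI less_imp_le w)
    qed simp
    then have "w \<longlonglongrightarrow> \<mu>" by (rule tendsto_dist_iff[THEN iffD2])
    moreover have "(\<lambda>n. disc_ext \<theta> (w n)) \<longlonglongrightarrow> 0"
      by (rule Lim_null_comparison[OF _ i0]) (intro always_eventually allI less_imp_le w)
    moreover have "cmod (disc_ext \<theta> (w n)) \<le> 1 / 2" for n
    proof -
      have "inverse (real (Suc (Suc n))) \<le> 1 / 2" by (simp add: field_simps)
      then show ?thesis using w(3)[of n] by linarith
    qed
    ultimately show ?thesis using w(1) by blast
  qed
  show "\<exists>r>0. \<exists>\<epsilon>>0. \<epsilon> < 1 \<and> (\<forall>z. cmod z < 1 \<longrightarrow> dist z \<mu> < r \<longrightarrow> \<epsilon> \<le> cmod (disc_ext \<theta> z))"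
    if L: "Liminf ?A ?F \<noteq> 0"
  proof -
    have "0 \<le> Liminf ?A ?F" by (rule Liminf_bounded) simp
    then have "0 < Liminf ?A ?F" using L by simp
    then obtain y where y: "0 < y" "y < Liminf ?A ?F" using dense by blast
    from less_LiminfD[OF y(2)] have ev: "eventually (\<lambda>z. y < ?F z) ?A" .
    \<comment> \<open>\<open>y\<close> is an extended real; the lower bound has to be a real number,
      and the minimum with 1/2 below keeps it under 1.\<close>
    obtain e where e: "0 < ereal e" "ereal e < y" using ereal_dense2[OF y(1)] by blast
    have e0: "0 < e" using e(1) by simp
    from ev obtain d where d: "d > 0" "\<And>z. z \<in> ball 0 1 \<Longrightarrow> z \<noteq> \<mu> \<Longrightarrow> dist z \<mu> < d \<Longrightarrow> y < ?F z"
      unfolding eventually_at by blast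
    show ?thesis
    proof (rule exI[of _ d], rule conjI[OF d(1)], rule exI[of _ "min e (1/2)"], intro conjI allI impI)
      fix z assume z: "cmod z < 1" "dist z \<mu> < d"
      then have "y < ?F z" using mub by (intro d) auto
      with e(2) have "ereal e < ?F z" by (rule less_trans)
      then show "min e (1/2) \<le> cmod (disc_ext \<theta> z)" by simp
    qed (use e0 in simp_all)
  qed
qed

theorem corollary6p15:
  fixes \<theta> \<phi> \<psi> A\<^sub>p A\<^sub>m :: "complex \<Rightarrow> complex" and M :: "L2 set"
  assumes "inner_fun \<theta>"
    and "unimodular \<phi>" and "unimodular \<psi>"
    and "A\<^sub>p \<in> Hinf" and "(\<lambda>z. cnj (A\<^sub>m z)) \<in> Hinf"
    and "AE z in circle_measure. cnj (\<psi> z) * \<phi> z = A\<^sub>m z * cnj (\<theta> z) + A\<^sub>p z * \<theta> z"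
    and "\<not> (\<exists>c. AE z in circle_measure. \<phi> z * cnj (\<psi> z) = c * \<theta> z)"
    and "\<not> (\<exists>c. AE z in circle_measure. cnj (\<phi> z) * \<psi> z = c * \<theta> z)"
    and "M = dual_band_space \<phi> \<psi> \<theta>"
  shows "essential_spectrum M (compressed_shift M) \<subseteq> sphere 0 1
    \<and> essential_spectrum M (compressed_shift M)
       = essential_spectrum (model_space \<theta>) (compressed_shift (model_space \<theta>))
    \<and> essential_spectrum (model_space \<theta>) (compressed_shift (model_space \<theta>))
       = {\<mu> \<in> sphere 0 1.
            Liminf (at \<mu> within ball 0 1) (\<lambda>z. ereal (norm (disc_ext \<theta> z))) = 0}"
proof -
  interpret inner_symbol \<theta> by standard (rule assms(1))
  interpret D: dual_band \<theta> \<phi> \<psi>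
    by unfold_locales (rule assms(2) assms(3) multiplied_model_spaces_orthogonal[OF assms(2-6)], assumption?)+
  let ?L = "\<lambda>\<mu>. Liminf (at \<mu> within ball 0 1) (\<lambda>z. ereal (norm (disc_ext \<theta> z)))"
  \<comment> \<open>The characterisation is proved for both spaces at once. In each case they share
    the same data: nothing off the circle, the sequence \<open>w\<close> if the limit inferior is 0,
    the multiplier \<open>g\<close> otherwise.\<close>
  have key: "(\<not> fredholm_on N (\<lambda>f. compressed_shift N f - \<mu> *\<^sub>C f)) = (\<mu> \<in> sphere 0 1 \<and> ?L \<mu> = 0)"
    if N: "N = K \<or> N = D.M" for N \<mu>
  proof (cases "cmod \<mu> = 1")
    case False
    then show ?thesis
      using N fredholm_K_off_circle[OF False] D.fredholm_M_off_circle[OF False] False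
      by (elim disjE) simp_all
  next
    case mu: True
    show ?thesis
    proof (cases "?L \<mu> = 0")
      case True
      then obtain w where w: "\<And>n. cmod (w n) < 1" "w \<longlonglongrightarrow> \<mu>" "\<And>n. cmod (disc_ext \<theta> (w n)) \<le> 1 / 2"
        "(\<lambda>n. disc_ext \<theta> (w n)) \<longlonglongrightarrow> 0" using liminf_cases(1)[OF mu] by blast
      show ?thesis
        using N not_fredholm_K[OF w(1,2) mu w(3,4)] D.not_fredholm_M[OF w(1,2) mu w(3,4)] True mu
        by (elim disjE) simp_all
    next
      case False
      then obtain r \<epsilon> where r: "r > 0" and eps: "\<epsilon> > 0" "\<epsilon> < 1"
        and low: "\<And>z. cmod z < 1 \<Longrightarrow> dist z \<mu> < r \<Longrightarrow> \<epsilon> \<le> cmod (disc_ext \<theta> z)"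
        using liminf_cases(2)[OF mu] by blast
      obtain c g where g: "c \<noteq> 0" "g \<in> Linf" "AE z in circle_measure. (z - \<mu>) * g z = \<theta> z - c"
        by (rule theta_quotient_bounded[OF mu r eps low])
      have gH: "g \<in> Hinf" by (rule theta_quotient_Hinf[OF mu g(2,3)])
      show ?thesis
        using N fredholm_K_on_circle[OF gH g(1,3)] D.fredholm_M_on_circle[OF gH g(1,3)] False
        by (elim disjE) simp_all
    qed
  qed
  have ess: "essential_spectrum N (compressed_shift N) = {\<mu> \<in> sphere 0 1. ?L \<mu> = 0}" if "N = K \<or> N = D.M" for N
    unfolding essential_spectrum_def key[OF that] ..
  have "essential_spectrum K (compressed_shift K) = {\<mu> \<in> sphere 0 1. ?L \<mu> = 0}"
    "essential_spectrum D.M (compressed_shift D.M) = {\<mu> \<in> sphere 0 1. ?L \<mu> = 0}"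
    by (rule ess, simp)+
  then show ?thesis unfolding assms(9) by blast
qed

end
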